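(* Let $R$ be a $GL(m)$-type R-matrix, $\eta\in\mathbb K\setminus\{0\}$, and let $\mathcal B_r(\mathcal L(R),\mathcal M(R))$ be the unital associative algebra generated by the entries of two matrices $L$ and $M$ subject to $$R_1M_1R_1M_1=M_1R_1M_1R_1,\quad R_1L_1R_1L_1=L_1R_1L_1R_1,\quad R_1L_1R_1M_1=\eta\,M_1R_1L_1R_1^{-1},$$ extended by the inverses $a_m(L)^{-1}$ and $a_m(M)^{-1}$ (so that $L$ and $M$ are invertible matrices). Put $$Q=LM^{-1}L^{-1}M,\qquad \mathsf N=M^{-1}Q.$$ Then the matrix elements of $Q$ and $M$ satisfy $$R_1M_1R_1M_1-M_1R_1M_1R_1=0,\quad R_1Q_1R_1Q_1-Q_1R_1Q_1R_1=0,\quad R_1Q_1R_1M_1-M_1R_1Q_1R_1=0,$$ and the matrix elements of $M$ and $\mathsf N$ satisfy $$R_1M_1R_1M_1-M_1R_1M_1R_1=0,\quad R_1\mathsf N_1R_1\mathsf N_1-\mathsf N_1R_1\mathsf N_1R_1=0,\quad R_1^{-1}\mathsf N_1R_1M_1-M_1R_1^{-1}\mathsf N_1R_1=0.$$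
   Context: $\mathbb K$ is $\mathbb C$ or $\mathbb R$; $V$ is a vector space over $\mathbb K$ of finite dimension $n$ with a fixed basis $x_1,\dots,x_n$; operators are identified with numerical matrices by $R(x_i\otimes x_j)=R_{ij}^{\,rs}x_r\otimes x_s$, and $(AB)_i^{\,j}=\sum_kA_i^{\,k}B_k^{\,j}$. For $X\in\mathrm{End}(V^{\otimes 2})$, $X_i$ denotes $X$ acting in the tensor factors $i,i+1$; for an $n\times n$ matrix $A$ with entries in an algebra, $A_1=A\otimes I\otimes\cdots\otimes I$. The matrices $L=\|L_i^{\,j}\|$ and $M=\|M_i^{\,j}\|$ are $n\times n$. R-matrix: an invertible $R\in\mathrm{End}(V^{\otimes 2})$ with $R_1R_2R_1=R_2R_1R_2$. Hecke type: in addition $(R-qI)(R+q^{-1}I)=0$, with $q\in\mathbb K\setminus\{0\}$ generic (either $q=1$ or $q^k\ne1$ for all $k\in\mathbb N$); $k_q=q^{k-1}+q^{k-3}+\dots+q^{1-k}$. The $q$-antisymmetrizers are $A_1(R)=I$, $A_{k+1}(R)=\frac{1}{(k+1)_q}A_k(R)\,(q^kI-k_qR_k)\,A_k(R)\in\mathrm{End}(V^{\otimes(k+1)})$. A Hecke type $R$ is of $GL(m)$-type if $A_m(R)$ is a rank one projector and $A_{m+1}(R)=0$. Such $R$ is skew-invertible: there is $\Psi_R\in\mathrm{End}(V^{\otimes2})$ with $\mathrm{Tr}_{(2)}R_{12}(\Psi_R)_{23}=P_{13}=\mathrm{Tr}_{(2)}(\Psi_R)_{12}R_{23}$ ($P$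 the flip). Put $C=\mathrm{Tr}_{(2)}(\Psi_R)_{12}$. For $X=L$ or $X=M$, $X_{\overline1}=X_1$, $X_{\overline{k+1}}=R_kX_{\overline k}R_k^{-1}$, and $a_m(X)=\mathrm{Tr}_{(1\dots m)}\big(C_1C_2\cdots C_m\,X_{\overline 1}X_{\overline2}\cdots X_{\overline m}\,A_m(R)\big)$. By the Cayley-Hamilton identity for $X$, invertibility of $a_m(X)$ guarantees invertibility of the matrix $X$. *)

theory Defs
  imports Complex_Main "HOL-Algebra.Algebraic_Closure_Type" "HOL-Algebra.QuotRing"
    "HOL-Library.Poly_Mapping" "HOL-Library.Function_Algebras"
begin

section \<open>Matrices over tensor powers\<close>

text \<open>
  The basis of the space \<open>V\<close> is indexed by a finite type \<open>'n\<close>, so \<open>dim V = CARD('n)\<close>. A basis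
  vector of the \<open>k\<close>-th tensor power of \<open>V\<close> is a list of length \<open>k\<close>. An element of
  \<open>End(V^{\<otimes>k}) \<otimes> A\<close> is a matrix \<open>Y\<close>, where \<open>Y (I, J)\<close> is the entry with lower (row) multi-index
  \<open>I\<close> and upper (column) multi-index \<open>J\<close>. Tensor factors are numbered from 1.
\<close>

type_synonym ('n, 'b) tm = "'n list \<times> 'n list \<Rightarrow> 'b"

definition idx :: "nat \<Rightarrow> 'n list set" where
  "idx k = {I. length I = k}"

definition tmat :: "('b, 'c) ring_scheme \<Rightarrow> nat \<Rightarrow> ('n::finite, 'b) tm ring" where
  "tmat A k = \<lparr>
     carrier = idx k \<times> idx k \<rightarrow>\<^sub>E carrier A,
     monoid.mult = (\<lambda>Y Z. \<lambda>(I, J)\<in>idx k \<times> idx k. \<Oplus>\<^bsub>A\<^esub>H\<in>idx k. Y (I, H) \<otimes>\<^bsub>A\<^esub> Z (H, J)),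
     one = (\<lambda>(I, J)\<in>idx k \<times> idx k. if I = J then \<one>\<^bsub>A\<^esub> else \<zero>\<^bsub>A\<^esub>),
     zero = (\<lambda>(I, J)\<in>idx k \<times> idx k. \<zero>\<^bsub>A\<^esub>),
     add = (\<lambda>Y Z. \<lambda>(I, J)\<in>idx k \<times> idx k. Y (I, J) \<oplus>\<^bsub>A\<^esub> Z (I, J))\<rparr>"

text \<open>The matrix \<open>c I\<close> for a ring element \<open>c\<close>.\<close>

definition scal :: "('b, 'c) ring_scheme \<Rightarrow> nat \<Rightarrow> 'b \<Rightarrow> ('n, 'b) tm" where
  "scal A k c = (\<lambda>(I, J)\<in>idx k \<times> idx k. if I = J then c else \<zero>\<^bsub>A\<^esub>)"

text \<open>
  \<open>leg A j k i Y\<close> is \<open>Y \<in> End(V^{\<otimes>j}) \<otimes> A\<close> acting in the factors \<open>i, \<dots>, i + j - 1\<close> of \<open>V^{\<otimes>k}\<close>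
  (for \<open>1 \<le> i\<close> and \<open>i + j - 1 \<le> k\<close>).
\<close>

definition leg :: "('b, 'c) ring_scheme \<Rightarrow> nat \<Rightarrow> nat \<Rightarrow> nat \<Rightarrow> ('n, 'b) tm \<Rightarrow> ('n, 'b) tm" where
  "leg A j k i Y = (\<lambda>(I, J)\<in>idx k \<times> idx k.
     if take (i - 1) I = take (i - 1) J \<and> drop (i - 1 + j) I = drop (i - 1 + j) J
     then Y (take j (drop (i - 1) I), take j (drop (i - 1) J)) else \<zero>\<^bsub>A\<^esub>)"

text \<open>Trace over all \<open>k\<close> factors, and trace over the \<open>i\<close>-th one of \<open>k + 1\<close> factors.\<close>

definition tr :: "('b, 'c) ring_scheme \<Rightarrow> nat \<Rightarrow> ('n::finite, 'b) tm \<Rightarrow> 'b" where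
  "tr A k Y = (\<Oplus>\<^bsub>A\<^esub>I\<in>idx k. Y (I, I))"

definition ptr :: "('b, 'c) ring_scheme \<Rightarrow> nat \<Rightarrow> nat \<Rightarrow> ('n::finite, 'b) tm \<Rightarrow> ('n, 'b) tm" where
  "ptr A k i Y = (\<lambda>(I, J)\<in>idx k \<times> idx k.
     \<Oplus>\<^bsub>A\<^esub>a\<in>UNIV. Y (take (i - 1) I @ a # drop (i - 1) I, take (i - 1) J @ a # drop (i - 1) J))"

definition map_tm :: "nat \<Rightarrow> ('b \<Rightarrow> 'd) \<Rightarrow> ('n, 'b) tm \<Rightarrow> ('n, 'd) tm" where
  "map_tm k h Y = (\<lambda>p\<in>idx k \<times> idx k. h (Y p))"

definition ordered_prod :: "('b, 'c) monoid_scheme \<Rightarrow> 'b list \<Rightarrow> 'b" where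
  "ordered_prod G xs = foldr (\<otimes>\<^bsub>G\<^esub>) xs \<one>\<^bsub>G\<^esub>"


section \<open>R-matrices of \<open>GL(m)\<close>-type\<close>

text \<open>
  The definitions make sense over any field. By the Gelfand--Mazur theorem the fields of class
  \<^class>\<open>real_normed_field\<close> are, up to isomorphism, exactly the reals and the complex numbers.
\<close>

abbreviation base :: "'k::field ring" where
  "base \<equiv> ring_of_type_algebra"

definition R_matrix :: "('n::finite, 'k::field) tm \<Rightarrow> bool" where
  "R_matrix R \<longleftrightarrow> R \<in> Units (tmat base 2) \<and>
     (let R1 = leg base 2 3 1 R; R2 = leg base 2 3 2 R in
      R1 \<otimes>\<^bsub>tmat base 3\<^esub> R2 \<otimes>\<^bsub>tmat base 3\<^esub> R1 = R2 \<otimes>\<^bsub>tmat base 3\<^esub> R1 \<otimes>\<^bsub>tmat base 3\<^esub> R2)"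

definition generic :: "'k::field \<Rightarrow> bool" where
  "generic q \<longleftrightarrow> q \<noteq> 0 \<and> (q = 1 \<or> (\<forall>k\<ge>1. q ^ k \<noteq> 1))"

definition Hecke_type :: "('n::finite, 'k::field) tm \<Rightarrow> 'k \<Rightarrow> bool" where
  "Hecke_type R q \<longleftrightarrow> R_matrix R \<and> generic q \<and>
     (R \<ominus>\<^bsub>tmat base 2\<^esub> scal base 2 q) \<otimes>\<^bsub>tmat base 2\<^esub> (R \<oplus>\<^bsub>tmat base 2\<^esub> scal base 2 (inverse q))
       = \<zero>\<^bsub>tmat base 2\<^esub>"

definition qnum :: "'k::field \<Rightarrow> nat \<Rightarrow> 'k" where
  "qnum q k = (\<Sum>i<k. q powi (int k - 1 - 2 * int i))"

text \<open>The \<open>q\<close>-antisymmetrizers \<open>A_k(R)\<close>, \<open>k \<ge> 1\<close>; the value at 0 is a dummy.\<close>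

fun asym :: "'k::field \<Rightarrow> ('n::finite, 'k) tm \<Rightarrow> nat \<Rightarrow> ('n, 'k) tm" where
  "asym q R 0 = \<one>\<^bsub>tmat base 0\<^esub>"
| "asym q R (Suc 0) = \<one>\<^bsub>tmat base 1\<^esub>"
| "asym q R (Suc (Suc l)) =
    (let k = Suc l; T = tmat base (k + 1); A = leg base k (k + 1) 1 (asym q R k) in
     scal base (k + 1) (1 / qnum q (k + 1)) \<otimes>\<^bsub>T\<^esub>
       (A \<otimes>\<^bsub>T\<^esub> (scal base (k + 1) (q ^ k) \<ominus>\<^bsub>T\<^esub>
           scal base (k + 1) (qnum q k) \<otimes>\<^bsub>T\<^esub> leg base 2 (k + 1) k R) \<otimes>\<^bsub>T\<^esub> A))"

text \<open>
  Since \<open>x_I \<mapsto> \<Sum>J. Y (I, J) x_J\<close>, the image of the operator with matrix \<open>Y\<close> is spanned by the rows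
  of \<open>Y\<close>.
\<close>

definition tm_rank :: "nat \<Rightarrow> ('n, 'k::field) tm \<Rightarrow> nat" where
  "tm_rank k Y = vector_space.dim (\<lambda>c (v :: 'n list \<Rightarrow> 'k) J. c * v J)
     ((\<lambda>I J. if J \<in> idx k then Y (I, J) else 0) ` idx k)"

definition GL_type :: "('n::finite, 'k::field) tm \<Rightarrow> 'k \<Rightarrow> nat \<Rightarrow> bool" where
  "GL_type R q m \<longleftrightarrow> Hecke_type R q \<and> m \<ge> 1 \<and>
     asym q R m \<otimes>\<^bsub>tmat base m\<^esub> asym q R m = asym q R m \<and> tm_rank m (asym q R m) = 1 \<and>
     asym q R (m + 1) = \<zero>\<^bsub>tmat base (m + 1)\<^esub>"

definition flip :: "('n, 'k::field) tm" where
  "flip = (\<lambda>(I, J)\<in>idx 2 \<times> idx 2. if J = rev I then 1 else 0)"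

definition is_skew_inverse :: "('n::finite, 'k::field) tm \<Rightarrow> ('n, 'k) tm \<Rightarrow> bool" where
  "is_skew_inverse R \<Psi> \<longleftrightarrow> \<Psi> \<in> carrier (tmat base 2) \<and>
     ptr base 2 2 (leg base 2 3 1 R \<otimes>\<^bsub>tmat base 3\<^esub> leg base 2 3 2 \<Psi>) = flip \<and>
     ptr base 2 2 (leg base 2 3 1 \<Psi> \<otimes>\<^bsub>tmat base 3\<^esub> leg base 2 3 2 R) = flip"

text \<open>Either of the two trace equations determines \<open>\<Psi>\<close>.\<close>

definition skew_inverse :: "('n::finite, 'k::field) tm \<Rightarrow> ('n, 'k) tm" where
  "skew_inverse R = (THE \<Psi>. is_skew_inverse R \<Psi>)"

definition Cmat :: "('n::finite, 'k::field) tm \<Rightarrow> ('n, 'k) tm" where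
  "Cmat R = ptr base 1 2 (skew_inverse R)"


section \<open>Free algebras\<close>

datatype 'g word = Word "'g list"

instantiation word :: (type) monoid_add
begin

definition zero_word :: "'a word" where "zero_word = Word []"

fun plus_word :: "'a word \<Rightarrow> 'a word \<Rightarrow> 'a word" where
  "plus_word (Word u) (Word v) = Word (u @ v)"

instance
proof
  fix a b c :: "'a word"
  show "a + b + c = a + (b + c)" by (cases a; cases b; cases c) simp
  show "0 + a = a" by (cases a) (simp add: zero_word_def)
  show "a + 0 = a" by (cases a) (simp add: zero_word_def)
qed

end

text \<open>
  The free unital associative algebra on \<open>'g\<close> is the monoid algebra of the free monoid, with the
  convolution product of \<^theory>\<open>HOL-Library.Poly_Mapping\<close>.
\<close>

type_synonym ('g, 'k) free_alg = "'g word \<Rightarrow>\<^sub>0 'k"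

definition gen :: "'g \<Rightarrow> ('g, 'k::field) free_alg" where
  "gen g = Poly_Mapping.single (Word [g]) 1"

definition const :: "'k::field \<Rightarrow> ('g, 'k) free_alg" where
  "const c = Poly_Mapping.single 0 c"

abbreviation free :: "('g, 'k::field) free_alg ring" where
  "free \<equiv> ring_of_type_algebra"


section \<open>The algebra \<open>B_r(L(R), M(R))\<close>\<close>

text \<open>\<open>InvL\<close> and \<open>InvM\<close> are the adjoined inverses of \<open>a_m(L)\<close> and \<open>a_m(M)\<close>.\<close>

datatype 'n gens = GenL 'n 'n | GenM 'n 'n | InvL | InvM

definition gen_mat :: "('n \<Rightarrow> 'n \<Rightarrow> 'n gens) \<Rightarrow> ('n, ('n gens, 'k::field) free_alg) tm" where
  "gen_mat G = (\<lambda>(I, J)\<in>idx 1 \<times> idx 1. gen (G (hd I) (hd J)))"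

text \<open>\<open>bar R m Y k\<close> is the matrix \<open>Y\<close> with barred index \<open>k \<ge> 1\<close>, in \<open>m\<close> factors; the value at 0 is a dummy.\<close>

fun bar :: "('n::finite, 'k::field) tm \<Rightarrow> nat \<Rightarrow> ('n, ('g, 'k) free_alg) tm \<Rightarrow> nat
    \<Rightarrow> ('n, ('g, 'k) free_alg) tm" where
  "bar R m Y 0 = \<one>\<^bsub>tmat free m\<^esub>"
| "bar R m Y (Suc 0) = leg free 1 m 1 Y"
| "bar R m Y (Suc (Suc l)) =
    (let k = Suc l; T = tmat free m; Rk = leg base 2 m k R in
     map_tm m const Rk \<otimes>\<^bsub>T\<^esub> bar R m Y k \<otimes>\<^bsub>T\<^esub> map_tm m const (inv\<^bsub>tmat base m\<^esub> Rk))"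

text \<open>The element \<open>a_m(Y)\<close>.\<close>

definition a_elem :: "('n::finite, 'k::field) tm \<Rightarrow> 'k \<Rightarrow> nat \<Rightarrow> ('n, ('g, 'k) free_alg) tm
    \<Rightarrow> ('g, 'k) free_alg" where
  "a_elem R q m Y =
    (let T = tmat free m in
     tr free m
       (ordered_prod T (map (\<lambda>i. map_tm m const (leg base 1 m i (Cmat R))) [1..<m + 1]) \<otimes>\<^bsub>T\<^esub>
        ordered_prod T (map (bar R m Y) [1..<m + 1]) \<otimes>\<^bsub>T\<^esub>
        map_tm m const (asym q R m)))"

definition Br_relators :: "('n::finite, 'k::field) tm \<Rightarrow> 'k \<Rightarrow> nat \<Rightarrow> 'k \<Rightarrow> ('n gens, 'k) free_alg set" where
  "Br_relators R q m \<eta> =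
    (let T = tmat free 2;
         L = gen_mat GenL; M = gen_mat GenM;
         R1 = map_tm 2 const R; R1' = map_tm 2 const (inv\<^bsub>tmat base 2\<^esub> R);
         L1 = leg free 1 2 1 L; M1 = leg free 1 2 1 M;
         aL = a_elem R q m L; aM = a_elem R q m M in
     (R1 \<otimes>\<^bsub>T\<^esub> M1 \<otimes>\<^bsub>T\<^esub> R1 \<otimes>\<^bsub>T\<^esub> M1 \<ominus>\<^bsub>T\<^esub> M1 \<otimes>\<^bsub>T\<^esub> R1 \<otimes>\<^bsub>T\<^esub> M1 \<otimes>\<^bsub>T\<^esub> R1) ` (idx 2 \<times> idx 2) \<union>
     (R1 \<otimes>\<^bsub>T\<^esub> L1 \<otimes>\<^bsub>T\<^esub> R1 \<otimes>\<^bsub>T\<^esub> L1 \<ominus>\<^bsub>T\<^esub> L1 \<otimes>\<^bsub>T\<^esub> R1 \<otimes>\<^bsub>T\<^esub> L1 \<otimes>\<^bsub>T\<^esub> R1) ` (idx 2 \<times> idx 2) \<union>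
     (R1 \<otimes>\<^bsub>T\<^esub> L1 \<otimes>\<^bsub>T\<^esub> R1 \<otimes>\<^bsub>T\<^esub> M1 \<ominus>\<^bsub>T\<^esub>
        scal free 2 (const \<eta>) \<otimes>\<^bsub>T\<^esub> (M1 \<otimes>\<^bsub>T\<^esub> R1 \<otimes>\<^bsub>T\<^esub> L1 \<otimes>\<^bsub>T\<^esub> R1')) ` (idx 2 \<times> idx 2) \<union>
     {aL * gen InvL - 1, gen InvL * aL - 1, aM * gen InvM - 1, gen InvM * aM - 1})"

text \<open>
  The quotient of the free algebra by the two-sided ideal generated by the relators. As a ring ideal
  of a unital algebra it is closed under scalars.
\<close>

definition Br_ideal :: "('n::finite, 'k::field) tm \<Rightarrow> 'k \<Rightarrow> nat \<Rightarrow> 'k \<Rightarrow> ('n gens, 'k) free_alg set" where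
  "Br_ideal R q m \<eta> = genideal free (Br_relators R q m \<eta>)"

definition Br :: "('n::finite, 'k::field) tm \<Rightarrow> 'k \<Rightarrow> nat \<Rightarrow> 'k \<Rightarrow> ('n gens, 'k) free_alg set ring" where
  "Br R q m \<eta> = free Quot Br_ideal R q m \<eta>"

definition Br_class :: "('n::finite, 'k::field) tm \<Rightarrow> 'k \<Rightarrow> nat \<Rightarrow> 'k \<Rightarrow>
    ('n gens, 'k) free_alg \<Rightarrow> ('n gens, 'k) free_alg set" where
  "Br_class R q m \<eta> x = Br_ideal R q m \<eta> +>\<^bsub>free\<^esub> x"

end

theory Submission
  imports Defs "HOL-Analysis.Cartesian_Space"
begin

text \<open>
  Write \<open>R\<close>, \<open>M\<close>, \<open>L\<close> for the matrices in two tensor factors and \<open>W = R Q R\<close>. Once \<open>L\<close> and \<open>M\<close>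
  are invertible, the three defining relations say that \<open>W\<close> commutes with \<open>M\<close> and with \<open>L\<close> (the
  factor \<open>\<eta>\<close> cancels), hence with \<open>Q\<close>; the relations for \<open>Q\<close> and \<open>N\<close> follow by computing in the
  group of units.

  Invertibility of \<open>X = L, M\<close> is obtained without the Cayley--Hamilton identity. The product \<open>P\<close> of
  the barred copies of \<open>X\<close> commutes with every \<open>R\<^sub>i\<close>, hence with the rank one projector
  \<open>A = A\<^sub>m(R) = u v\<close>, so that \<open>P A = A det\<close> for a single element \<open>det\<close>, and \<open>a\<^sub>m(X)\<close> is a scalar
  multiple of \<open>det\<close>, whatever the matrix \<open>C\<close> is. Since \<open>P\<close> begins with \<open>X\<^sub>1\<close>, and ends with \<open>X\<^sub>1\<close>
  after multiplication by \<open>R\<^sub>m\<^sub>-\<^sub>1 \<cdots> R\<^sub>1\<close>, contracting \<open>P A = A det\<close> gives a right and a left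
  inverse of \<open>X\<close> as soon as \<open>u\<close> and \<open>v\<close> are nondegenerate in their first tensor factor. The
  vanishing of \<open>A\<^sub>m\<^sub>+\<^sub>1\<close> implies \<open>A\<^sub>1\<^sub>.\<^sub>.\<^sub>m A\<^sub>2\<^sub>.\<^sub>.\<^sub>m\<^sub>+\<^sub>1 A\<^sub>1\<^sub>.\<^sub>.\<^sub>m = m\<^sub>q\<^sup>-\<^sup>2 A\<^sub>1\<^sub>.\<^sub>.\<^sub>m\<close>, and
  nondegeneracy is read off from the entries of this identity.
\<close>

section \<open>Finite sums and multi-indices\<close>

text \<open>The entries of \<open>L\<close> and \<open>M\<close> do not commute, so for matrices
  over \<open>Br\<close> neither the usual determinant nor the passage from a one-sided to a
  two-sided inverse is available. Matrix inversion is therefore pushed to the scalar field, where a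
  left inverse of a square matrix is a right inverse, and in \<open>Br\<close> only single elements
  are inverted: \<open>det\<close> is a unit because a central scalar multiple of it is one. The
  antisymmetrizers are treated through \<open>R_i + 1/q\<close> instead of \<open>R_i\<close>. The
  basic fact is that \<open>A\<close> is killed by these elements on both sides; idempotence,
  absorption of smaller antisymmetrizers and the eigenvalue \<open>-1/q\<close> of
  \<open>R_i\<close> all follow from it. The constant \<open>1/m_q^2\<close> originates in the
  identity \<open>m_q^2 - (m-1)_q (m+1)_q = 1\<close>. The same computations are needed in several
  tensor powers, with shifted factors, and over both the field and \<open>Br\<close>. They are
  therefore done for abstract generators in rings, monoids and groups, and carried over by the
  homomorphisms \<open>leg\<close> and \<open>map_tm\<close>.\<close>

lemma finite_idx [simp]: "finite (idx k :: 'n::finite list set)"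
  using finite_lists_length_eq[of "UNIV :: 'n set" k] by (simp add: idx_def)

lemma append_in_idx: "I \<in> idx i \<Longrightarrow> J \<in> idx j \<Longrightarrow> k = i + j \<Longrightarrow> I @ J \<in> idx k"
  by (simp add: idx_def)

lemma idx_split:
  assumes "I \<in> idx k" "k = i + j + l"
  obtains a b c where "I = a @ b @ c" "a \<in> idx i" "b \<in> idx j" "c \<in> idx l"
proof
  show "I = take i I @ take j (drop i I) @ drop j (drop i I)"
    by (metis append_take_drop_id)
qed (use assms in \<open>auto simp: idx_def\<close>)

lemma ring_type_algebra [simp]:
  "carrier (ring_of_type_algebra :: 'a::ring_1 ring) = UNIV"
  "x \<otimes>\<^bsub>ring_of_type_algebra\<^esub> y = x * (y :: 'a)"
  "x \<oplus>\<^bsub>ring_of_type_algebra\<^esub> y = x + (y :: 'a)"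
  "\<one>\<^bsub>ring_of_type_algebra\<^esub> = (1 :: 'a)"
  "\<zero>\<^bsub>ring_of_type_algebra\<^esub> = (0 :: 'a)"
  by (simp_all add: ring_of_type_algebra_def)

lemma ring_ring_of_type_algebra: "ring (ring_of_type_algebra :: 'a::ring_1 ring)"
proof -
  have "\<exists>y. x + y = 0" for x :: 'a
    using add.right_inverse by blast
  thus ?thesis
    unfolding ring_of_type_algebra_def using add.right_inverse
    by unfold_locales (auto simp: algebra_simps Units_def)
qed

lemma finsum_ring_of_type_algebra [simp]:
  "finsum (ring_of_type_algebra :: 'a::ring_1 ring) f A = sum f A"
proof -
  interpret ring "ring_of_type_algebra :: 'a ring" by (rule ring_ring_of_type_algebra)
  show ?thesis
    by (induction A rule: infinite_finite_induct) simp_all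
qed

lemma (in abelian_monoid) finsum_swap:
  assumes "finite A" "finite B" "\<And>a b. a \<in> A \<Longrightarrow> b \<in> B \<Longrightarrow> f a b \<in> carrier G"
  shows "(\<Oplus>a\<in>A. \<Oplus>b\<in>B. f a b) = (\<Oplus>b\<in>B. \<Oplus>a\<in>A. f a b)"
  using assms(1,3)
proof (induction A rule: finite_induct)
  case (insert x A)
  then have "(\<Oplus>a\<in>insert x A. \<Oplus>b\<in>B. f a b) = (\<Oplus>b\<in>B. f x b) \<oplus> (\<Oplus>b\<in>B. \<Oplus>a\<in>A. f a b)"
    by (simp add: Pi_def)
  also have "\<dots> = (\<Oplus>b\<in>B. f x b \<oplus> (\<Oplus>a\<in>A. f a b))"
    using insert by (simp add: finsum_addf Pi_def)
  also have "\<dots> = (\<Oplus>b\<in>B. \<Oplus>a\<in>insert x A. f a b)"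
    using insert by (intro finsum_cong') (auto simp: Pi_def)
  finally show ?case .
qed (use assms(2) in simp)

lemma (in abelian_monoid) finsum_delta:
  assumes "finite A" "i \<in> A" "f \<in> A \<rightarrow> carrier G" "\<And>j. j \<in> A \<Longrightarrow> j \<noteq> i \<Longrightarrow> f j = \<zero>"
  shows "finsum G f A = f i"
proof -
  have "finsum G f A = (\<Oplus>j\<in>A. if i = j then f j else \<zero>)"
    using assms by (intro finsum_cong') auto
  also have "\<dots> = f i"
    using assms by (intro finsum_singleton) auto
  finally show ?thesis .
qed

lemma ring_hom_finsum:
  assumes "ring A" "ring A'" "h \<in> ring_hom A A'" "f \<in> S \<rightarrow> carrier A"
  shows "h (finsum A f S) = finsum A' (h \<circ> f) S"
proof -
  interpret ring_hom_ring A A' h by (rule ring_hom_ringI2[OF assms(1-3)])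
  show ?thesis
    using assms(4)
  proof (induction S rule: infinite_finite_induct)
    case (insert x S)
    then show ?case by (simp add: Pi_def)
  qed (simp_all)
qed

section \<open>Matrix rings\<close>

lemma tmat_simps:
  "carrier (tmat A k) = idx k \<times> idx k \<rightarrow>\<^sub>E carrier A"
  "Y \<otimes>\<^bsub>tmat A k\<^esub> Z = (\<lambda>(I, J)\<in>idx k \<times> idx k. \<Oplus>\<^bsub>A\<^esub>H\<in>idx k. Y (I, H) \<otimes>\<^bsub>A\<^esub> Z (H, J))"
  "\<one>\<^bsub>tmat A k\<^esub> = (\<lambda>(I, J)\<in>idx k \<times> idx k. if I = J then \<one>\<^bsub>A\<^esub> else \<zero>\<^bsub>A\<^esub>)"
  "\<zero>\<^bsub>tmat A k\<^esub> = (\<lambda>(I, J)\<in>idx k \<times> idx k. \<zero>\<^bsub>A\<^esub>)"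
  "Y \<oplus>\<^bsub>tmat A k\<^esub> Z = (\<lambda>(I, J)\<in>idx k \<times> idx k. Y (I, J) \<oplus>\<^bsub>A\<^esub> Z (I, J))"
  by (simp_all add: tmat_def)

lemma tmat_eqI:
  assumes "Y \<in> carrier (tmat A k)" "Z \<in> carrier (tmat A k)"
    and "\<And>I J. I \<in> idx k \<Longrightarrow> J \<in> idx k \<Longrightarrow> Y (I, J) = Z (I, J)"
  shows "Y = Z"
proof (rule PiE_ext)
  show "Y \<in> idx k \<times> idx k \<rightarrow>\<^sub>E carrier A" "Z \<in> idx k \<times> idx k \<rightarrow>\<^sub>E carrier A"
    using assms by (simp_all add: tmat_simps)
qed (use assms in auto)

lemma tmat_entry_closed [simp]:
  "Y \<in> carrier (tmat A k) \<Longrightarrow> I \<in> idx k \<Longrightarrow> J \<in> idx k \<Longrightarrow> Y (I, J) \<in> carrier A"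
  by (auto simp: tmat_simps)

lemma tmat_mult_entry:
  "I \<in> idx k \<Longrightarrow> J \<in> idx k \<Longrightarrow>
    (Y \<otimes>\<^bsub>tmat A k\<^esub> Z) (I, J) = (\<Oplus>\<^bsub>A\<^esub>H\<in>idx k. Y (I, H) \<otimes>\<^bsub>A\<^esub> Z (H, J))"
  by (simp add: tmat_simps)

context ring
begin

lemma tmat_mult_closed:
  fixes Y Z :: "('n::finite, 'a) tm"
  shows "Y \<in> carrier (tmat R k) \<Longrightarrow> Z \<in> carrier (tmat R k) \<Longrightarrow> Y \<otimes>\<^bsub>tmat R k\<^esub> Z \<in> carrier (tmat R k)"
  by (auto simp: tmat_simps(1,2) intro!: finsum_closed)

lemma tmat_one_closed: "\<one>\<^bsub>tmat R k\<^esub> \<in> carrier (tmat R k)"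
  by (auto simp: tmat_simps)

lemma tmat_m_assoc:
  fixes W Y Z :: "('n::finite, 'a) tm"
  assumes "W \<in> carrier (tmat R k)" "Y \<in> carrier (tmat R k)" "Z \<in> carrier (tmat R k)"
  shows "W \<otimes>\<^bsub>tmat R k\<^esub> Y \<otimes>\<^bsub>tmat R k\<^esub> Z = W \<otimes>\<^bsub>tmat R k\<^esub> (Y \<otimes>\<^bsub>tmat R k\<^esub> Z)"
proof (rule tmat_eqI)
  fix I J :: "'n list" assume IJ: "I \<in> idx k" "J \<in> idx k"
  have "(W \<otimes>\<^bsub>tmat R k\<^esub> Y \<otimes>\<^bsub>tmat R k\<^esub> Z) (I, J)
      = (\<Oplus>H\<in>idx k. (\<Oplus>K\<in>idx k. W (I, K) \<otimes> Y (K, H)) \<otimes> Z (H, J))"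
    using IJ assms by (simp add: tmat_mult_entry cong: finsum_cong' ) (intro finsum_cong'; auto intro!: finsum_closed simp: tmat_mult_entry)
  also have "\<dots> = (\<Oplus>H\<in>idx k. \<Oplus>K\<in>idx k. W (I, K) \<otimes> Y (K, H) \<otimes> Z (H, J))"
    using IJ assms by (intro finsum_cong' finsum_ldistr) (auto intro!: finsum_closed)
  also have "\<dots> = (\<Oplus>K\<in>idx k. \<Oplus>H\<in>idx k. W (I, K) \<otimes> Y (K, H) \<otimes> Z (H, J))"
    using IJ assms by (intro finsum_swap) auto
  also have "\<dots> = (\<Oplus>K\<in>idx k. \<Oplus>H\<in>idx k. W (I, K) \<otimes> (Y (K, H) \<otimes> Z (H, J)))"
    using IJ assms by (intro finsum_cong' refl m_assoc) (auto intro!: finsum_closed)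
  also have "\<dots> = (\<Oplus>K\<in>idx k. W (I, K) \<otimes> (\<Oplus>H\<in>idx k. Y (K, H) \<otimes> Z (H, J)))"
    using IJ assms by (intro finsum_cong' finsum_rdistr[symmetric]) (auto intro!: finsum_closed)
  also have "\<dots> = (W \<otimes>\<^bsub>tmat R k\<^esub> (Y \<otimes>\<^bsub>tmat R k\<^esub> Z)) (I, J)"
    using IJ assms by (simp add: tmat_mult_entry) (intro finsum_cong'; auto intro!: finsum_closed simp: tmat_mult_entry)
  finally show "(W \<otimes>\<^bsub>tmat R k\<^esub> Y \<otimes>\<^bsub>tmat R k\<^esub> Z) (I, J) = (W \<otimes>\<^bsub>tmat R k\<^esub> (Y \<otimes>\<^bsub>tmat R k\<^esub> Z)) (I, J)" .
qed (use assms in \<open>auto intro!: tmat_mult_closed\<close>)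

lemma tmat_ring: "ring (tmat R k :: ('n::finite, 'a) tm ring)"
proof (rule ringI)
  let ?T = "tmat R k :: ('n::finite, 'a) tm ring"
  show "abelian_group ?T"
  proof (rule abelian_groupI)
    fix x assume x: "x \<in> carrier ?T"
    show "\<exists>y\<in>carrier ?T. y \<oplus>\<^bsub>?T\<^esub> x = \<zero>\<^bsub>?T\<^esub>"
      by (rule bexI[of _ "\<lambda>p\<in>idx k \<times> idx k. \<ominus> x p"])
        (use x in \<open>auto simp: tmat_simps PiE_iff l_neg fun_eq_iff restrict_def\<close>,
         use x in \<open>auto simp: extensional_def\<close>)
  qed (auto simp: tmat_simps PiE_iff fun_eq_iff restrict_def a_ac extensional_def)
  show "monoid ?T"
  proof (rule monoidI)
    fix x assume x: "x \<in> carrier ?T"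
    show "\<one>\<^bsub>?T\<^esub> \<otimes>\<^bsub>?T\<^esub> x = x"
    proof (rule tmat_eqI)
      fix I J :: "'n list" assume IJ: "I \<in> idx k" "J \<in> idx k"
      have "(\<one>\<^bsub>?T\<^esub> \<otimes>\<^bsub>?T\<^esub> x) (I, J) = (\<Oplus>H\<in>idx k. \<one>\<^bsub>?T\<^esub> (I, H) \<otimes> x (H, J))"
        using IJ by (rule tmat_mult_entry)
      also have "\<dots> = \<one>\<^bsub>?T\<^esub> (I, I) \<otimes> x (I, J)"
        using IJ x by (intro finsum_delta) (auto simp: tmat_simps(3))
      finally show "(\<one>\<^bsub>?T\<^esub> \<otimes>\<^bsub>?T\<^esub> x) (I, J) = x (I, J)"
        using IJ x by (simp add: tmat_simps(3))
    qed (use x in \<open>auto intro!: tmat_mult_closed tmat_one_closed\<close>)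
    show "x \<otimes>\<^bsub>?T\<^esub> \<one>\<^bsub>?T\<^esub> = x"
    proof (rule tmat_eqI)
      fix I J :: "'n list" assume IJ: "I \<in> idx k" "J \<in> idx k"
      have "(x \<otimes>\<^bsub>?T\<^esub> \<one>\<^bsub>?T\<^esub>) (I, J) = (\<Oplus>H\<in>idx k. x (I, H) \<otimes> \<one>\<^bsub>?T\<^esub> (H, J))"
        using IJ by (rule tmat_mult_entry)
      also have "\<dots> = x (I, J) \<otimes> \<one>\<^bsub>?T\<^esub> (J, J)"
        using IJ x by (intro finsum_delta) (auto simp: tmat_simps(3))
      finally show "(x \<otimes>\<^bsub>?T\<^esub> \<one>\<^bsub>?T\<^esub>) (I, J) = x (I, J)"
        using IJ x by (simp add: tmat_simps(3))
    qed (use x in \<open>auto intro!: tmat_mult_closed tmat_one_closed\<close>)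
  qed (auto intro: tmat_mult_closed tmat_m_assoc tmat_one_closed)
  have add: "x \<oplus>\<^bsub>?T\<^esub> y \<in> carrier ?T" if "x \<in> carrier ?T" "y \<in> carrier ?T" for x y
    using that by (auto simp: tmat_simps PiE_iff)
  fix x y z assume xyz: "x \<in> carrier ?T" "y \<in> carrier ?T" "z \<in> carrier ?T"
  show "(x \<oplus>\<^bsub>?T\<^esub> y) \<otimes>\<^bsub>?T\<^esub> z = x \<otimes>\<^bsub>?T\<^esub> z \<oplus>\<^bsub>?T\<^esub> y \<otimes>\<^bsub>?T\<^esub> z"
  proof (rule tmat_eqI)
    fix I J :: "'n list" assume IJ: "I \<in> idx k" "J \<in> idx k"
    have "((x \<oplus>\<^bsub>?T\<^esub> y) \<otimes>\<^bsub>?T\<^esub> z) (I, J) = (\<Oplus>H\<in>idx k. x (I, H) \<otimes> z (H, J) \<oplus> y (I, H) \<otimes> z (H, J))"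
      unfolding tmat_mult_entry[OF IJ] using IJ xyz
      by (intro finsum_cong') (auto simp: tmat_simps(5) l_distr simp del: finsum_addf)
    also have "\<dots> = (x \<otimes>\<^bsub>?T\<^esub> z \<oplus>\<^bsub>?T\<^esub> y \<otimes>\<^bsub>?T\<^esub> z) (I, J)"
      using IJ xyz by (subst finsum_addf) (auto simp: tmat_simps(5) tmat_mult_entry)
    finally show "((x \<oplus>\<^bsub>?T\<^esub> y) \<otimes>\<^bsub>?T\<^esub> z) (I, J) = (x \<otimes>\<^bsub>?T\<^esub> z \<oplus>\<^bsub>?T\<^esub> y \<otimes>\<^bsub>?T\<^esub> z) (I, J)" .
  qed (use xyz in \<open>auto intro!: tmat_mult_closed add\<close>)
  show "z \<otimes>\<^bsub>?T\<^esub> (x \<oplus>\<^bsub>?T\<^esub> y) = z \<otimes>\<^bsub>?T\<^esub> x \<oplus>\<^bsub>?T\<^esub> z \<otimes>\<^bsub>?T\<^esub> y"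
  proof (rule tmat_eqI)
    fix I J :: "'n list" assume IJ: "I \<in> idx k" "J \<in> idx k"
    have "(z \<otimes>\<^bsub>?T\<^esub> (x \<oplus>\<^bsub>?T\<^esub> y)) (I, J) = (\<Oplus>H\<in>idx k. z (I, H) \<otimes> x (H, J) \<oplus> z (I, H) \<otimes> y (H, J))"
      unfolding tmat_mult_entry[OF IJ] using IJ xyz
      by (intro finsum_cong') (auto simp: tmat_simps(5) r_distr simp del: finsum_addf)
    also have "\<dots> = (z \<otimes>\<^bsub>?T\<^esub> x \<oplus>\<^bsub>?T\<^esub> z \<otimes>\<^bsub>?T\<^esub> y) (I, J)"
      using IJ xyz by (subst finsum_addf) (auto simp: tmat_simps(5) tmat_mult_entry)
    finally show "(z \<otimes>\<^bsub>?T\<^esub> (x \<oplus>\<^bsub>?T\<^esub> y)) (I, J) = (z \<otimes>\<^bsub>?T\<^esub> x \<oplus>\<^bsub>?T\<^esub> z \<otimes>\<^bsub>?T\<^esub> y) (I, J)" .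
  qed (use xyz in \<open>auto intro!: tmat_mult_closed add\<close>)
qed

section \<open>Operators acting in some of the tensor factors\<close>

lemma leg_append:
  assumes "k = p + j + l" "a \<in> idx p" "b \<in> idx j" "c \<in> idx l" "a' \<in> idx p" "b' \<in> idx j" "c' \<in> idx l"
  shows "leg R j k (Suc p) Y (a @ b @ c, a' @ b' @ c') = (if a = a' \<and> c = c' then Y (b, b') else \<zero>)"
  using assms by (auto simp: leg_def idx_def)

lemma leg_closed:
  fixes Y :: "('n::finite, 'a) tm"
  assumes "k = p + j + l" "Y \<in> carrier (tmat R j)"
  shows "leg R j k (Suc p) Y \<in> carrier (tmat R k)"
proof -
  have "leg R j k (Suc p) Y (I, J) \<in> carrier R" if IJ: "I \<in> idx k" "J \<in> idx k" for I J :: "'n list"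
  proof -
    obtain a b c where I: "I = a @ b @ c" "a \<in> idx p" "b \<in> idx j" "c \<in> idx l"
      using idx_split[OF IJ(1) assms(1)] .
    obtain a' b' c' where J: "J = a' @ b' @ c'" "a' \<in> idx p" "b' \<in> idx j" "c' \<in> idx l"
      using idx_split[OF IJ(2) assms(1)] .
    show ?thesis
      using I J assms by (simp add: leg_append)
  qed
  then show ?thesis
    by (auto simp: tmat_simps(1) leg_def)
qed

text \<open>An embedded operator is the identity outside its own factors, so in a product with it
  only those intermediate multi-indices contribute whose outer parts \<open>a\<close> and
  \<open>c\<close> are prescribed.\<close>

lemma finsum_idx_factor:
  fixes g :: "'n::finite list \<Rightarrow> 'a"
  assumes "k = p + j + l" "a \<in> idx p" "c \<in> idx l" "g \<in> idx k \<rightarrow> carrier R"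
    and "\<And>a' b' c'. a' \<in> idx p \<Longrightarrow> b' \<in> idx j \<Longrightarrow> c' \<in> idx l \<Longrightarrow> \<not> (a' = a \<and> c' = c)
      \<Longrightarrow> g (a' @ b' @ c') = \<zero>"
  shows "(\<Oplus>H\<in>idx k. g H) = (\<Oplus>H\<in>idx j. g (a @ H @ c))"
proof -
  let ?h = "\<lambda>H. a @ H @ c"
  have sub: "?h ` idx j \<subseteq> idx k"
    using assms by (auto simp: idx_def)
  have "(\<Oplus>H\<in>idx k. g H) = (\<Oplus>H\<in>?h ` idx j. g H)"
  proof (rule add.finprod_mono_neutral_cong_left[symmetric])
    show "\<And>H. H \<in> idx k - ?h ` idx j \<Longrightarrow> g H = \<zero>"
    proof -
      fix H assume H: "H \<in> idx k - ?h ` idx j"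
      obtain a' b' c' where I: "H = a' @ b' @ c'" "a' \<in> idx p" "b' \<in> idx j" "c' \<in> idx l"
        using idx_split[of H k p j l] H assms(1) by auto
      then show "g H = \<zero>"
        using H assms(5) by auto
    qed
  qed (use sub assms in auto)
  also have "\<dots> = (\<Oplus>H\<in>idx j. g (a @ H @ c))"
    using sub assms(4) by (intro finsum_reindex) (auto simp: inj_on_def)
  finally show ?thesis .
qed

text \<open>\<open>f\<close> plays the role of a column of the right-hand matrix. Keeping it an
  arbitrary family lets the same reduction be applied to single columns in later
  contractions.\<close>

lemma leg_mult_left:
  fixes Y :: "('n::finite, 'a) tm"
  assumes "k = p + j + l" "a \<in> idx p" "b \<in> idx j" "c \<in> idx l" "f \<in> idx k \<rightarrow> carrier R"
    "Y \<in> carrier (tmat R j)"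
  shows "(\<Oplus>H\<in>idx k. leg R j k (Suc p) Y (a @ b @ c, H) \<otimes> f H) = (\<Oplus>H\<in>idx j. Y (b, H) \<otimes> f (a @ H @ c))"
proof -
  have cl: "f (x @ y @ z) \<in> carrier R" if "x \<in> idx p" "y \<in> idx j" "z \<in> idx l" for x y z
    using assms that by (auto simp: idx_def)
  have abc: "a @ b @ c \<in> idx k"
    using assms by (auto simp: idx_def)
  have "(\<Oplus>H\<in>idx k. leg R j k (Suc p) Y (a @ b @ c, H) \<otimes> f H)
      = (\<Oplus>H\<in>idx j. leg R j k (Suc p) Y (a @ b @ c, a @ H @ c) \<otimes> f (a @ H @ c))"
    using abc assms(2-6) leg_closed[OF assms(1,6)]
    by (intro finsum_idx_factor[OF assms(1)]) (auto simp: leg_append[OF assms(1)] cl)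
  also have "\<dots> = (\<Oplus>H\<in>idx j. Y (b, H) \<otimes> f (a @ H @ c))"
    using assms(2-) cl by (intro finsum_cong') (auto simp: leg_append[OF assms(1)])
  finally show ?thesis .
qed

lemma leg_mult_right:
  fixes Y :: "('n::finite, 'a) tm"
  assumes "k = p + j + l" "a \<in> idx p" "b \<in> idx j" "c \<in> idx l" "f \<in> idx k \<rightarrow> carrier R"
    "Y \<in> carrier (tmat R j)"
  shows "(\<Oplus>H\<in>idx k. f H \<otimes> leg R j k (Suc p) Y (H, a @ b @ c)) = (\<Oplus>H\<in>idx j. f (a @ H @ c) \<otimes> Y (H, b))"
proof -
  have cl: "f (x @ y @ z) \<in> carrier R" if "x \<in> idx p" "y \<in> idx j" "z \<in> idx l" for x y z
    using assms that by (auto simp: idx_def)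
  have abc: "a @ b @ c \<in> idx k"
    using assms by (auto simp: idx_def)
  have "(\<Oplus>H\<in>idx k. f H \<otimes> leg R j k (Suc p) Y (H, a @ b @ c))
      = (\<Oplus>H\<in>idx j. f (a @ H @ c) \<otimes> leg R j k (Suc p) Y (a @ H @ c, a @ b @ c))"
    using abc assms(2-6) leg_closed[OF assms(1,6)]
    by (intro finsum_idx_factor[OF assms(1)]) (auto simp: leg_append[OF assms(1)] cl)
  also have "\<dots> = (\<Oplus>H\<in>idx j. f (a @ H @ c) \<otimes> Y (H, b))"
    using assms(2-) cl by (intro finsum_cong') (auto simp: leg_append[OF assms(1)])
  finally show ?thesis .
qed

lemma leg_hom:
  assumes "k = p + j + l"
  shows "leg R j k (Suc p) \<in> ring_hom (tmat R j :: ('n::finite, 'a) tm ring) (tmat R k)"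
proof (rule ring_hom_memI)
  let ?leg = "leg R j k (Suc p) :: ('n, 'a) tm \<Rightarrow> _"
  interpret Tj: ring "tmat R j :: ('n::finite, 'a) tm ring" by (rule tmat_ring)
  interpret Tk: ring "tmat R k :: ('n::finite, 'a) tm ring" by (rule tmat_ring)
  fix x assume x: "x \<in> carrier (tmat R j :: ('n, 'a) tm ring)"
  show cl: "?leg x \<in> carrier (tmat R k)"
    by (rule leg_closed[OF assms x])
  fix y assume y: "y \<in> carrier (tmat R j :: ('n, 'a) tm ring)"
  have cl': "?leg y \<in> carrier (tmat R k)"
    by (rule leg_closed[OF assms y])
  show "?leg (x \<otimes>\<^bsub>tmat R j\<^esub> y) = ?leg x \<otimes>\<^bsub>tmat R k\<^esub> ?leg y"
  proof (rule tmat_eqI)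
    fix I J :: "'n list" assume IJ: "I \<in> idx k" "J \<in> idx k"
    obtain a b c where I: "I = a @ b @ c" "a \<in> idx p" "b \<in> idx j" "c \<in> idx l"
      using idx_split[OF IJ(1) assms(1)] .
    obtain a' b' c' where J: "J = a' @ b' @ c'" "a' \<in> idx p" "b' \<in> idx j" "c' \<in> idx l"
      using idx_split[OF IJ(2) assms(1)] .
    have "(?leg x \<otimes>\<^bsub>tmat R k\<^esub> ?leg y) (I, J)
        = (\<Oplus>H\<in>idx j. x (b, H) \<otimes> ?leg y (a @ H @ c, J))"
      using I J IJ x cl' assms by (subst tmat_mult_entry) (auto intro!: leg_mult_left)
    also have "\<dots> = ?leg (x \<otimes>\<^bsub>tmat R j\<^esub> y) (I, J)"
    proof (cases "a = a' \<and> c = c'")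
      case True
      then show ?thesis
        using I J x y assms by (simp add: leg_append tmat_mult_entry) (intro finsum_cong'; auto simp: leg_append)
    next
      case False
      then have "(\<Oplus>H\<in>idx j. x (b, H) \<otimes> ?leg y (a @ H @ c, J)) = (\<Oplus>H\<in>(idx j :: 'n list set). \<zero>)"
        using I J x y assms by (intro finsum_cong') (auto simp: leg_append)
      also have "\<dots> = ?leg (x \<otimes>\<^bsub>tmat R j\<^esub> y) (I, J)"
        using False I J assms by (auto simp: leg_append)
      finally show ?thesis .
    qed
    finally show "?leg (x \<otimes>\<^bsub>tmat R j\<^esub> y) (I, J)
        = (?leg x \<otimes>\<^bsub>tmat R k\<^esub> ?leg y) (I, J)" by simp
  qed (use x y cl cl' in \<open>auto intro!: leg_closed[OF assms]\<close>)
  show "?leg (x \<oplus>\<^bsub>tmat R j\<^esub> y) = ?leg x \<oplus>\<^bsub>tmat R k\<^esub> ?leg y"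
  proof (rule tmat_eqI)
    fix I J :: "'n list" assume IJ: "I \<in> idx k" "J \<in> idx k"
    obtain a b c where I: "I = a @ b @ c" "a \<in> idx p" "b \<in> idx j" "c \<in> idx l"
      using idx_split[OF IJ(1) assms(1)] .
    obtain a' b' c' where J: "J = a' @ b' @ c'" "a' \<in> idx p" "b' \<in> idx j" "c' \<in> idx l"
      using idx_split[OF IJ(2) assms(1)] .
    show "?leg (x \<oplus>\<^bsub>tmat R j\<^esub> y) (I, J)
        = (?leg x \<oplus>\<^bsub>tmat R k\<^esub> ?leg y) (I, J)"
      using I J assms IJ by (auto simp: tmat_simps(5) leg_append)
  qed (use x y cl cl' in \<open>auto intro!: leg_closed[OF assms]\<close>)
next
  interpret Tj: ring "tmat R j :: ('n::finite, 'a) tm ring" by (rule tmat_ring)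
  interpret Tk: ring "tmat R k :: ('n::finite, 'a) tm ring" by (rule tmat_ring)
  show "leg R j k (Suc p) (\<one>\<^bsub>tmat R j\<^esub> :: ('n, 'a) tm) = \<one>\<^bsub>tmat R k\<^esub>"
  proof (rule tmat_eqI)
    fix I J :: "'n list" assume IJ: "I \<in> idx k" "J \<in> idx k"
    obtain a b c where I: "I = a @ b @ c" "a \<in> idx p" "b \<in> idx j" "c \<in> idx l"
      using idx_split[OF IJ(1) assms(1)] .
    obtain a' b' c' where J: "J = a' @ b' @ c'" "a' \<in> idx p" "b' \<in> idx j" "c' \<in> idx l"
      using idx_split[OF IJ(2) assms(1)] .
    show "leg R j k (Suc p) \<one>\<^bsub>tmat R j\<^esub> (I, J) = \<one>\<^bsub>tmat R k\<^esub> (I, J)"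
      using I J IJ assms by (auto simp: leg_append tmat_simps(3)) (auto simp: idx_def)
  qed (auto intro!: leg_closed[OF assms])
qed

text \<open>Positions are counted from 1, so \<open>Suc p\<close> means that \<open>p\<close>
  factors are skipped; under nested embeddings these numbers of skipped factors add up.\<close>

lemma leg_leg:
  assumes "n = p + k + p'" "k = i + j + i'" "Y \<in> carrier (tmat R j :: ('n::finite, 'a) tm ring)"
  shows "leg R k n (Suc p) (leg R j k (Suc i) Y) = leg R j n (Suc (p + i)) Y"
proof (rule tmat_eqI)
  have n: "n = (p + i) + j + (i' + p')"
    using assms by simp
  show "leg R k n (Suc p) (leg R j k (Suc i) Y) \<in> carrier (tmat R n)"
    by (intro leg_closed[OF assms(1)] leg_closed[OF assms(2)] assms)
  show "leg R j n (Suc (p + i)) Y \<in> carrier (tmat R n)"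
    by (intro leg_closed[OF n] assms)
  fix I J :: "'n list" assume IJ: "I \<in> idx n" "J \<in> idx n"
  obtain a b c where I: "I = a @ b @ c" "a \<in> idx p" "b \<in> idx k" "c \<in> idx p'"
    using idx_split[OF IJ(1) assms(1)] .
  obtain a' b' c' where J: "J = a' @ b' @ c'" "a' \<in> idx p" "b' \<in> idx k" "c' \<in> idx p'"
    using idx_split[OF IJ(2) assms(1)] .
  obtain d e f where b: "b = d @ e @ f" "d \<in> idx i" "e \<in> idx j" "f \<in> idx i'"
    using idx_split[OF I(3) assms(2)] .
  obtain d' e' f' where b': "b' = d' @ e' @ f'" "d' \<in> idx i" "e' \<in> idx j" "f' \<in> idx i'"
    using idx_split[OF J(3) assms(2)] .
  have "leg R j n (Suc (p + i)) Y (I, J) = leg R j n (Suc (p + i)) Y ((a @ d) @ e @ (f @ c), (a' @ d') @ e' @ (f' @ c'))"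
    by (simp add: I J b b')
  also have "\<dots> = (if a @ d = a' @ d' \<and> f @ c = f' @ c' then Y (e, e') else \<zero>)"
    using I J b b' by (intro leg_append[OF n]) (auto intro: append_in_idx)
  also have "\<dots> = leg R k n (Suc p) (leg R j k (Suc i) Y) (I, J)"
    unfolding I(1) J(1) leg_append[OF assms(1) I(2-4) J(2-4)]
    unfolding b(1) b'(1) leg_append[OF assms(2) b(2-4) b'(2-4)]
    using I(2-4) J(2-4) b b' by (auto simp: idx_def)
  finally show "leg R k n (Suc p) (leg R j k (Suc i) Y) (I, J) = leg R j n (Suc (p + i)) Y (I, J)" by simp
qed

text \<open>For disjoint factors every sum over intermediate indices collapses to one term. Both
  orders are computed because the ring of entries is not commutative: the results differ only in the
  order of the two remaining entries.\<close>

lemma leg_leg_disjoint_entry: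
  assumes "n = p + j + (d + j' + l)" 
    and Y: "Y \<in> carrier (tmat R j :: ('n::finite, 'a) tm ring)" and Z: "Z \<in> carrier (tmat R j')"
    and "a \<in> idx p" "b \<in> idx j" "c \<in> idx d" "e \<in> idx j'" "f \<in> idx l"
    and "a' \<in> idx p" "b' \<in> idx j" "c' \<in> idx d" "e' \<in> idx j'" "f' \<in> idx l"
  shows "(leg R j n (Suc p) Y \<otimes>\<^bsub>tmat R n\<^esub> leg R j' n (Suc (p + j + d)) Z) (a @ b @ c @ e @ f, a' @ b' @ c' @ e' @ f')
    = (if a = a' \<and> c = c' \<and> f = f' then Y (b, b') \<otimes> Z (e, e') else \<zero>)" (is ?L)
    and "(leg R j' n (Suc (p + j + d)) Z \<otimes>\<^bsub>tmat R n\<^esub> leg R j n (Suc p) Y) (a @ b @ c @ e @ f, a' @ b' @ c' @ e' @ f')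
    = (if a = a' \<and> c = c' \<and> f = f' then Z (e, e') \<otimes> Y (b, b') else \<zero>)" (is ?R)
proof -
  let ?Z = "leg R j' n (Suc (p + j + d)) Z"
  have n: "n = (p + j + d) + j' + l"
    using assms by simp
  have idx: "a @ b @ c @ e @ f \<in> idx n" "a' @ b' @ c' @ e' @ f' \<in> idx n"
    "c @ e @ f \<in> idx (d + j' + l)" "c' @ e' @ f' \<in> idx (d + j' + l)"
    using assms by (auto simp: idx_def)
  have Zn: "?Z \<in> carrier (tmat R n)"
    by (intro leg_closed[OF n] Z)
  have Ze: "?Z (a1 @ b1 @ c1 @ e1 @ f1, a2 @ b2 @ c2 @ e2 @ f2)
      = (if a1 = a2 \<and> b1 = b2 \<and> c1 = c2 \<and> f1 = f2 then Z (e1, e2) else \<zero>)"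
    if "a1 \<in> idx p" "b1 \<in> idx j" "c1 \<in> idx d" "e1 \<in> idx j'" "f1 \<in> idx l"
       "a2 \<in> idx p" "b2 \<in> idx j" "c2 \<in> idx d" "e2 \<in> idx j'" "f2 \<in> idx l" for a1 b1 c1 e1 f1 a2 b2 c2 e2 f2
    using leg_append[OF n, of "a1 @ b1 @ c1" e1 f1 "a2 @ b2 @ c2" e2 f2 Z] that
    by (auto simp: idx_def)
  have "(leg R j n (Suc p) Y \<otimes>\<^bsub>tmat R n\<^esub> ?Z) (a @ b @ c @ e @ f, a' @ b' @ c' @ e' @ f')
      = (\<Oplus>H\<in>idx j. Y (b, H) \<otimes> ?Z (a @ H @ c @ e @ f, a' @ b' @ c' @ e' @ f'))"
    using idx assms Zn by (subst tmat_mult_entry[OF idx(1,2)], intro leg_mult_left[OF assms(1)]) auto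
  also have "\<dots> = Y (b, b') \<otimes> ?Z (a @ b' @ c @ e @ f, a' @ b' @ c' @ e' @ f')"
    using assms(2-) by (intro finsum_delta) (auto simp: Ze)
  also have "\<dots> = (if a = a' \<and> c = c' \<and> f = f' then Y (b, b') \<otimes> Z (e, e') else \<zero>)"
    using assms(2-) by (auto simp: Ze)
  finally show ?L .
  have "(?Z \<otimes>\<^bsub>tmat R n\<^esub> leg R j n (Suc p) Y) (a @ b @ c @ e @ f, a' @ b' @ c' @ e' @ f')
      = (\<Oplus>H\<in>idx j. ?Z (a @ b @ c @ e @ f, a' @ H @ c' @ e' @ f') \<otimes> Y (H, b'))"
    using idx assms Zn by (subst tmat_mult_entry[OF idx(1,2)], intro leg_mult_right[OF assms(1)]) auto
  also have "\<dots> = ?Z (a @ b @ c @ e @ f, a' @ b @ c' @ e' @ f') \<otimes> Y (b, b')"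
    using assms(2-) by (intro finsum_delta) (auto simp: Ze)
  also have "\<dots> = (if a = a' \<and> c = c' \<and> f = f' then Z (e, e') \<otimes> Y (b, b') else \<zero>)"
    using assms(2-) by (auto simp: Ze)
  finally show ?R .
qed

text \<open>Acting in disjoint factors is not enough over a noncommutative ring; the entries must
  commute as well. In the applications at least one of the two matrices has central entries.\<close>

lemma leg_commute:
  assumes i: "1 \<le> i" "i + j \<le> i'" "i' + j' \<le> Suc n"
    and Y: "Y \<in> carrier (tmat R j :: ('n::finite, 'a) tm ring)" and Z: "Z \<in> carrier (tmat R j')"
    and comm: "\<And>I J I' J'. I \<in> idx j \<Longrightarrow> J \<in> idx j \<Longrightarrow> I' \<in> idx j' \<Longrightarrow> J' \<in> idx j' \<Longrightarrow>
      Y (I, J) \<otimes> Z (I', J') = Z (I', J') \<otimes> Y (I, J)"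
  shows "leg R j n i Y \<otimes>\<^bsub>tmat R n\<^esub> leg R j' n i' Z = leg R j' n i' Z \<otimes>\<^bsub>tmat R n\<^esub> leg R j n i Y"
proof -
  define p d l where "p = i - 1" "d = i' - i - j" "l = Suc n - i' - j'"
  have i_eq: "i = Suc p" "i' = Suc (p + j + d)" and n: "n = p + j + (d + j' + l)" 
    and n': "n = (p + j + d) + j' + l"
    using i by (auto simp: p_d_l_def)
  interpret Tn: ring "tmat R n :: ('n::finite, 'a) tm ring" by (rule tmat_ring)
  show ?thesis
    unfolding i_eq
  proof (rule tmat_eqI[where A = R])
    fix I J :: "'n list" assume IJ: "I \<in> idx n" "J \<in> idx n"
    obtain a b g where I: "I = a @ b @ g" "a \<in> idx p" "b \<in> idx j" "g \<in> idx (d + j' + l)"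
      using idx_split[OF IJ(1) n] .
    obtain a' b' g' where J: "J = a' @ b' @ g'" "a' \<in> idx p" "b' \<in> idx j" "g' \<in> idx (d + j' + l)"
      using idx_split[OF IJ(2) n] .
    obtain c e f where g: "g = c @ e @ f" "c \<in> idx d" "e \<in> idx j'" "f \<in> idx l"
      using idx_split[OF I(4) refl] .
    obtain c' e' f' where g': "g' = c' @ e' @ f'" "c' \<in> idx d" "e' \<in> idx j'" "f' \<in> idx l"
      using idx_split[OF J(4) refl] .
    note idx = I(2,3) g(2-4) J(2,3) g'(2-4)
    show "(leg R j n (Suc p) Y \<otimes>\<^bsub>tmat R n\<^esub> leg R j' n (Suc (p + j + d)) Z) (I, J)
      = (leg R j' n (Suc (p + j + d)) Z \<otimes>\<^bsub>tmat R n\<^esub> leg R j n (Suc p) Y) (I, J)"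
      unfolding I(1) J(1) g(1) g'(1)
      unfolding leg_leg_disjoint_entry[OF n Y Z idx]
      using comm idx by simp
  qed (intro tmat_mult_closed leg_closed[OF n] leg_closed[OF n'] Y Z)+
qed

end

section \<open>Change of the ring of entries\<close>

lemma map_tm_closed:
  assumes "h \<in> ring_hom A A'" "Y \<in> carrier (tmat A k)"
  shows "map_tm k h Y \<in> carrier (tmat A' k)"
  using assms by (auto simp: tmat_simps(1) map_tm_def PiE_iff ring_hom_def)

lemma map_tm_hom:
  assumes A: "ring A" and A': "ring A'" and h: "h \<in> ring_hom A A'"
  shows "map_tm k h \<in> ring_hom (tmat A k :: ('n::finite, 'a) tm ring) (tmat A' k)"
proof (rule ring_hom_memI)
  interpret h: ring_hom_ring A A' h by (rule ring_hom_ringI2[OF A A' h])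
  fix x assume x: "x \<in> carrier (tmat A k :: ('n::finite, 'a) tm ring)"
  show "map_tm k h x \<in> carrier (tmat A' k)"
    using h x by (rule map_tm_closed)
  fix y assume y: "y \<in> carrier (tmat A k :: ('n::finite, 'a) tm ring)"
  show "map_tm k h (x \<otimes>\<^bsub>tmat A k\<^esub> y) = map_tm k h x \<otimes>\<^bsub>tmat A' k\<^esub> map_tm k h y"
  proof (rule tmat_eqI[where A = A'])
    fix I J :: "'n list" assume IJ: "I \<in> idx k" "J \<in> idx k"
    have "map_tm k h (x \<otimes>\<^bsub>tmat A k\<^esub> y) (I, J) = h (finsum A (\<lambda>H. x (I, H) \<otimes>\<^bsub>A\<^esub> y (H, J)) (idx k))"
      using IJ by (simp add: map_tm_def tmat_mult_entry)
    also have "\<dots> = finsum A' (h \<circ> (\<lambda>H. x (I, H) \<otimes>\<^bsub>A\<^esub> y (H, J))) (idx k)"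
      using x y IJ by (intro ring_hom_finsum[OF A A' h]) auto
    also have "\<dots> = (map_tm k h x \<otimes>\<^bsub>tmat A' k\<^esub> map_tm k h y) (I, J)"
      using IJ x y unfolding tmat_mult_entry[OF IJ]
      by (intro h.S.finsum_cong') (auto simp: map_tm_def)
    finally show "map_tm k h (x \<otimes>\<^bsub>tmat A k\<^esub> y) (I, J) = (map_tm k h x \<otimes>\<^bsub>tmat A' k\<^esub> map_tm k h y) (I, J)" .
  qed (intro map_tm_closed[OF h] h.R.tmat_mult_closed h.S.tmat_mult_closed x y)+
  show "map_tm k h (x \<oplus>\<^bsub>tmat A k\<^esub> y) = map_tm k h x \<oplus>\<^bsub>tmat A' k\<^esub> map_tm k h y"
    using x y by (auto simp: map_tm_def tmat_simps(5) restrict_def fun_eq_iff)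
next
  interpret h: ring_hom_ring A A' h by (rule ring_hom_ringI2[OF A A' h])
  show "map_tm k h (\<one>\<^bsub>tmat A k\<^esub> :: ('n, 'a) tm) = \<one>\<^bsub>tmat A' k\<^esub>"
    by (auto simp: map_tm_def tmat_simps(3) restrict_def fun_eq_iff)
qed

lemma map_tm_leg:
  fixes Y :: "('n, 'b) tm"
  assumes "ring (A :: ('b, 'c) ring_scheme)" "ring A'" "h \<in> ring_hom A A'" "k = p + j + l"
  shows "map_tm k h (leg A j k (Suc p) Y) = leg A' j k (Suc p) (map_tm j h Y)"
proof -
  interpret h: ring_hom_ring A A' h by (rule ring_hom_ringI2[OF assms(1-3)])
  have "take j (drop p I) \<in> idx j" if "I \<in> idx k" for I :: "'n list"
    using that assms(4) by (auto simp: idx_def)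
  then show ?thesis
    by (auto simp: map_tm_def leg_def fun_eq_iff restrict_def)
qed

lemma map_tm_comp: "map_tm k g (map_tm k h Y) = map_tm k (g \<circ> h) Y"
  by (auto simp: map_tm_def)

lemma map_tm_scal:
  assumes "ring A" "ring A'" "h \<in> ring_hom A A'"
  shows "map_tm k h (scal A k c) = scal A' k (h c)"
proof -
  interpret h: ring_hom_ring A A' h by (rule ring_hom_ringI2[OF assms(1-3)])
  show ?thesis
    by (auto simp: map_tm_def scal_def fun_eq_iff restrict_def)
qed

section \<open>Scalars\<close>

context ring
begin

lemma scal_closed: "c \<in> carrier R \<Longrightarrow> scal R k c \<in> carrier (tmat R k)"
  by (auto simp: scal_def tmat_simps(1))

lemma scal_entry:
  "I \<in> idx k \<Longrightarrow> J \<in> idx k \<Longrightarrow> scal R k c (I, J) = (if I = J then c else \<zero>)"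
  by (simp add: scal_def)

lemma scal_mult_entry:
  fixes Y :: "('n::finite, 'a) tm"
  assumes "c \<in> carrier R" "Y \<in> carrier (tmat R k)" "I \<in> idx k" "J \<in> idx k"
  shows "(scal R k c \<otimes>\<^bsub>tmat R k\<^esub> Y) (I, J) = c \<otimes> Y (I, J)"
    and "(Y \<otimes>\<^bsub>tmat R k\<^esub> scal R k c) (I, J) = Y (I, J) \<otimes> c"
proof -
  have "(scal R k c \<otimes>\<^bsub>tmat R k\<^esub> Y) (I, J) = scal R k c (I, I) \<otimes> Y (I, J)"
    unfolding tmat_mult_entry[OF assms(3,4)] using assms scal_closed[OF assms(1)]
    by (intro finsum_delta) (auto simp: scal_entry)
  then show "(scal R k c \<otimes>\<^bsub>tmat R k\<^esub> Y) (I, J) = c \<otimes> Y (I, J)"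
    using assms by (simp add: scal_def)
  have "(Y \<otimes>\<^bsub>tmat R k\<^esub> scal R k c) (I, J) = Y (I, J) \<otimes> scal R k c (J, J)"
    unfolding tmat_mult_entry[OF assms(3,4)] using assms scal_closed[OF assms(1)]
    by (intro finsum_delta) (auto simp: scal_entry)
  then show "(Y \<otimes>\<^bsub>tmat R k\<^esub> scal R k c) (I, J) = Y (I, J) \<otimes> c"
    using assms by (simp add: scal_def)
qed

lemma scal_hom: "scal R k \<in> ring_hom R (tmat R k :: ('n::finite, 'a) tm ring)"
proof (rule ring_hom_memI)
  interpret T: ring "tmat R k :: ('n::finite, 'a) tm ring" by (rule tmat_ring)
  fix x y assume xy: "x \<in> carrier R" "y \<in> carrier R"
  then show "scal R k (x \<oplus> y) = scal R k x \<oplus>\<^bsub>tmat R k\<^esub> scal R k y"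
    by (auto simp: tmat_simps scal_def fun_eq_iff restrict_def)
  show "scal R k (x \<otimes> y) = scal R k x \<otimes>\<^bsub>tmat R k\<^esub> (scal R k y :: ('n, 'a) tm)"
  proof (rule tmat_eqI)
    fix I J :: "'n list" assume "I \<in> idx k" "J \<in> idx k"
    then show "scal R k (x \<otimes> y) (I, J) = (scal R k x \<otimes>\<^bsub>tmat R k\<^esub> scal R k y) (I, J)"
      using xy by (simp add: scal_mult_entry scal_closed) (simp add: scal_def)
  qed (use xy in \<open>auto intro!: scal_closed\<close>)
qed (auto simp: scal_closed, simp add: scal_def tmat_simps(3))

lemma scal_central:
  fixes Y :: "('n::finite, 'a) tm"
  assumes "c \<in> carrier R" "Y \<in> carrier (tmat R k)" "\<And>x. x \<in> carrier R \<Longrightarrow> c \<otimes> x = x \<otimes> c"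
  shows "scal R k c \<otimes>\<^bsub>tmat R k\<^esub> Y = Y \<otimes>\<^bsub>tmat R k\<^esub> scal R k c"
proof -
  interpret T: ring "tmat R k :: ('n::finite, 'a) tm ring" by (rule tmat_ring)
  show ?thesis
    by (rule tmat_eqI) (use assms in \<open>auto intro!: T.m_closed scal_closed simp: scal_mult_entry\<close>)
qed

lemma leg_scal:
  assumes "k = p + j + l"
  shows "leg R j k (Suc p) (scal R j c) = (scal R k c :: ('n, 'a) tm)"
proof -
  have "leg R j k (Suc p) (scal R j c) (I, J) = (scal R k c :: ('n, 'a) tm) (I, J)"
    if IJ: "I \<in> idx k" "J \<in> idx k" for I J :: "'n list"
  proof -
    obtain a b d where I: "I = a @ b @ d" "a \<in> idx p" "b \<in> idx j" "d \<in> idx l"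
      using idx_split[OF IJ(1) assms(1)] .
    obtain a' b' d' where J: "J = a' @ b' @ d'" "a' \<in> idx p" "b' \<in> idx j" "d' \<in> idx l"
      using idx_split[OF IJ(2) assms(1)] .
    show ?thesis
      using I J IJ assms by (auto simp: leg_append scal_def) (auto simp: idx_def)
  qed
  then show ?thesis
    by (auto simp: fun_eq_iff leg_def scal_def restrict_def)
qed

end

section \<open>Quantum integers\<close>

lemma qnum_0 [simp]: "qnum q 0 = 0"
  by (simp add: qnum_def)

lemma qnum_1 [simp]: "qnum q (Suc 0) = 1"
  by (simp add: qnum_def)

lemma qnum_Suc:
  assumes "q \<noteq> 0"
  shows "qnum q (Suc k) = q ^ k + qnum q k / q"
proof -
  have "qnum q (Suc k) = q powi int k + (\<Sum>i<k. q powi (int k - 2 - 2 * int i))"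
    unfolding qnum_def by (subst sum.lessThan_Suc_shift) (simp add: algebra_simps)
  also have "(\<Sum>i<k. q powi (int k - 2 - 2 * int i)) = qnum q k / q"
    unfolding qnum_def sum_divide_distrib
    by (intro sum.cong refl) (simp add: assms power_int_diff power_int_add field_simps power2_eq_square)
  finally show ?thesis by simp
qed

text \<open>Here the lowest power of \<open>q\<close> is split off, in \<open>qnum_Suc\<close> the
  highest. Comparing the two one-step recursions yields the identities that follow.\<close>

lemma qnum_Suc':
  assumes "q \<noteq> 0"
  shows "qnum q (Suc k) = q * qnum q k + 1 / q ^ k"
proof -
  have "qnum q (Suc k) = (\<Sum>i<k. q powi (int k - 2 * int i)) + q powi (- int k)"
    by (simp add: qnum_def)
  also have "(\<Sum>i<k. q powi (int k - 2 * int i)) = q * qnum q k"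
    unfolding qnum_def sum_distrib_left
    by (intro sum.cong refl) (simp add: assms power_int_diff power_int_add field_simps)
  finally show ?thesis by (simp add: power_int_minus divide_inverse)
qed

text \<open>The factor \<open>q + 1 / q\<close> is the q-number of 2. This relation is what makes
  the critical coefficient in \<open>antisym_annihilates\<close> vanish.\<close>

lemma qnum_recurrence:
  assumes "q \<noteq> 0"
  shows "qnum q (Suc (Suc k)) + qnum q k = (q + 1 / q) * qnum q (Suc k)"
proof -
  have "qnum q (Suc k) / q = qnum q k + 1 / q ^ Suc k"
    using assms by (simp add: qnum_Suc'[OF assms, of k] field_simps)
  then show ?thesis
    by (simp add: qnum_Suc'[OF assms, of "Suc k"] distrib_right)
qed

text \<open>The two one-step recursions reduce the left-hand side to a quotient of equal powers of
  \<open>q\<close>. The value 1 is responsible for the constant in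
  \<open>antisym_shift\<close>.\<close>

lemma qnum_discriminant:
  assumes "q \<noteq> 0"
  shows "qnum q (Suc k) * qnum q (Suc k) - qnum q k * qnum q (Suc (Suc k)) = 1"
proof -
  have 1: "q * qnum q (Suc k) - qnum q k = q ^ Suc k"
    using qnum_Suc[OF assms, of k] assms by (simp add: field_simps)
  have 2: "qnum q (Suc k) - q * qnum q k = 1 / q ^ k"
    using qnum_Suc'[OF assms, of k] by simp
  have "qnum q (Suc k) * qnum q (Suc k) - qnum q k * qnum q (Suc (Suc k))
     = qnum q (Suc k) * (qnum q (Suc k) - q * qnum q k) - qnum q k / q ^ Suc k"
    by (simp add: qnum_Suc'[OF assms, of "Suc k"] algebra_simps)
  also have "\<dots> = (q * qnum q (Suc k) - qnum q k) / q ^ Suc k"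
    unfolding 2 using assms by (simp add: field_simps)
  finally show ?thesis
    unfolding 1 using assms by simp
qed

text \<open>For \<open>q \<noteq> 1\<close> the product \<open>(q - 1 / q) * qnum q k\<close> equals
  \<open>q ^ k - 1 / q ^ k\<close>, which could vanish only if \<open>q ^ (2 * k) = 1\<close>. For
  \<open>q = 1\<close> the q-number is the integer \<open>k\<close>, which is where characteristic
  zero enters.\<close>

lemma qnum_nonzero:
  fixes q :: "'k::field_char_0"
  assumes "generic q" "k > 0"
  shows "qnum q k \<noteq> 0"
proof (cases "q = 1")
  case True
  then show ?thesis using assms by (simp add: qnum_def)
next
  case False
  have q: "q \<noteq> 0" "\<And>k. k \<ge> 1 \<Longrightarrow> q ^ k \<noteq> 1"
    using assms False by (auto simp: generic_def)
  have "(q - 1 / q) * qnum q j = q ^ j - 1 / q ^ j" for j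
    using qnum_Suc[OF q(1), of j] qnum_Suc'[OF q(1), of j] by (simp add: algebra_simps)
  moreover have "q ^ k - 1 / q ^ k \<noteq> 0"
    using q(2)[of "k + k"] q(1) assms(2) by (simp add: power_add field_simps)
  ultimately show ?thesis by (metis mult_zero_right)
qed

section \<open>Antisymmetrizers in Hecke algebras\<close>

text \<open>An algebra over a field, presented as a ring with a central homomorphism from the field.
  The instances are \<open>tmat base N\<close> and, after extension of scalars,
  \<open>tmat B N\<close>.\<close>

locale central_scalars = ring S for S (structure) +
  fixes \<iota> :: "'k::field \<Rightarrow> 'a"
  assumes \<iota>_hom: "\<iota> \<in> ring_hom base S"
    and \<iota>_central: "x \<in> carrier S \<Longrightarrow> x \<otimes> \<iota> c = \<iota> c \<otimes> x"
begin

definition smul :: "'k \<Rightarrow> 'a \<Rightarrow> 'a" (infixr "\<cdot>" 75) where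
  "c \<cdot> x = \<iota> c \<otimes> x"

sublocale \<iota>: ring_hom_ring base S \<iota>
  by (rule ring_hom_ringI2[OF ring_ring_of_type_algebra ring_axioms \<iota>_hom])

lemma \<iota>_closed [simp]: "\<iota> c \<in> carrier S"
  using \<iota>.hom_closed[of c] by simp

lemma smul_closed [simp]: "x \<in> carrier S \<Longrightarrow> c \<cdot> x \<in> carrier S"
  by (simp add: smul_def)

lemma smul_mult [simp]:
  assumes "x \<in> carrier S" "y \<in> carrier S"
  shows "c \<cdot> x \<otimes> y = c \<cdot> (x \<otimes> y)" "x \<otimes> c \<cdot> y = c \<cdot> (x \<otimes> y)"
proof -
  show "c \<cdot> x \<otimes> y = c \<cdot> (x \<otimes> y)"
    using assms by (simp add: smul_def m_assoc)
  have "x \<otimes> (\<iota> c \<otimes> y) = (x \<otimes> \<iota> c) \<otimes> y" using assms by (simp add: m_assoc)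
  then show "x \<otimes> c \<cdot> y = c \<cdot> (x \<otimes> y)"
    using assms by (simp add: smul_def \<iota>_central m_assoc)
qed

lemma smul_smul [simp]: "x \<in> carrier S \<Longrightarrow> c \<cdot> d \<cdot> x = (c * d) \<cdot> x"
  using \<iota>.hom_mult[of c d] by (simp add: smul_def m_assoc)

lemma smul_one_zero [simp]:
  "x \<in> carrier S \<Longrightarrow> 1 \<cdot> x = x" "x \<in> carrier S \<Longrightarrow> 0 \<cdot> x = \<zero>" "c \<cdot> \<zero> = \<zero>"
  using \<iota>.hom_one \<iota>.hom_zero by (simp_all add: smul_def)

lemma smul_add_right: "x \<in> carrier S \<Longrightarrow> y \<in> carrier S \<Longrightarrow> c \<cdot> (x \<oplus> y) = c \<cdot> x \<oplus> c \<cdot> y"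
  by (simp add: smul_def r_distr)

lemma smul_add_left: "x \<in> carrier S \<Longrightarrow> (c + d) \<cdot> x = c \<cdot> x \<oplus> d \<cdot> x"
  using \<iota>.hom_add[of c d] by (simp add: smul_def l_distr)

lemma smul_eq_zero:
  assumes "x \<in> carrier S" "c \<cdot> x = \<zero>" "c \<noteq> 0"
  shows "x = \<zero>"
proof -
  have "x = (1 / c) \<cdot> c \<cdot> x" using assms(1,3) by simp
  also have "\<dots> = \<zero>" unfolding assms(2) by simp
  finally show ?thesis .
qed

text \<open>\<open>antisym q p l\<close> is the antisymmetrizer \<open>A\<^sub>l\<^sub>+\<^sub>1\<close>, written in terms of \<open>p i = R\<^sub>i + q\<^sup>-\<^sup>1\<close>.\<close>

primrec antisym :: "'k \<Rightarrow> (nat \<Rightarrow> 'a) \<Rightarrow> nat \<Rightarrow> 'a" where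
  "antisym q p 0 = \<one>"
| "antisym q p (Suc l) = (1 / qnum q (l + 2)) \<cdot> (antisym q p l \<otimes>
     (qnum q (l + 2) \<cdot> \<one> \<oplus> (- qnum q (l + 1)) \<cdot> p (Suc l)) \<otimes> antisym q p l)"

lemma antisym_closed [simp]: "(\<And>i. i \<in> {1..l} \<Longrightarrow> p i \<in> carrier S) \<Longrightarrow> antisym q p l \<in> carrier S"
  by (induction l) auto

lemma antisym_commute:
  assumes "x \<in> carrier S" "\<And>i. i \<in> {1..l} \<Longrightarrow> p i \<in> carrier S" "\<And>i. i \<in> {1..l} \<Longrightarrow> p i \<otimes> x = x \<otimes> p i"
  shows "antisym q p l \<otimes> x = x \<otimes> antisym q p l"
  using assms(2,3)
proof (induction l)
  case (Suc l)
  let ?e = "antisym q p l" and ?z = "qnum q (l + 2) \<cdot> \<one> \<oplus> (- qnum q (l + 1)) \<cdot> p (Suc l)"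
  have cl: "?e \<in> carrier S" "?z \<in> carrier S" "p (Suc l) \<in> carrier S"
    using Suc.prems(1) by (auto intro!: antisym_closed)
  have e: "?e \<otimes> x = x \<otimes> ?e"
    using Suc by simp
  have z: "?z \<otimes> x = x \<otimes> ?z"
    using assms(1) cl Suc.prems(2)[of "Suc l"] by (simp add: l_distr r_distr)
  have "?e \<otimes> ?z \<otimes> ?e \<otimes> x = ?e \<otimes> (?z \<otimes> x) \<otimes> ?e"
    using cl assms(1) e by (simp add: m_assoc)
  also have "\<dots> = (?e \<otimes> x) \<otimes> ?z \<otimes> ?e"
    unfolding z using cl assms(1) by (simp add: m_assoc)
  also have "\<dots> = x \<otimes> (?e \<otimes> ?z \<otimes> ?e)"
    unfolding e using cl assms(1) by (simp add: m_assoc)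
  finally show ?case
    using cl assms(1) by simp
qed (use assms(1) in simp)

text \<open>On an element killed by all the \<open>p i\<close>, the middle factor of the recursion
  acts as the number \<open>qnum q (l + 2)\<close>, which the normalisation cancels. Applied to an
  antisymmetrizer, this gives both idempotence and absorption of smaller or shifted ones.\<close>

lemma antisym_absorb_right:
  assumes "x \<in> carrier S" "\<And>i. i \<in> {1..l} \<Longrightarrow> p i \<in> carrier S" "\<And>i. i \<in> {1..l} \<Longrightarrow> x \<otimes> p i = \<zero>"
    and "\<And>k. k \<in> {1..Suc l} \<Longrightarrow> qnum q k \<noteq> 0"
  shows "x \<otimes> antisym q p l = x"
  using assms(2-4)
proof (induction l)
  case (Suc l)
  let ?e = "antisym q p l" and ?z = "qnum q (l + 2) \<cdot> \<one> \<oplus> (- qnum q (l + 1)) \<cdot> p (Suc l)"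
  have cl: "?e \<in> carrier S" "?z \<in> carrier S" "p (Suc l) \<in> carrier S"
    using Suc.prems(1) by (auto intro!: antisym_closed)
  have xe: "x \<otimes> ?e = x"
    using Suc by simp
  have "x \<otimes> (?e \<otimes> ?z \<otimes> ?e) = (x \<otimes> ?e) \<otimes> ?z \<otimes> ?e"
    using assms(1) cl by (simp add: m_assoc)
  also have "\<dots> = qnum q (l + 2) \<cdot> x"
    unfolding xe using assms(1) cl Suc.prems(2)[of "Suc l"] xe by (simp add: r_distr l_distr)
  finally show ?case
    using assms(1) cl Suc.prems(3)[of "l + 2"] by simp
qed (use assms(1) in simp)

lemma antisym_absorb_left:
  assumes "x \<in> carrier S" "\<And>i. i \<in> {1..l} \<Longrightarrow> p i \<in> carrier S" "\<And>i. i \<in> {1..l} \<Longrightarrow> p i \<otimes> x = \<zero>"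
    and "\<And>k. k \<in> {1..Suc l} \<Longrightarrow> qnum q k \<noteq> 0"
  shows "antisym q p l \<otimes> x = x"
  using assms(2-4)
proof (induction l)
  case (Suc l)
  let ?e = "antisym q p l" and ?z = "qnum q (l + 2) \<cdot> \<one> \<oplus> (- qnum q (l + 1)) \<cdot> p (Suc l)"
  have cl: "?e \<in> carrier S" "?z \<in> carrier S" "p (Suc l) \<in> carrier S"
    using Suc.prems(1) by (auto intro!: antisym_closed)
  have ex: "?e \<otimes> x = x"
    using Suc by simp
  have "?e \<otimes> ?z \<otimes> ?e \<otimes> x = ?e \<otimes> (?z \<otimes> (?e \<otimes> x))"
    using assms(1) cl by (simp add: m_assoc)
  also have "\<dots> = qnum q (l + 2) \<cdot> x"
    unfolding ex using assms(1) cl Suc.prems(2)[of "Suc l"] ex by (simp add: r_distr l_distr)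
  finally show ?case
    using assms(1) cl Suc.prems(3)[of "l + 2"] by simp
qed (use assms(1) in simp)

end

text \<open>The Hecke algebra on \<open>n\<close> generators, written in
  \<open>p i = R_i + 1/q\<close>. The substitution turns the Hecke condition into
  \<open>p_square\<close> and adds linear terms to the braid relation.\<close>

locale hecke_algebra = central_scalars S \<iota> for S (structure) and \<iota> :: "'k::field \<Rightarrow> 'a" +
  fixes q :: 'k and p :: "nat \<Rightarrow> 'a" and n :: nat
  assumes q_nonzero: "q \<noteq> 0"
    and qnum_nonzero: "k \<in> {1..Suc n} \<Longrightarrow> qnum q k \<noteq> 0"
    and p_closed: "i \<in> {1..n} \<Longrightarrow> p i \<in> carrier S"
    and p_square: "i \<in> {1..n} \<Longrightarrow> p i \<otimes> p i = (q + 1 / q) \<cdot> p i"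
    and p_braid: "1 \<le> i \<Longrightarrow> i < n \<Longrightarrow>
      p i \<otimes> p (Suc i) \<otimes> p i \<oplus> p (Suc i) = p (Suc i) \<otimes> p i \<otimes> p (Suc i) \<oplus> p i"
    and p_commute: "1 \<le> i \<Longrightarrow> Suc i < j \<Longrightarrow> j \<le> n \<Longrightarrow> p i \<otimes> p j = p j \<otimes> p i"
begin

lemma antisym_in_carrier: "l \<le> n \<Longrightarrow> antisym q p l \<in> carrier S"
  by (rule antisym_closed) (use p_closed in auto)

text \<open>Multiplying the braid relation by \<open>e\<close> on the left kills every term
  beginning with \<open>p i\<close> and leaves \<open>e p_{i+1} p_i p_{i+1} = e p_{i+1}\<close>.
  Hence all four terms of the product are multiples of \<open>e p_{i+1}\<close>. The numbers
  \<open>a, b, c, d\<close> stand for the coefficients in two consecutive steps of the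
  recursion.\<close>

lemma hecke_step_right:
  assumes "1 \<le> i" "i < n" "e \<in> carrier S" "e \<otimes> p i = \<zero>"
  shows "e \<otimes> (a \<cdot> \<one> \<oplus> b \<cdot> p (Suc i)) \<otimes> (c \<cdot> \<one> \<oplus> d \<cdot> p i) \<otimes> p (Suc i)
    = (a * c + b * c * (q + 1 / q) + b * d) \<cdot> (e \<otimes> p (Suc i))"
proof -
  let ?r = "p i" and ?p = "p (Suc i)"
  have cl: "?r \<in> carrier S" "?p \<in> carrier S"
    using assms by (auto intro: p_closed)
  note cl = cl assms(3)
  have er: "e \<otimes> (?r \<otimes> x) = \<zero>" if "x \<in> carrier S" for x
    using that cl assms(4) by (simp flip: m_assoc)
  have "e \<otimes> (?p \<otimes> ?r \<otimes> ?p \<oplus> ?r) = e \<otimes> (?r \<otimes> ?p \<otimes> ?r \<oplus> ?p)"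
    using p_braid[OF assms(1,2)] by simp
  then have prp: "e \<otimes> (?p \<otimes> (?r \<otimes> ?p)) = e \<otimes> ?p"
    using cl er assms(4) by (simp add: r_distr m_assoc)
  have pp: "?p \<otimes> ?p = (q + 1 / q) \<cdot> ?p"
    using assms by (intro p_square) auto
  have "e \<otimes> (a \<cdot> \<one> \<oplus> b \<cdot> ?p) \<otimes> (c \<cdot> \<one> \<oplus> d \<cdot> ?r) \<otimes> ?p
      = (a * c) \<cdot> (e \<otimes> ?p) \<oplus> (b * c * (q + 1 / q)) \<cdot> (e \<otimes> ?p) \<oplus> (b * d) \<cdot> (e \<otimes> ?p)"
    using cl by (simp add: l_distr r_distr m_assoc er assms(4) prp pp smul_add_right mult_ac)
  also have "\<dots> = (a * c + b * c * (q + 1 / q) + b * d) \<cdot> (e \<otimes> ?p)"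
    using cl by (simp add: smul_add_left del: mult_eq_0_iff)
  finally show ?thesis .
qed

lemma hecke_step_left:
  assumes "1 \<le> i" "i < n" "e \<in> carrier S" "p i \<otimes> e = \<zero>"
  shows "p (Suc i) \<otimes> ((c \<cdot> \<one> \<oplus> d \<cdot> p i) \<otimes> ((a \<cdot> \<one> \<oplus> b \<cdot> p (Suc i)) \<otimes> e))
    = (a * c + b * c * (q + 1 / q) + b * d) \<cdot> (p (Suc i) \<otimes> e)"
proof -
  let ?r = "p i" and ?p = "p (Suc i)"
  have cl: "?r \<in> carrier S" "?p \<in> carrier S"
    using assms by (auto intro: p_closed)
  note cl = cl assms(3)
  have "(?p \<otimes> ?r \<otimes> ?p \<oplus> ?r) \<otimes> e = (?r \<otimes> ?p \<otimes> ?r \<oplus> ?p) \<otimes> e"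
    using p_braid[OF assms(1,2)] by simp
  then have prp: "?p \<otimes> (?r \<otimes> (?p \<otimes> e)) = ?p \<otimes> e"
    using cl assms(4) by (simp add: l_distr m_assoc)
  have "?p \<otimes> ?p = (q + 1 / q) \<cdot> ?p"
    using assms by (intro p_square) auto
  then have pp: "?p \<otimes> (?p \<otimes> e) = (q + 1 / q) \<cdot> (?p \<otimes> e)"
    using cl by (simp flip: m_assoc)
  have "?p \<otimes> ((c \<cdot> \<one> \<oplus> d \<cdot> ?r) \<otimes> ((a \<cdot> \<one> \<oplus> b \<cdot> ?p) \<otimes> e))
      = (a * c) \<cdot> (?p \<otimes> e) \<oplus> (b * c * (q + 1 / q)) \<cdot> (?p \<otimes> e) \<oplus> (b * d) \<cdot> (?p \<otimes> e)"
    using cl by (simp add: l_distr r_distr m_assoc assms(4) prp pp smul_add_right mult_ac a_ac)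
  also have "\<dots> = (a * c + b * c * (q + 1 / q) + b * d) \<cdot> (?p \<otimes> e)"
    using cl by (simp add: smul_add_left del: mult_eq_0_iff)
  finally show ?thesis .
qed

text \<open>Only the newest generator \<open>p (Suc l)\<close> needs work, the older ones being
  killed by the outer factors \<open>?e\<close>. For it the inner \<open>?e\<close> is expanded once
  more by the recursion; its own outer factors commute with \<open>p (Suc l)\<close>, and what
  remains is the situation of \<open>hecke_step_right\<close> and
  \<open>hecke_step_left\<close>.\<close>

lemma antisym_annihilates:
  "l \<le> n \<Longrightarrow> i \<in> {1..l} \<Longrightarrow> antisym q p l \<otimes> p i = \<zero> \<and> p i \<otimes> antisym q p l = \<zero>"
proof (induction l arbitrary: i)
  case (Suc l)
  let ?e = "antisym q p l" and ?p = "p (Suc l)"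
  let ?z = "qnum q (l + 2) \<cdot> \<one> \<oplus> (- qnum q (l + 1)) \<cdot> ?p"
  have e: "?e \<in> carrier S"
    using Suc.prems by (intro antisym_in_carrier) auto
  have p: "?p \<in> carrier S" "p i \<in> carrier S"
    using Suc.prems by (auto intro!: p_closed)
  have z: "?z \<in> carrier S" using p by simp
  have "?e \<otimes> ?z \<otimes> ?e \<otimes> p i = \<zero> \<and> p i \<otimes> (?e \<otimes> ?z \<otimes> ?e) = \<zero>"
  proof (cases "i = Suc l")
    case False
    then have IH: "?e \<otimes> p i = \<zero>" "p i \<otimes> ?e = \<zero>"
      using Suc.IH[of i] Suc.prems by auto
    have "?e \<otimes> ?z \<otimes> ?e \<otimes> p i = ?e \<otimes> ?z \<otimes> (?e \<otimes> p i)"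
      "p i \<otimes> (?e \<otimes> ?z \<otimes> ?e) = (p i \<otimes> ?e) \<otimes> ?z \<otimes> ?e"
      using e p z by (simp_all add: m_assoc)
    then show ?thesis
      using e p z by (simp add: IH)
  next
    case i: True
    show ?thesis
    proof (cases l)
      \<comment> \<open>The second antisymmetrizer is \<open>1 - p 1 / (q + 1 / q)\<close>, and
        \<open>p 1\<close> squares to \<open>q + 1 / q\<close> times itself.\<close>
      case 0
      have pp: "?p \<otimes> ?p = (q + 1 / q) \<cdot> ?p"
        using Suc.prems by (intro p_square) auto
      have "qnum q (Suc (Suc 0)) = q + 1 / q"
        using qnum_Suc[OF q_nonzero, of 1] by simp
      moreover have "(q + 1 / q) \<cdot> ?p \<oplus> (- (q + 1 / q)) \<cdot> ?p = \<zero>"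
        using p(1) smul_add_left[of ?p "q + 1 / q" "- (q + 1 / q)"] by simp
      ultimately show ?thesis
        using i p(1) pp by (simp add: 0 l_distr r_distr)
    next
      case (Suc l')
      let ?a = "antisym q p l'" and ?r = "p l"
      let ?w = "qnum q (l' + 2) \<cdot> \<one> \<oplus> (- qnum q (l' + 1)) \<cdot> ?r"
      have a: "?a \<in> carrier S" and r: "?r \<in> carrier S"
        using Suc.prems Suc by (auto intro!: antisym_in_carrier p_closed)
      have w: "?w \<in> carrier S" using r by simp
      have e_def: "?e = (1 / qnum q (l' + 2)) \<cdot> (?a \<otimes> ?w \<otimes> ?a)"
        by (simp add: Suc)
      \<comment> \<open>\<open>?a\<close> involves only \<open>p 1, ..., p l'\<close>, whose indices
        differ from \<open>Suc l = l' + 2\<close> by at least two.\<close>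
      have ap: "?a \<otimes> ?p = ?p \<otimes> ?a"
        using Suc.prems Suc p(1) by (intro antisym_commute) (auto intro!: p_closed p_commute)
      have az: "?a \<otimes> ?z = ?z \<otimes> ?a"
        using a p(1) ap by (simp add: l_distr r_distr)
      have IH: "?e \<otimes> p j = \<zero>" "p j \<otimes> ?e = \<zero>" if "j \<in> {1..l}" for j
        using Suc.IH[of j] Suc.prems that by auto
      have lt: "l' < l" "l < n" using Suc Suc.prems by auto
      have side: "p j \<in> carrier S" "?e \<otimes> p j = \<zero>" "p j \<otimes> ?e = \<zero>" if "j \<in> {1..l'}" for j
        using lt that by (simp_all add: p_closed IH)
      have qn: "qnum q j \<noteq> 0" if "j \<in> {1..Suc l'}" for j
        using lt that by (simp add: qnum_nonzero)
      have ea: "?e \<otimes> ?a = ?e"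
        by (rule antisym_absorb_right[OF e side(1,2) qn])
      have ae: "?a \<otimes> ?e = ?e"
        by (rule antisym_absorb_left[OF e side(1,3) qn])
      \<comment> \<open>This is the coefficient produced by \<open>hecke_step_right\<close>. Since
        \<open>l' + 2 = l + 1\<close> and \<open>l' + 1 = l\<close>, it is
        \<open>qnum q (l + 1)\<close> times the three-term recurrence.\<close>
      have coef: "qnum q (l + 2) * qnum q (l' + 2) + - qnum q (l + 1) * qnum q (l' + 2) * (q + 1 / q)
          + - qnum q (l + 1) * - qnum q (l' + 1) = 0"
      proof -
        have "a * b + - b * b * r + - b * - c = b * ((a + c) - r * b)" for a b c r :: 'k
          by (simp add: algebra_simps)
        then show ?thesis
          using qnum_recurrence[OF q_nonzero, of "Suc l'"] by (simp add: Suc)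
      qed
      have l: "1 \<le> l" "l < n" using Suc Suc.prems by auto
      \<comment> \<open>Of the two copies of \<open>?a\<close>, the left one passes through
        \<open>?z\<close> and is absorbed by \<open>?e\<close>, while the right one passes through
        \<open>?p\<close> to the end.\<close>
      have "?e \<otimes> ?z \<otimes> (?a \<otimes> ?w \<otimes> ?a) \<otimes> ?p = ?e \<otimes> (?z \<otimes> ?a) \<otimes> ?w \<otimes> (?a \<otimes> ?p)"
        using e p z a r w by (simp add: m_assoc)
      also have "\<dots> = (?e \<otimes> ?a) \<otimes> ?z \<otimes> ?w \<otimes> ?p \<otimes> ?a"
        unfolding ap az[symmetric] using e p z a r w by (simp add: m_assoc)
      also have "?e \<otimes> ?a \<otimes> ?z \<otimes> ?w \<otimes> ?p = \<zero>"
        unfolding ea hecke_step_right[OF l e IH(1)[of l, OF atLeastAtMost_iff[THEN iffD2, OF conjI[OF l(1) order_refl]]]] coef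
        using e p(1) by simp
      finally have right: "?e \<otimes> ?z \<otimes> (?a \<otimes> ?w \<otimes> ?a) \<otimes> ?p = \<zero>"
        using a by simp
      have "?p \<otimes> (?a \<otimes> ?w \<otimes> ?a \<otimes> ?z \<otimes> ?e) = (?p \<otimes> ?a) \<otimes> ?w \<otimes> (?a \<otimes> ?z) \<otimes> ?e"
        using e p z a r w by (simp add: m_assoc)
      also have "\<dots> = ?a \<otimes> (?p \<otimes> (?w \<otimes> (?z \<otimes> (?a \<otimes> ?e))))"
        unfolding ap[symmetric] az using e p z a r w by (simp add: m_assoc)
      also have "?p \<otimes> (?w \<otimes> (?z \<otimes> (?a \<otimes> ?e))) = \<zero>"
        unfolding ae hecke_step_left[OF l e IH(2)[of l, OF atLeastAtMost_iff[THEN iffD2, OF conjI[OF l(1) order_refl]]]] coef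
        using e p(1) by simp
      finally have left: "?p \<otimes> (?a \<otimes> ?w \<otimes> ?a \<otimes> ?z \<otimes> ?e) = \<zero>"
        using a by simp
      have "?e \<otimes> ?z \<otimes> ?e \<otimes> ?p = (1 / qnum q (l' + 2)) \<cdot> (?e \<otimes> ?z \<otimes> (?a \<otimes> ?w \<otimes> ?a) \<otimes> ?p)"
        by (subst (2) e_def) (use e p z a w in simp)
      moreover have "?p \<otimes> (?e \<otimes> ?z \<otimes> ?e) = (1 / qnum q (l' + 2)) \<cdot> (?p \<otimes> (?a \<otimes> ?w \<otimes> ?a \<otimes> ?z \<otimes> ?e))"
        by (subst (1) e_def) (use e p z a w in simp)
      ultimately show ?thesis
        unfolding i left right by simp
    qed
  qed
  then show ?case
    using e p z by simp
qed auto

lemma antisym_idem: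
  assumes "l \<le> n"
  shows "antisym q p l \<otimes> antisym q p l = antisym q p l"
  using assms antisym_annihilates[OF assms]
  by (intro antisym_absorb_right antisym_in_carrier p_closed qnum_nonzero) auto

text \<open>With \<open>e = antisym q p l\<close>, vanishing of the next antisymmetrizer means
  \<open>e p_n e = ((n+1)_q / n_q) e\<close>. The shifted antisymmetrizer contains
  \<open>p n\<close> only in its last recursion step, and everything else in it is absorbed by
  \<open>e\<close>; so the product is a combination of \<open>e\<close> and
  \<open>e p_n e\<close>.\<close>

lemma antisym_shift:
  assumes "Suc l = n" "antisym q p (Suc l) = \<zero>"
  shows "antisym q p l \<otimes> antisym q (\<lambda>i. p (Suc i)) l \<otimes> antisym q p l
    = (1 / (qnum q n)\<^sup>2) \<cdot> antisym q p l"
proof (cases l)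
  case 0
  with assms(1) have "n = Suc 0" by simp
  then show ?thesis unfolding 0 by simp
next
  case (Suc l')
  let ?e = "antisym q p l" and ?p = "p n" and ?b = "antisym q (\<lambda>i. p (Suc i)) l'"
  have e: "?e \<in> carrier S" using assms by (intro antisym_in_carrier) auto
  have b: "?b \<in> carrier S" using assms Suc by (intro antisym_closed p_closed) auto
  have p: "?p \<in> carrier S" using assms by (intro p_closed) auto
  have ann: "?e \<otimes> p i = \<zero>" "p i \<otimes> ?e = \<zero>" if "i \<in> {1..l}" for i
    using antisym_annihilates[of l i] assms that by auto
  have lt: "l' < l" "l < n" using Suc assms(1) by auto
  \<comment> \<open>The inner part \<open>?b\<close> of the shifted antisymmetrizer involves
    \<open>p 2, ..., p l\<close>, all of which are killed by \<open>?e\<close>.\<close>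
  have side: "p (Suc j) \<in> carrier S" "?e \<otimes> p (Suc j) = \<zero>" "p (Suc j) \<otimes> ?e = \<zero>" if "j \<in> {1..l'}" for j
    using lt that by (simp_all add: p_closed ann)
  have qn: "qnum q j \<noteq> 0" if "j \<in> {1..Suc l'}" for j
    using lt that by (simp add: qnum_nonzero)
  have eb: "?e \<otimes> ?b = ?e"
    by (rule antisym_absorb_right[OF e side(1,2) qn])
  have be: "?b \<otimes> ?e = ?e"
    by (rule antisym_absorb_left[OF e side(1,3) qn])
  have ee: "?e \<otimes> ?e = ?e"
    using assms by (intro antisym_idem) auto
  have n: "n = l + 1" "n = l' + 2" "Suc n = l + 2" "l = l' + 1" using assms Suc by auto
  have nz: "qnum q n \<noteq> 0" "qnum q (Suc n) \<noteq> 0"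
    using assms(1) by (auto intro!: qnum_nonzero)
  have ez: "?e \<otimes> (a \<cdot> \<one> \<oplus> c \<cdot> ?p) \<otimes> ?e = a \<cdot> ?e \<oplus> c \<cdot> (?e \<otimes> ?p \<otimes> ?e)" for a c
    using e p ee by (simp add: l_distr r_distr)
  have "(1 / qnum q (Suc n)) \<cdot> (?e \<otimes> (qnum q (Suc n) \<cdot> \<one> \<oplus> (- qnum q n) \<cdot> ?p) \<otimes> ?e) = \<zero>"
    using assms(2) n(1) by simp
  then have "(1 / qnum q (Suc n)) \<cdot> (qnum q (Suc n) \<cdot> ?e \<oplus> (- qnum q n) \<cdot> (?e \<otimes> ?p \<otimes> ?e)) = \<zero>"
    unfolding ez .
  then have zero: "qnum q (Suc n) \<cdot> ?e \<oplus> (- qnum q n) \<cdot> (?e \<otimes> ?p \<otimes> ?e) = \<zero>"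
    by (rule smul_eq_zero[rotated]) (use nz e p in simp_all)
  have epe: "?e \<otimes> ?p \<otimes> ?e = (qnum q (Suc n) / qnum q n) \<cdot> ?e"
  proof -
    \<comment> \<open>The term \<open>?e \<otimes> ?p \<otimes> ?e\<close> is subtracted and added
      back, so that the vanishing combination appears divided by \<open>qnum q n\<close>.\<close>
    have "(qnum q (Suc n) / qnum q n) \<cdot> ?e = (qnum q (Suc n) / qnum q n) \<cdot> ?e
       \<oplus> ((- 1) \<cdot> (?e \<otimes> ?p \<otimes> ?e) \<oplus> 1 \<cdot> (?e \<otimes> ?p \<otimes> ?e))"
      using e p smul_add_left[of "?e \<otimes> ?p \<otimes> ?e" "-1" 1] by simp
    also have "\<dots> = (1 / qnum q n) \<cdot> (qnum q (Suc n) \<cdot> ?e \<oplus> (- qnum q n) \<cdot> (?e \<otimes> ?p \<otimes> ?e)) \<oplus> (?e \<otimes> ?p \<otimes> ?e)"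
      using e p nz by (simp add: smul_add_right a_assoc)
    also have "\<dots> = ?e \<otimes> ?p \<otimes> ?e"
      unfolding zero using e p by simp
    finally show ?thesis by simp
  qed
  let ?z = "qnum q n \<cdot> \<one> \<oplus> (- qnum q l) \<cdot> ?p"
  have z: "?z \<in> carrier S" using p by simp
  have "?e \<otimes> antisym q (\<lambda>i. p (Suc i)) l \<otimes> ?e
      = (1 / qnum q n) \<cdot> (?e \<otimes> (?b \<otimes> ?z \<otimes> ?b) \<otimes> ?e)"
    using e b p z unfolding n(2) by (simp add: Suc)
  also have "?e \<otimes> (?b \<otimes> ?z \<otimes> ?b) \<otimes> ?e = (?e \<otimes> ?b) \<otimes> ?z \<otimes> (?b \<otimes> ?e)"
    using e b z by (simp add: m_assoc)
  also have "\<dots> = qnum q n \<cdot> ?e \<oplus> (- qnum q l) \<cdot> (?e \<otimes> ?p \<otimes> ?e)"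
    unfolding eb be ez ..
  also have "\<dots> = (qnum q n - qnum q l * (qnum q (Suc n) / qnum q n)) \<cdot> ?e"
    unfolding epe using e smul_add_left[of ?e "qnum q n" "- (qnum q l * (qnum q (Suc n) / qnum q n))"] by simp
  also have "qnum q n - qnum q l * (qnum q (Suc n) / qnum q n) = 1 / qnum q n"
  proof -
    have "a - b * (c / a) = (a * a - b * c) / a" if "a \<noteq> 0" for a b c :: 'k
      using that by (simp add: field_simps)
    then show ?thesis
      using qnum_discriminant[OF q_nonzero, of l] nz(1) unfolding assms(1) by simp
  qed
  finally show ?thesis
    using e by (simp add: power2_eq_square)
qed

end

section \<open>Barred copies\<close>

context monoid
begin

lemma inv_Units_cancel:
  assumes "u \<in> Units G" "a \<in> carrier G"
  shows "inv u \<otimes> (u \<otimes> a) = a" "u \<otimes> (inv u \<otimes> a) = a"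
  using assms Units_closed[OF assms(1)] by (simp_all flip: m_assoc)

lemma inv_mult_Units:
  assumes "a \<in> Units G" "b \<in> Units G"
  shows "inv (a \<otimes> b) = inv b \<otimes> inv a"
  using assms Units_closed[OF assms(1)] Units_closed[OF assms(2)]
  by (intro inv_unique'[symmetric]) (auto simp: m_assoc inv_Units_cancel)

end

text \<open>Here \<open>g i\<close> stands for \<open>R_i\<close> and \<open>x\<close> for the
  matrix in the first factor. Only products of these occur in the theory of the copies, so a monoid
  is the natural setting; there are \<open>n\<close> generators for \<open>n + 1\<close> tensor
  factors.\<close>

locale barred_copies = monoid G for G (structure) +
  fixes g :: "nat \<Rightarrow> 'a" and x :: 'a and n :: nat
  assumes g_Units: "i \<in> {1..n} \<Longrightarrow> g i \<in> Units G"
    and g_braid: "1 \<le> i \<Longrightarrow> i < n \<Longrightarrow> g i \<otimes> g (Suc i) \<otimes> g i = g (Suc i) \<otimes> g i \<otimes> g (Suc i)"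
    and g_commute: "1 \<le> i \<Longrightarrow> Suc i < j \<Longrightarrow> j \<le> n \<Longrightarrow> g i \<otimes> g j = g j \<otimes> g i"
    and x_closed: "x \<in> carrier G"
    and g_x: "2 \<le> i \<Longrightarrow> i \<le> n \<Longrightarrow> g i \<otimes> x = x \<otimes> g i"
    and reflection: "1 \<le> n \<Longrightarrow> g 1 \<otimes> x \<otimes> g 1 \<otimes> x = x \<otimes> g 1 \<otimes> x \<otimes> g 1"
begin

text \<open>\<open>copy l\<close> is the copy with barred index \<open>l + 1\<close>.\<close>

primrec copy :: "nat \<Rightarrow> 'a" where
  "copy 0 = x"
| "copy (Suc l) = g (Suc l) \<otimes> copy l \<otimes> inv (g (Suc l))"

declare copy.simps(2) [simp del]

primrec copies_prod :: "nat \<Rightarrow> 'a" where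
  "copies_prod 0 = x"
| "copies_prod (Suc l) = copies_prod l \<otimes> copy (Suc l)"

text \<open>The product \<open>g l ... g 1\<close>, which conjugates \<open>x\<close> into
  \<open>copy l\<close>.\<close>

primrec descent :: "nat \<Rightarrow> 'a" where
  "descent 0 = \<one>"
| "descent (Suc l) = g (Suc l) \<otimes> descent l"

lemma g_closed: "i \<in> {1..n} \<Longrightarrow> g i \<in> carrier G"
  using g_Units by (auto intro: Units_closed)

lemma copy_closed: "l \<le> n \<Longrightarrow> copy l \<in> carrier G"
  by (induction l) (auto simp: copy.simps(2) x_closed g_Units g_closed)

lemma copies_prod_closed: "l \<le> n \<Longrightarrow> copies_prod l \<in> carrier G"
proof (induction l)
  case (Suc l)
  then show ?case
    using copy_closed[of "Suc l"] by (auto)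
qed (simp add: x_closed)

lemma descent_Units: "l \<le> n \<Longrightarrow> descent l \<in> Units G"
  by (induction l) (auto simp: g_Units)

lemma copy_descent: "l \<le> n \<Longrightarrow> copy l = descent l \<otimes> x \<otimes> inv (descent l)"
proof (induction l)
  case (Suc l)
  then have "g (Suc l) \<in> Units G" "descent l \<in> Units G"
    by (auto intro: g_Units descent_Units)
  note this this[THEN Units_closed]
  with Suc show ?case
    by (simp add: copy.simps(2) inv_mult_Units m_assoc x_closed)
qed (simp add: x_closed)

lemma commute_conjugate:
  assumes "a \<in> carrier G" "b \<in> carrier G" "u \<in> Units G" "a \<otimes> u = u \<otimes> a" "a \<otimes> b = b \<otimes> a"
  shows "a \<otimes> (u \<otimes> b \<otimes> inv u) = u \<otimes> b \<otimes> inv u \<otimes> a"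
proof -
  have u: "u \<in> carrier G" using assms(3) by (rule Units_closed)
  have inv: "a \<otimes> inv u = inv u \<otimes> a"
  proof -
    have "inv u \<otimes> (a \<otimes> u) \<otimes> inv u = inv u \<otimes> (u \<otimes> a) \<otimes> inv u"
      by (simp only: assms(4))
    moreover have "inv u \<otimes> (a \<otimes> u) \<otimes> inv u = inv u \<otimes> a"
      using assms(1,3) u by (simp add: m_assoc)
    moreover have "inv u \<otimes> (u \<otimes> a) \<otimes> inv u = a \<otimes> inv u"
      using assms(1,3) u by (simp flip: m_assoc)
    ultimately show ?thesis by simp
  qed
  have "a \<otimes> (u \<otimes> b \<otimes> inv u) = (a \<otimes> u) \<otimes> b \<otimes> inv u"
    using assms(1-3) u by (simp add: m_assoc)
  also have "\<dots> = u \<otimes> (a \<otimes> b) \<otimes> inv u"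
    unfolding assms(4) using assms(1-3) u by (simp add: m_assoc)
  also have "\<dots> = u \<otimes> b \<otimes> (a \<otimes> inv u)"
    unfolding assms(5) using assms(1-3) u by (simp add: m_assoc)
  also have "\<dots> = u \<otimes> b \<otimes> inv u \<otimes> a"
    unfolding inv using assms(1-3) u by (simp add: m_assoc)
  finally show ?thesis .
qed

text \<open>\<open>copy l\<close> is formed from \<open>x\<close> and \<open>g 1, ..., g l\<close>;
  each of these commutes with \<open>g i\<close> once \<open>i > l + 1\<close>.\<close>

lemma copy_commute_above: "Suc l < i \<Longrightarrow> i \<le> n \<Longrightarrow> g i \<otimes> copy l = copy l \<otimes> g i"
proof (induction l)
  case (Suc l)
  then show ?case
    unfolding copy.simps
    by (intro commute_conjugate g_closed copy_closed g_Units g_commute[symmetric]) auto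
qed (simp add: g_x)

lemma copy_Suc_Suc:
  assumes "Suc (Suc l) \<le> n"
  shows "copy (Suc (Suc l)) = (g (Suc (Suc l)) \<otimes> g (Suc l)) \<otimes> copy l \<otimes> inv (g (Suc (Suc l)) \<otimes> g (Suc l))"
  using assms g_Units[of "Suc l"] g_Units[of "Suc (Suc l)"] copy_closed[of l] g_closed[of "Suc l"] g_closed[of "Suc (Suc l)"]
  by (simp add: copy.simps(2) inv_mult_Units m_assoc)

text \<open>The essential case is \<open>i = l - 1\<close>. There \<open>copy l\<close> is the
  conjugate of \<open>copy (l - 2)\<close> by \<open>b a\<close> with \<open>a = g (l - 1)\<close>
  and \<open>b = g l\<close>. The braid relation \<open>a (b a) = (b a) b\<close> turns
  \<open>a\<close> into \<open>b\<close> while passing the conjugator, \<open>b\<close> commutes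
  with \<open>copy (l - 2)\<close>, and the inverse conjugator turns it back into
  \<open>a\<close>.\<close>

lemma copy_commute_below: "1 \<le> i \<Longrightarrow> i < l \<Longrightarrow> l \<le> n \<Longrightarrow> g i \<otimes> copy l = copy l \<otimes> g i"
proof (induction l)
  case (Suc l)
  show ?case
  proof (cases "i = l")
    case False
    then show ?thesis
      using Suc unfolding copy.simps
      by (intro commute_conjugate g_closed copy_closed g_Units g_commute) auto
  next
    case True
    then obtain k where k: "l = Suc k" using Suc.prems(1) by (cases l) auto
    let ?a = "g (Suc k)" and ?b = "g (Suc (Suc k))" and ?c = "copy k"
    have cl: "?a \<in> Units G" "?b \<in> Units G" "?c \<in> carrier G"
      using Suc.prems k by (auto intro!: g_Units copy_closed)
    have cl': "?a \<in> carrier G" "?b \<in> carrier G"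
      using cl by auto
    have br: "?a \<otimes> (?b \<otimes> ?a) = ?b \<otimes> ?a \<otimes> ?b"
      using g_braid[of "Suc k"] Suc.prems k cl' by (simp add: m_assoc)
    \<comment> \<open>The braid relation once more, multiplied on both sides by the inverse of the
      conjugator.\<close>
    have br': "?b \<otimes> inv (?b \<otimes> ?a) = inv (?b \<otimes> ?a) \<otimes> ?a"
    proof -
      have "inv (?b \<otimes> ?a) \<otimes> (?a \<otimes> (?b \<otimes> ?a)) \<otimes> inv (?b \<otimes> ?a)
          = inv (?b \<otimes> ?a) \<otimes> ((?b \<otimes> ?a) \<otimes> ?b) \<otimes> inv (?b \<otimes> ?a)"
        by (simp only: br)
      moreover have "inv (?b \<otimes> ?a) \<otimes> (?a \<otimes> (?b \<otimes> ?a)) \<otimes> inv (?b \<otimes> ?a)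
          = inv (?b \<otimes> ?a) \<otimes> ?a \<otimes> ((?b \<otimes> ?a) \<otimes> inv (?b \<otimes> ?a))"
        using cl cl' by (simp only: m_assoc Units_m_closed Units_inv_closed m_closed)
      moreover have "inv (?b \<otimes> ?a) \<otimes> ((?b \<otimes> ?a) \<otimes> ?b) \<otimes> inv (?b \<otimes> ?a)
          = ?b \<otimes> inv (?b \<otimes> ?a)"
        using cl cl' by (simp only: inv_Units_cancel Units_m_closed Units_inv_closed m_closed)
      ultimately show ?thesis
        using cl cl' by simp
    qed
    have comm: "?b \<otimes> ?c = ?c \<otimes> ?b"
      using Suc.prems k by (intro copy_commute_above) auto
    have "?a \<otimes> ((?b \<otimes> ?a) \<otimes> ?c \<otimes> inv (?b \<otimes> ?a)) = (?a \<otimes> (?b \<otimes> ?a)) \<otimes> ?c \<otimes> inv (?b \<otimes> ?a)"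
      using cl cl' by (simp add: m_assoc)
    also have "\<dots> = ?b \<otimes> ?a \<otimes> (?b \<otimes> ?c) \<otimes> inv (?b \<otimes> ?a)"
      unfolding br using cl cl' by (simp add: m_assoc)
    also have "\<dots> = ?b \<otimes> ?a \<otimes> ?c \<otimes> (?b \<otimes> inv (?b \<otimes> ?a))"
      unfolding comm using cl cl' by (simp add: m_assoc)
    also have "\<dots> = (?b \<otimes> ?a) \<otimes> ?c \<otimes> inv (?b \<otimes> ?a) \<otimes> ?a"
      unfolding br' using cl cl' by (simp add: m_assoc)
    finally show ?thesis
      using copy_Suc_Suc[of k] Suc.prems k True by simp
  qed
qed simp

text \<open>Conjugation by \<open>g (l + 1) g (l + 2)\<close> carries the reflection equation for \<open>copy l\<close> to the one
  for \<open>copy (l + 1)\<close>.\<close>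

lemma copy_reflection:
  "Suc l \<le> n \<Longrightarrow> g (Suc l) \<otimes> copy l \<otimes> g (Suc l) \<otimes> copy l = copy l \<otimes> g (Suc l) \<otimes> copy l \<otimes> g (Suc l)"
proof (induction l)
  case 0
  then show ?case using reflection by simp
next
  case (Suc l)
  let ?a = "g (Suc l)" and ?b = "g (Suc (Suc l))" and ?c = "copy l" and ?d = "copy (Suc l)"
  have cl: "?a \<in> Units G" "?b \<in> Units G" "?c \<in> carrier G" "?d \<in> carrier G"
    using Suc.prems copy_closed[of "Suc l"] by (auto intro!: g_Units copy_closed)
  have cl': "?a \<in> carrier G" "?b \<in> carrier G" "?a \<otimes> ?b \<in> Units G"
    using cl by auto
  let ?u = "?a \<otimes> ?b"
  have u: "?u \<in> carrier G" "inv ?u \<in> carrier G" using cl' by auto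
  have "?u \<otimes> ?a = ?b \<otimes> ?u"
    using g_braid[of "Suc l"] Suc.prems cl' by (simp add: m_assoc)
  then have b: "?b = ?u \<otimes> ?a \<otimes> inv ?u"
    using cl cl' u by (simp add: m_assoc del: Units_m_closed)
  have "?u \<otimes> ?c = ?d \<otimes> ?u"
  proof -
    have "?u \<otimes> ?c = ?a \<otimes> (?b \<otimes> ?c)"
      using cl cl' by (simp add: m_assoc)
    also have "?b \<otimes> ?c = ?c \<otimes> ?b"
      using Suc.prems by (intro copy_commute_above) auto
    also have "?a \<otimes> (?c \<otimes> ?b) = ?d \<otimes> ?u"
      using cl cl' by (simp add: copy.simps(2) m_assoc inv_Units_cancel)
    finally show ?thesis .
  qed
  then have d: "?d = ?u \<otimes> ?c \<otimes> inv ?u"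
    using cl cl' u by (simp add: m_assoc)
  have IH: "?a \<otimes> (?c \<otimes> (?a \<otimes> ?c)) = ?c \<otimes> (?a \<otimes> (?c \<otimes> ?a))"
    using Suc cl cl' by (simp add: m_assoc)
  have conj: "(?u \<otimes> w \<otimes> inv ?u) \<otimes> (?u \<otimes> x \<otimes> inv ?u) \<otimes> (?u \<otimes> y \<otimes> inv ?u) \<otimes> (?u \<otimes> z \<otimes> inv ?u)
      = ?u \<otimes> (w \<otimes> (x \<otimes> (y \<otimes> z))) \<otimes> inv ?u"
    if "w \<in> carrier G" "x \<in> carrier G" "y \<in> carrier G" "z \<in> carrier G" for w x y z
  proof -
    define v where "v = ?u"
    have "v \<in> Units G" "v \<in> carrier G" using cl' u by (simp_all add: v_def)
    then show ?thesis
      using that unfolding v_def[symmetric] by (simp add: m_assoc inv_Units_cancel)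
  qed
  have "?b \<otimes> ?d \<otimes> ?b \<otimes> ?d = (?u \<otimes> ?a \<otimes> inv ?u) \<otimes> (?u \<otimes> ?c \<otimes> inv ?u) \<otimes> (?u \<otimes> ?a \<otimes> inv ?u) \<otimes> (?u \<otimes> ?c \<otimes> inv ?u)"
    by (simp only: b[symmetric] d[symmetric])
  also have "\<dots> = (?u \<otimes> ?c \<otimes> inv ?u) \<otimes> (?u \<otimes> ?a \<otimes> inv ?u) \<otimes> (?u \<otimes> ?c \<otimes> inv ?u) \<otimes> (?u \<otimes> ?a \<otimes> inv ?u)"
    by (simp only: conj cl cl' IH)
  also have "\<dots> = ?d \<otimes> ?b \<otimes> ?d \<otimes> ?b"
    by (simp only: b[symmetric] d[symmetric])
  finally show ?case .
qed

text \<open>As \<open>copy (Suc l)\<close> is the conjugate of \<open>copy l\<close> by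
  \<open>g (Suc l)\<close>, this is the reflection equation for \<open>copy l\<close> multiplied on
  the right by the inverse of \<open>g (Suc l)\<close>.\<close>

lemma copy_pair_commute:
  assumes "Suc l \<le> n"
  shows "g (Suc l) \<otimes> (copy l \<otimes> copy (Suc l)) = copy l \<otimes> copy (Suc l) \<otimes> g (Suc l)"
proof -
  let ?a = "g (Suc l)" and ?c = "copy l"
  have cl: "?a \<in> Units G" "?a \<in> carrier G" "?c \<in> carrier G"
    using assms g_Units[of "Suc l"] by (auto intro: copy_closed)
  have "?a \<otimes> (?c \<otimes> copy (Suc l)) = (?a \<otimes> ?c \<otimes> ?a \<otimes> ?c) \<otimes> inv ?a"
    using cl by (simp add: copy.simps(2) m_assoc)
  also have "\<dots> = ?c \<otimes> copy (Suc l) \<otimes> ?a"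
    unfolding copy_reflection[OF assms] using cl by (simp add: copy.simps(2) m_assoc)
  finally show ?thesis .
qed

lemma copies_prod_commute_above:
  "Suc l < i \<Longrightarrow> i \<le> n \<Longrightarrow> g i \<otimes> copies_prod l = copies_prod l \<otimes> g i"
proof (induction l)
  case (Suc l)
  let ?P = "copies_prod l" and ?c = "copy (Suc l)"
  have cl: "?P \<in> carrier G" "?c \<in> carrier G" "g i \<in> carrier G"
    using Suc.prems copy_closed[of "Suc l"]
    by (auto intro!: copies_prod_closed g_closed)
  have "g i \<otimes> (?P \<otimes> ?c) = (g i \<otimes> ?P) \<otimes> ?c"
    using cl by (simp add: m_assoc)
  also have "\<dots> = ?P \<otimes> (g i \<otimes> ?c)"
    using Suc cl by (simp add: m_assoc)
  also have "\<dots> = ?P \<otimes> ?c \<otimes> g i"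
    using copy_commute_above[of "Suc l" i] Suc.prems cl by (simp add: m_assoc)
  finally show ?case by simp
qed (simp add: g_x)

text \<open>The generator \<open>g i\<close> commutes with the copies before
  \<open>copy (i - 1)\<close>, with the product of \<open>copy (i - 1)\<close> and
  \<open>copy i\<close>, and with every later copy. With the two middle factors separately it need
  not commute.\<close>

lemma copies_prod_commute:
  "l \<le> n \<Longrightarrow> i \<in> {1..l} \<Longrightarrow> g i \<otimes> copies_prod l = copies_prod l \<otimes> g i"
proof (induction l)
  case (Suc l)
  let ?P = "copies_prod l" and ?c = "copy (Suc l)"
  have cl: "?P \<in> carrier G" "?c \<in> carrier G" "g i \<in> carrier G"
    using Suc.prems copy_closed[of "Suc l"]
    by (auto intro!: copies_prod_closed g_closed)
  have "g i \<otimes> (?P \<otimes> ?c) = ?P \<otimes> ?c \<otimes> g i"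
  proof (cases "i = Suc l")
    case False
    have "g i \<otimes> (?P \<otimes> ?c) = (g i \<otimes> ?P) \<otimes> ?c"
      using cl by (simp add: m_assoc)
    also have "\<dots> = ?P \<otimes> (g i \<otimes> ?c)"
      using Suc False cl by (simp add: m_assoc)
    also have "\<dots> = ?P \<otimes> ?c \<otimes> g i"
      using copy_commute_below[of i "Suc l"] Suc.prems False cl by (simp add: m_assoc)
    finally show ?thesis .
  next
    case True
    show ?thesis
    proof (cases l)
      case 0
      then show ?thesis
        using copy_pair_commute[of 0] Suc.prems True by simp
    next
      case (Suc k)
      let ?P' = "copies_prod k" and ?d = "copy l"
      have cl2: "?P' \<in> carrier G" "?d \<in> carrier G"
        using Suc Suc.prems copy_closed[of l]
        by (auto intro!: copies_prod_closed)
      have P: "?P = ?P' \<otimes> ?d" by (simp add: Suc)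
      have "g i \<otimes> (?P \<otimes> ?c) = (g i \<otimes> ?P') \<otimes> (?d \<otimes> ?c)"
        unfolding P using cl cl2 by (simp add: m_assoc)
      also have "\<dots> = ?P' \<otimes> (g i \<otimes> (?d \<otimes> ?c))"
        using copies_prod_commute_above[of k i] Suc Suc.prems True cl cl2
        by (simp add: m_assoc)
      also have "g i \<otimes> (?d \<otimes> ?c) = ?d \<otimes> ?c \<otimes> g i"
        using copy_pair_commute[of l] Suc.prems True by (simp)
      finally show ?thesis
        unfolding P using cl cl2 by (simp add: m_assoc)
    qed
  qed
  then show ?case by simp
qed simp

lemma copies_prod_first: "l \<le> n \<Longrightarrow> \<exists>y\<in>carrier G. copies_prod l = x \<otimes> y"
proof (induction l)
  case (Suc l)
  then obtain y where "y \<in> carrier G" "copies_prod l = x \<otimes> y" by auto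
  with Suc show ?case
    using copy_closed[of "Suc l"]
    by (intro bexI[of _ "y \<otimes> copy (Suc l)"]) (auto simp: m_assoc x_closed)
qed (use x_closed in \<open>auto intro!: bexI[of _ \<one>]\<close>)

text \<open>The last copy ends with the inverse of \<open>descent l\<close>, which the
  multiplication cancels; the rest is collected in \<open>y\<close>.\<close>

lemma copies_prod_last:
  assumes "l \<le> n"
  shows "\<exists>y\<in>carrier G. copies_prod l \<otimes> descent l = y \<otimes> x"
proof (cases l)
  case 0
  then show ?thesis using x_closed by (auto intro!: bexI[of _ \<one>])
next
  case (Suc k)
  have cl: "copies_prod k \<in> carrier G" "descent l \<in> Units G"
    using assms Suc by (auto intro!: copies_prod_closed descent_Units simp del: descent.simps)
  have "copies_prod l \<otimes> descent l = copies_prod k \<otimes> copy l \<otimes> descent l"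
    by (simp add: Suc)
  also have "\<dots> = copies_prod k \<otimes> descent l \<otimes> x"
    unfolding copy_descent[OF assms] using cl Units_closed[OF cl(2)] x_closed by (simp add: m_assoc)
  finally show ?thesis
    using cl by (intro bexI[of _ "copies_prod k \<otimes> descent l"]) auto
qed

end

section \<open>Rank one antisymmetrizers\<close>

text \<open>\<open>v\<close> is the row chosen as a basis of the row space, and \<open>u I\<close>
  is the coordinate of row \<open>I\<close> with respect to it.\<close>

lemma tm_rank_one_factor:
  fixes Y :: "('n, 'k::field) tm"
  assumes "tm_rank k Y = 1"
  obtains u v I\<^sub>0 J\<^sub>0 where "\<And>I J. I \<in> idx k \<Longrightarrow> J \<in> idx k \<Longrightarrow> Y (I, J) = u I * v J"
    and "I\<^sub>0 \<in> idx k" "u I\<^sub>0 \<noteq> 0" "J\<^sub>0 \<in> idx k" "v J\<^sub>0 \<noteq> 0"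
proof -
  interpret vector_space "\<lambda>c (v :: 'n list \<Rightarrow> 'k) J. c * v J"
    by unfold_locales (auto simp: fun_eq_iff algebra_simps)
  define rows where "rows = (\<lambda>I J. if J \<in> idx k then Y (I, J) else 0) ` idx k"
  have dim: "dim rows = 1"
    using assms unfolding tm_rank_def rows_def .
  obtain B where B: "B \<subseteq> rows" "independent B" "rows \<subseteq> span B" "card B = dim rows"
    using basis_exists[of rows] by blast
  then obtain v where v: "B = {v}"
    using dim by (auto simp: card_1_singleton_iff)
  have "\<exists>c. \<forall>J\<in>idx k. Y (I, J) = c * v J" if "I \<in> idx k" for I
  proof -
    have "(\<lambda>J. if J \<in> idx k then Y (I, J) else 0) \<in> span {v}"
      using B(3) v that unfolding rows_def by blast
    then show ?thesis
      unfolding span_singleton by (auto simp: fun_eq_iff) metis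
  qed
  then obtain u where u: "\<And>I J. I \<in> idx k \<Longrightarrow> J \<in> idx k \<Longrightarrow> Y (I, J) = u I * v J"
    by metis
  have "v \<in> rows" "v \<noteq> 0"
    using B(1,2) v dependent_zero[of B] by auto
  then obtain I\<^sub>0 where I: "I\<^sub>0 \<in> idx k" "v = (\<lambda>J. if J \<in> idx k then Y (I\<^sub>0, J) else 0)"
    unfolding rows_def by auto
  obtain J\<^sub>0 where "v J\<^sub>0 \<noteq> 0"
    using \<open>v \<noteq> 0\<close> by (auto simp: fun_eq_iff)
  moreover from this have "J\<^sub>0 \<in> idx k" "Y (I\<^sub>0, J\<^sub>0) \<noteq> 0"
    using I(2) by (metis (mono_tags, lifting))+
  moreover from this have "u I\<^sub>0 \<noteq> 0"
    using u[OF I(1)] by force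
  ultimately show ?thesis
    using that u I(1) by blast
qed

lemma sum_idx_Suc:
  "(\<Sum>H\<in>idx (Suc l). f H) = (\<Sum>a\<in>UNIV. \<Sum>H\<in>idx l. f (a # H :: 'n::finite list))"
proof -
  have "idx (Suc l) = (\<lambda>(a, H). a # H) ` (UNIV \<times> (idx l :: 'n list set))"
    by (auto simp: idx_def length_Suc_conv image_iff)
  then show ?thesis
    by (simp add: sum.reindex inj_on_def sum.cartesian_product split_beta)
qed

text \<open>The identity \<open>A_1 A_2 A_1 = \<kappa> A_1\<close> yields
  \<open>\<beta> \<alpha> = 1\<close>, whereas duals in the first tensor factor require
  \<open>\<alpha> \<beta> = 1\<close>. Over a field these are equivalent because the dimension is
  finite.\<close>

lemma square_matrix_right_inverse:
  fixes \<alpha> \<beta> :: "'n::finite \<Rightarrow> 'n \<Rightarrow> 'k::field"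
  assumes "\<And>x y. (\<Sum>a\<in>UNIV. \<beta> x a * \<alpha> a y) = (if x = y then 1 else 0)"
  shows "(\<Sum>y\<in>UNIV. \<alpha> a y * \<beta> y d) = (if a = d then 1 else 0)"
proof -
  have "(\<chi> x a. \<beta> x a) ** (\<chi> a y. \<alpha> a y) = mat 1"
    using assms by (simp add: matrix_matrix_mult_def mat_def vec_eq_iff)
  then have "(\<chi> a y. \<alpha> a y) ** (\<chi> x a. \<beta> x a) = mat 1"
    by (rule matrix_left_right_inverse1)
  then show ?thesis
    by (auto simp: matrix_matrix_mult_def mat_def vec_eq_iff)
qed

text \<open>Substituting \<open>A = u v\<close> into the shift identity turns it into a product of
  two square matrices over the field. The families \<open>w\<close> and \<open>w'\<close> are duals
  of the slices of \<open>u\<close> and \<open>v\<close> obtained by fixing the first index.\<close>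

lemma rank_one_first_factor_nondegenerate:
  fixes A :: "('n::finite, 'k::field) tm"
  assumes A: "A \<in> carrier (tmat base (Suc l))"
    and uv: "\<And>I J. I \<in> idx (Suc l) \<Longrightarrow> J \<in> idx (Suc l) \<Longrightarrow> A (I, J) = u I * v J"
    and nz: "I\<^sub>0 \<in> idx (Suc l)" "u I\<^sub>0 \<noteq> 0" "J\<^sub>0 \<in> idx (Suc l)" "v J\<^sub>0 \<noteq> 0"
    and shift: "leg base (Suc l) (l + 2) 1 A \<otimes>\<^bsub>tmat base (l + 2)\<^esub> leg base (Suc l) (l + 2) 2 A
        \<otimes>\<^bsub>tmat base (l + 2)\<^esub> leg base (Suc l) (l + 2) 1 A
      = scal base (l + 2) \<kappa> \<otimes>\<^bsub>tmat base (l + 2)\<^esub> leg base (Suc l) (l + 2) 1 A"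
    and \<kappa>: "\<kappa> \<noteq> 0"
  obtains w w' where
    "\<And>a d. a \<in> idx 1 \<Longrightarrow> d \<in> idx 1 \<Longrightarrow> (\<Sum>K\<in>idx l. u (a @ K) * w K d) = (if a = d then 1 else 0)"
    "\<And>b d. b \<in> idx 1 \<Longrightarrow> d \<in> idx 1 \<Longrightarrow> (\<Sum>H\<in>idx l. w' d H * v (b @ H)) = (if d = b then 1 else 0)"
proof -
  interpret K: ring "base :: 'k ring" by (rule ring_ring_of_type_algebra)
  let ?N = "l + 2" and ?m = "Suc l"
  let ?T = "tmat base ?N :: ('n, 'k) tm ring"
  interpret T: ring ?T by (rule K.tmat_ring)
  define A1 A2 where "A1 = leg base ?m ?N 1 A" and "A2 = leg base ?m ?N 2 A"
  have N: "?N = 0 + ?m + 1" "?N = 1 + ?m + 0" by auto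
  have A1: "A1 \<in> carrier ?T" and A2: "A2 \<in> carrier ?T"
    using K.leg_closed[OF N(1) A] K.leg_closed[OF N(2) A]
    by (simp_all add: A1_def A2_def numeral_2_eq_2)
  have idx: "H @ [x] \<in> idx ?N" if "H \<in> idx ?m" for H and x :: 'n
    using that by (simp add: idx_def)
  have A1e: "A1 (I @ [x], J @ [y]) = (if x = y then A (I, J) else 0)"
    if "I \<in> idx ?m" "J \<in> idx ?m" for I J x y
    using K.leg_append[OF N(1), of "[]" I "[x]" "[]" J "[y]" A] that
    by (simp add: A1_def idx_def)
  have A2e: "A2 (a # I, b # J) = (if a = b then A (I, J) else 0)"
    if "I \<in> idx ?m" "J \<in> idx ?m" for a b I J
    using K.leg_append[OF N(2), of "[a]" I "[]" "[b]" J "[]" A] that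
    by (simp add: A2_def idx_def numeral_2_eq_2)
  \<comment> \<open>The middle operator carries \<open>u (H @ [x])\<close> and
    \<open>v (K @ [y])\<close>, the outer ones contribute \<open>v (a # H)\<close> and
    \<open>u (a # K)\<close>. Summing over \<open>H\<close> and over \<open>K\<close> separately
    leaves these two matrices, linked by the common index \<open>a\<close>; dividing by
    \<open>\<kappa>\<close> normalises their product.\<close>
  define \<alpha> \<beta> where "\<alpha> = (\<lambda>a y. \<Sum>K\<in>idx l. u (a # K) * v (K @ [y]))"
    and "\<beta> = (\<lambda>x a. (\<Sum>H\<in>idx l. v (a # H) * u (H @ [x])) / \<kappa>)"
  have entry: "(A1 \<otimes>\<^bsub>?T\<^esub> A2 \<otimes>\<^bsub>?T\<^esub> A1) (I @ [x], J @ [y])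
      = (\<Sum>H\<in>idx ?m. A (I, H) * (\<Sum>K\<in>idx ?m. A2 (H @ [x], K @ [y]) * A (K, J)))"
    if IJ: "I \<in> idx ?m" "J \<in> idx ?m" for I J x y
  proof -
    have "(A1 \<otimes>\<^bsub>?T\<^esub> A2 \<otimes>\<^bsub>?T\<^esub> A1) (I @ [x], J @ [y]) = (A1 \<otimes>\<^bsub>?T\<^esub> (A2 \<otimes>\<^bsub>?T\<^esub> A1)) (I @ [x], J @ [y])"
      by (simp only: T.m_assoc[OF A1 A2 A1])
    also have "\<dots> = (\<Sum>H\<in>idx ?N. A1 (I @ [x], H) * (A2 \<otimes>\<^bsub>?T\<^esub> A1) (H, J @ [y]))"
      using IJ idx by (simp add: tmat_mult_entry)
    also have "\<dots> = (\<Sum>H\<in>idx ?m. A (I, H) * (A2 \<otimes>\<^bsub>?T\<^esub> A1) (H @ [x], J @ [y]))"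
      using K.leg_mult_left[OF N(1), of "[]" I "[x]" "\<lambda>H. (A2 \<otimes>\<^bsub>?T\<^esub> A1) (H, J @ [y])" A] IJ A
      by (simp add: A1_def idx_def)
    also have "\<dots> = (\<Sum>H\<in>idx ?m. A (I, H) * (\<Sum>K\<in>idx ?m. A2 (H @ [x], K @ [y]) * A (K, J)))"
    proof (intro sum.cong refl arg_cong2[where f = "(*)"])
      fix H :: "'n list" assume H: "H \<in> idx ?m"
      have "(A2 \<otimes>\<^bsub>?T\<^esub> A1) (H @ [x], J @ [y]) = (\<Sum>K\<in>idx ?N. A2 (H @ [x], K) * A1 (K, J @ [y]))"
        using IJ H idx by (simp add: tmat_mult_entry)
      then show "(A2 \<otimes>\<^bsub>?T\<^esub> A1) (H @ [x], J @ [y]) = (\<Sum>K\<in>idx ?m. A2 (H @ [x], K @ [y]) * A (K, J))"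
        using K.leg_mult_right[OF N(1), of "[]" J "[y]" "\<lambda>K. A2 (H @ [x], K)" A] IJ A
        by (simp add: A1_def idx_def)
    qed
    finally show ?thesis .
  qed
  have "(\<Sum>a\<in>UNIV. \<beta> x a * \<alpha> a y) = (if x = y then 1 else 0)" for x y
  proof -
    \<comment> \<open>At \<open>I\<^sub>0\<close> and \<open>J\<^sub>0\<close> the common factor
      \<open>u I\<^sub>0 * v J\<^sub>0\<close> is nonzero and can be cancelled.\<close>
    have "(A1 \<otimes>\<^bsub>?T\<^esub> A2 \<otimes>\<^bsub>?T\<^esub> A1) (I\<^sub>0 @ [x], J\<^sub>0 @ [y])
        = (scal base ?N \<kappa> \<otimes>\<^bsub>?T\<^esub> A1) (I\<^sub>0 @ [x], J\<^sub>0 @ [y])"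
      using shift by (simp add: A1_def A2_def)
    also have "\<dots> = \<kappa> * (if x = y then u I\<^sub>0 * v J\<^sub>0 else 0)"
      using K.scal_mult_entry(1)[of \<kappa> A1 ?N] A1 idx nz by (simp add: A1e uv)
    also have "(A1 \<otimes>\<^bsub>?T\<^esub> A2 \<otimes>\<^bsub>?T\<^esub> A1) (I\<^sub>0 @ [x], J\<^sub>0 @ [y])
        = u I\<^sub>0 * v J\<^sub>0 * (\<Sum>H\<in>idx ?m. \<Sum>K\<in>idx ?m. v H * u K * A2 (H @ [x], K @ [y]))"
      unfolding entry[OF nz(1,3)] sum_distrib_left
      using nz by (intro sum.cong refl) (simp add: uv)
    also have "(\<Sum>H\<in>idx ?m. \<Sum>K\<in>idx ?m. v H * u K * A2 (H @ [x], K @ [y]))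
        = (\<Sum>a\<in>UNIV. \<Sum>H\<in>idx l. \<Sum>b\<in>UNIV. \<Sum>K\<in>idx l.
            if a = b then v (a # H) * u (a # K) * (u (H @ [x]) * v (K @ [y])) else 0)"
      unfolding sum_idx_Suc
      by (intro sum.cong refl) (auto simp: A2e uv idx_def)
    also have "\<dots> = (\<Sum>a\<in>UNIV. \<Sum>H\<in>idx l. \<Sum>K\<in>idx l. v (a # H) * u (a # K) * (u (H @ [x]) * v (K @ [y])))"
    proof (intro sum.cong refl)
      fix a :: 'n and H :: "'n list"
      show "(\<Sum>b\<in>UNIV. \<Sum>K\<in>idx l. if a = b then v (a # H) * u (a # K) * (u (H @ [x]) * v (K @ [y])) else 0)
          = (\<Sum>K\<in>idx l. v (a # H) * u (a # K) * (u (H @ [x]) * v (K @ [y])))"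
        by (subst sum.swap) (simp add: sum.delta)
    qed
    also have "\<dots> = \<kappa> * (\<Sum>a\<in>UNIV. \<beta> x a * \<alpha> a y)"
      unfolding sum_distrib_left
    proof (intro sum.cong refl)
      fix a :: 'n
      have "\<kappa> * (\<beta> x a * \<alpha> a y) = (\<Sum>H\<in>idx l. v (a # H) * u (H @ [x])) * (\<Sum>K\<in>idx l. u (a # K) * v (K @ [y]))"
        using \<kappa> by (simp add: \<alpha>_def \<beta>_def)
      then show "(\<Sum>H\<in>idx l. \<Sum>K\<in>idx l. v (a # H) * u (a # K) * (u (H @ [x]) * v (K @ [y]))) = \<kappa> * (\<beta> x a * \<alpha> a y)"
        unfolding sum_product by (simp add: mult_ac)
    qed
    finally have "u I\<^sub>0 * v J\<^sub>0 * (\<kappa> * (\<Sum>a\<in>UNIV. \<beta> x a * \<alpha> a y)) = \<kappa> * (if x = y then u I\<^sub>0 * v J\<^sub>0 else 0)" .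
    then show ?thesis
      using nz \<kappa> by (auto split: if_splits)
  qed
  then have inv: "(\<Sum>y\<in>UNIV. \<alpha> a y * \<beta> y d) = (if a = d then 1 else 0)" for a d
    by (rule square_matrix_right_inverse)
  \<comment> \<open>Regrouping \<open>\<alpha> \<beta> = 1\<close> so that the slice
    \<open>u (a # K)\<close> stands alone exhibits its dual as the coefficient of that slice. The
    next fact does the same for \<open>v\<close>.\<close>
  have 1: "(\<Sum>K\<in>idx l. u (a # K) * (\<Sum>y\<in>UNIV. v (K @ [y]) * \<beta> y d)) = (if a = d then 1 else 0)" for a d
  proof -
    have "(\<Sum>K\<in>idx l. u (a # K) * (\<Sum>y\<in>UNIV. v (K @ [y]) * \<beta> y d)) = (\<Sum>y\<in>UNIV. \<alpha> a y * \<beta> y d)"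
      unfolding \<alpha>_def sum_distrib_left sum_distrib_right by (subst sum.swap) (simp add: mult_ac)
    then show ?thesis by (simp add: inv)
  qed
  have 2: "(\<Sum>H\<in>idx l. (\<Sum>y\<in>UNIV. \<alpha> d y * u (H @ [y]) / \<kappa>) * v (b # H)) = (if d = b then 1 else 0)" for b d
  proof -
    have "(\<Sum>H\<in>idx l. (\<Sum>y\<in>UNIV. \<alpha> d y * u (H @ [y]) / \<kappa>) * v (b # H)) = (\<Sum>y\<in>UNIV. \<alpha> d y * \<beta> y b)"
      unfolding \<beta>_def sum_distrib_left sum_distrib_right sum_divide_distrib
      by (subst sum.swap) (simp add: mult_ac)
    then show ?thesis by (simp add: inv)
  qed
  show thesis
  proof (rule that)
    fix a d :: "'n list" assume "a \<in> idx 1" "d \<in> idx 1"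
    then obtain a' d' where ad: "a = [a']" "d = [d']"
      by (auto simp: idx_def length_Suc_conv)
    show "(\<Sum>K\<in>idx l. u (a @ K) * (\<Sum>y\<in>UNIV. v (K @ [y]) * \<beta> y (hd d))) = (if a = d then 1 else 0)"
      using 1[of a' d'] by (simp add: ad)
    show "(\<Sum>H\<in>idx l. (\<Sum>y\<in>UNIV. \<alpha> (hd d) y * u (H @ [y]) / \<kappa>) * v (a @ H)) = (if d = a then 1 else 0)"
      using 2[of d' a'] by (simp add: ad)
  qed
qed

section \<open>Antisymmetrizers of an R-matrix\<close>

context central_scalars
begin

lemma smul_minus: "x \<in> carrier S \<Longrightarrow> \<ominus> (c \<cdot> x) = (- c) \<cdot> x"
  by (rule minus_equality) (simp_all flip: smul_add_left)

lemma \<iota>_smul: "\<iota> c = c \<cdot> \<one>"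
  by (simp add: smul_def)

lemma commute_shift:
  assumes "x \<in> carrier S" "b \<in> carrier S" "x \<otimes> b = b \<otimes> x"
  shows "x \<otimes> (b \<oplus> \<iota> d) = (b \<oplus> \<iota> d) \<otimes> x"
  using assms \<iota>_central[OF assms(1)] by (simp add: l_distr r_distr)

text \<open>The identity \<open>(k+1)_q = q^k + k_q / q\<close> rewrites
  \<open>q^k - k_q R_k\<close> as \<open>(k+1)_q - k_q (R_k + 1/q)\<close>, the form used in
  \<open>antisym\<close>.\<close>

lemma antisym_generator:
  assumes "g \<in> carrier S" "q \<noteq> 0"
  shows "\<iota> (q ^ Suc l) \<ominus> \<iota> (qnum q (Suc l)) \<otimes> g
    = qnum q (l + 2) \<cdot> \<one> \<oplus> (- qnum q (l + 1)) \<cdot> (g \<oplus> \<iota> (1 / q))"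
proof -
  have "\<iota> (q ^ Suc l) \<ominus> \<iota> (qnum q (Suc l)) \<otimes> g = (q ^ Suc l) \<cdot> \<one> \<oplus> (- qnum q (Suc l)) \<cdot> g"
    unfolding a_minus_def smul_def[symmetric, of "qnum q (Suc l)"]
    using assms by (simp only: smul_minus \<iota>_smul[of "q ^ Suc l"])
  also have "(q ^ Suc l) \<cdot> \<one> = qnum q (l + 2) \<cdot> \<one> \<oplus> (- qnum q (Suc l) / q) \<cdot> \<one>"
    using qnum_Suc[OF assms(2), of "Suc l"] by (simp flip: smul_add_left)
  finally show ?thesis
    unfolding \<iota>_smul[of "1 / q"] using assms(1) by (simp add: smul_add_right a_ac)
qed

text \<open>With \<open>p = g + 1/q\<close> the first factor of the Hecke condition is
  \<open>p - (q + 1/q)\<close>.\<close>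

lemma hecke_square:
  assumes "g \<in> carrier S" "(g \<ominus> \<iota> q) \<otimes> (g \<oplus> \<iota> (1 / q)) = \<zero>"
  shows "(g \<oplus> \<iota> (1 / q)) \<otimes> (g \<oplus> \<iota> (1 / q)) = (q + 1 / q) \<cdot> (g \<oplus> \<iota> (1 / q))"
proof -
  define p where "p = g \<oplus> \<iota> (1 / q)"
  have p: "p \<in> carrier S" using assms(1) by (simp add: p_def)
  have "\<ominus> \<iota> q = (1 / q) \<cdot> \<one> \<oplus> (- (q + 1 / q)) \<cdot> \<one>"
    unfolding \<iota>_smul[of q] smul_minus[OF one_closed] by (simp flip: smul_add_left)
  then have "g \<ominus> \<iota> q = p \<oplus> (- (q + 1 / q)) \<cdot> \<one>"
    unfolding a_minus_def p_def \<iota>_smul[of "1 / q"] using assms(1) by (simp add: a_assoc)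
  with assms(2) have "p \<otimes> p \<oplus> (- (q + 1 / q)) \<cdot> p = \<zero>"
    using p by (simp add: l_distr flip: p_def)
  then have "p \<otimes> p = \<ominus> ((- (q + 1 / q)) \<cdot> p)"
    using p by (simp add: minus_equality[symmetric] a_comm)
  then show ?thesis
    unfolding smul_minus[OF p] by (simp add: p_def ab_semigroup_add_class.add.commute)
qed

text \<open>With \<open>c = 1/q\<close>, \<open>x = a + c\<close> and \<open>y = b + c\<close>,
  expand \<open>a b a\<close>. The quadratic relation gives \<open>x\<close> the coefficient
  \<open>- c (q + c) + 2 c^2 = c^2 - 1\<close>, so apart from \<open>x y x - x\<close> the expansion
  is symmetric in \<open>x\<close> and \<open>y\<close>. Cancelling the symmetric part leaves the
  relation for \<open>x\<close> and \<open>y\<close>.\<close>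

lemma hecke_braid:
  assumes a: "a \<in> carrier S" and b: "b \<in> carrier S" and q: "q \<noteq> 0"
    and aa: "(a \<oplus> \<iota> (1 / q)) \<otimes> (a \<oplus> \<iota> (1 / q)) = (q + 1 / q) \<cdot> (a \<oplus> \<iota> (1 / q))"
    and bb: "(b \<oplus> \<iota> (1 / q)) \<otimes> (b \<oplus> \<iota> (1 / q)) = (q + 1 / q) \<cdot> (b \<oplus> \<iota> (1 / q))"
    and braid: "a \<otimes> b \<otimes> a = b \<otimes> a \<otimes> b"
  shows "(a \<oplus> \<iota> (1 / q)) \<otimes> (b \<oplus> \<iota> (1 / q)) \<otimes> (a \<oplus> \<iota> (1 / q)) \<oplus> (b \<oplus> \<iota> (1 / q))
    = (b \<oplus> \<iota> (1 / q)) \<otimes> (a \<oplus> \<iota> (1 / q)) \<otimes> (b \<oplus> \<iota> (1 / q)) \<oplus> (a \<oplus> \<iota> (1 / q))"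
proof -
  define c where "c = 1 / q"
  have cq: "c * q = 1" using q by (simp add: c_def)
  have expand: "(x \<oplus> (- c) \<cdot> \<one>) \<otimes> (y \<oplus> (- c) \<cdot> \<one>) \<otimes> (x \<oplus> (- c) \<cdot> \<one>)
      = x \<otimes> y \<otimes> x \<oplus> (- 1) \<cdot> x
        \<oplus> ((- c) \<cdot> (x \<otimes> y) \<oplus> (- c) \<cdot> (y \<otimes> x) \<oplus> ((c * c) \<cdot> x \<oplus> (c * c) \<cdot> y) \<oplus> (- (c * c * c)) \<cdot> \<one>)"
    if x: "x \<in> carrier S" and y: "y \<in> carrier S" and xx: "x \<otimes> x = (q + c) \<cdot> x" for x y
  proof -
    have "(x \<oplus> (- c) \<cdot> \<one>) \<otimes> (y \<oplus> (- c) \<cdot> \<one>) \<otimes> (x \<oplus> (- c) \<cdot> \<one>)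
      = x \<otimes> y \<otimes> x \<oplus> ((- c) \<cdot> (x \<otimes> x) \<oplus> (c * c) \<cdot> x \<oplus> (c * c) \<cdot> x)
        \<oplus> ((- c) \<cdot> (x \<otimes> y) \<oplus> (- c) \<cdot> (y \<otimes> x) \<oplus> (c * c) \<cdot> y \<oplus> (- (c * c * c)) \<cdot> \<one>)"
      using x y by (simp add: l_distr r_distr smul_add_right a_ac m_assoc semigroup_mult_class.mult.assoc)
    also have "(- c) \<cdot> (x \<otimes> x) \<oplus> (c * c) \<cdot> x \<oplus> (c * c) \<cdot> x = (- c * (q + c) + c * c + c * c) \<cdot> x"
      unfolding xx smul_smul[OF x] smul_add_left[OF x, of "- c * (q + c) + c * c"]
        smul_add_left[OF x, of "- c * (q + c)"] ..
    also have "- c * (q + c) + c * c + c * c = - 1 + c * c"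
      using cq by (simp add: algebra_simps)
    also have "(- 1 + c * c) \<cdot> x = (- 1) \<cdot> x \<oplus> (c * c) \<cdot> x"
      by (rule smul_add_left[OF x])
    finally show ?thesis
      using x y by (simp add: a_ac)
  qed
  define x y where "x = a \<oplus> \<iota> c" and "y = b \<oplus> \<iota> c"
  have x: "x \<in> carrier S" and y: "y \<in> carrier S"
    using a b by (simp_all add: x_def y_def)
  have zero: "\<iota> c \<oplus> (- c) \<cdot> \<one> = \<zero>"
    using smul_add_left[OF one_closed, of c "- c"] by (simp add: \<iota>_smul[of c])
  have ab: "a = x \<oplus> (- c) \<cdot> \<one>" "b = y \<oplus> (- c) \<cdot> \<one>"
    using a b zero by (simp_all add: x_def y_def a_assoc)
  have xx: "x \<otimes> x = (q + c) \<cdot> x" and yy: "y \<otimes> y = (q + c) \<cdot> y"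
    using aa bb by (simp_all only: x_def y_def c_def)
  let ?z = "(- c) \<cdot> (x \<otimes> y) \<oplus> (- c) \<cdot> (y \<otimes> x) \<oplus> ((c * c) \<cdot> x \<oplus> (c * c) \<cdot> y) \<oplus> (- (c * c * c)) \<cdot> \<one>"
  have "x \<otimes> y \<otimes> x \<oplus> (- 1) \<cdot> x \<oplus> ?z = a \<otimes> b \<otimes> a"
    unfolding ab expand[OF x y xx] ..
  also have "\<dots> = y \<otimes> x \<otimes> y \<oplus> (- 1) \<cdot> y \<oplus> ((- c) \<cdot> (y \<otimes> x) \<oplus> (- c) \<cdot> (x \<otimes> y) \<oplus> ((c * c) \<cdot> y \<oplus> (c * c) \<cdot> x) \<oplus> (- (c * c * c)) \<cdot> \<one>)"
    unfolding braid unfolding ab expand[OF y x yy] ..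
  also have "\<dots> = y \<otimes> x \<otimes> y \<oplus> (- 1) \<cdot> y \<oplus> ?z"
    using x y by (simp add: a_ac)
  finally have "x \<otimes> y \<otimes> x \<oplus> (- 1) \<cdot> x = y \<otimes> x \<otimes> y \<oplus> (- 1) \<cdot> y"
    using x y by (simp only: add.right_cancel a_closed m_closed smul_closed one_closed)
  then have cancelled: "x \<otimes> y \<otimes> x \<oplus> (- 1) \<cdot> x \<oplus> (x \<oplus> y) = y \<otimes> x \<otimes> y \<oplus> (- 1) \<cdot> y \<oplus> (y \<oplus> x)"
    by (simp only: a_comm[OF y x])
  have cancel: "u \<oplus> (- 1) \<cdot> v \<oplus> (v \<oplus> w) = u \<oplus> w"
    if "u \<in> carrier S" "v \<in> carrier S" "w \<in> carrier S" for u v w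
  proof -
    have v: "(- 1) \<cdot> v \<oplus> v = \<zero>"
      using smul_add_left[of v "- 1" 1] that by simp
    have "u \<oplus> (- 1) \<cdot> v \<oplus> (v \<oplus> w) = u \<oplus> ((- 1) \<cdot> v \<oplus> v) \<oplus> w"
      using that by (simp only: a_assoc a_closed smul_closed)
    then show ?thesis
      unfolding v using that by simp
  qed
  have "x \<otimes> y \<otimes> x \<oplus> y = y \<otimes> x \<otimes> y \<oplus> x"
    using cancelled x y by (simp only: cancel m_closed)
  then show ?thesis
    by (simp only: x_def y_def c_def)
qed

end

lemma central_scalars_tmat:
  "central_scalars (tmat base N :: ('n::finite, 'k::field) tm ring) (scal base N)"
proof -
  interpret K: ring "base :: 'k ring" by (rule ring_ring_of_type_algebra)
  interpret T: ring "tmat base N :: ('n, 'k) tm ring" by (rule K.tmat_ring)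
  show ?thesis
    by unfold_locales (auto intro!: K.scal_hom K.scal_central[symmetric])
qed

definition hecke_gen :: "('n::finite, 'k::field) tm \<Rightarrow> 'k \<Rightarrow> nat \<Rightarrow> nat \<Rightarrow> ('n, 'k) tm" where
  "hecke_gen R q N i = leg base 2 N i R \<oplus>\<^bsub>tmat base N\<^esub> scal base N (1 / q)"

lemma (in ring) leg_full:
  assumes "Y \<in> carrier (tmat R k :: ('n::finite, 'a) tm ring)"
  shows "leg R k k (Suc 0) Y = Y"
proof (rule tmat_eqI[OF _ assms])
  show "leg R k k (Suc 0) Y \<in> carrier (tmat R k)"
    by (rule leg_closed[of k 0 k 0]) (use assms in auto)
  fix I J :: "'n list" assume "I \<in> idx k" "J \<in> idx k"
  then show "leg R k k (Suc 0) Y (I, J) = Y (I, J)"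
    using leg_append[of k 0 k 0 "[]" I "[]" "[]" J "[]" Y] by (simp add: idx_def)
qed

text \<open>The recursion for \<open>asym\<close> computes in one tensor power and embeds the result
  into the next. Embeddings are homomorphisms and compose, so every embedded antisymmetrizer is the
  abstract word in the generators shifted by the number \<open>p\<close> of skipped factors.
  Quantifying over \<open>N\<close> and \<open>p\<close> is what carries the induction: the inner
  antisymmetrizer has to be known in the larger tensor power.\<close>

lemma leg_asym:
  fixes R :: "('n::finite, 'k::field) tm"
  assumes R: "R \<in> carrier (tmat base 2)" and q: "q \<noteq> 0"
  shows "asym q R (Suc l) \<in> carrier (tmat base (Suc l)) \<and> (\<forall>N p. p + Suc l \<le> N \<longrightarrow>
    leg base (Suc l) N (Suc p) (asym q R (Suc l))
      = central_scalars.antisym (tmat base N) (scal base N) q (\<lambda>i. hecke_gen R q N (p + i)) l)"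
proof (induction l)
  case 0
  interpret K: ring "base :: 'k ring" by (rule ring_ring_of_type_algebra)
  interpret T: ring "tmat base (Suc 0) :: ('n, 'k) tm ring" by (rule K.tmat_ring)
  have "leg base (Suc 0) N (Suc p) (\<one>\<^bsub>tmat base (Suc 0)\<^esub> :: ('n, 'k) tm) = \<one>\<^bsub>tmat base N\<^esub>"
    if "Suc p \<le> N" for N p
    by (rule ring_hom_one[OF K.leg_hom[of N p "Suc 0" "N - Suc p"]]) (use that in auto)
  then show ?case
    by (simp add: central_scalars.antisym.simps[OF central_scalars_tmat])
next
  case (Suc l)
  interpret K: ring "base :: 'k ring" by (rule ring_ring_of_type_algebra)
  let ?k = "Suc l"
  let ?T = "tmat base (Suc ?k) :: ('n, 'k) tm ring"
  interpret T: ring ?T by (rule K.tmat_ring)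
  define a where "a = asym q R ?k"
  define A where "A = leg base ?k (Suc ?k) (Suc 0) a"
  define g where "g = leg base 2 (Suc ?k) (Suc l) R"
  define Z where "Z = scal base (Suc ?k) (q ^ ?k) \<ominus>\<^bsub>?T\<^esub> scal base (Suc ?k) (qnum q ?k) \<otimes>\<^bsub>?T\<^esub> g"
  have asym: "asym q R (Suc ?k) = scal base (Suc ?k) (1 / qnum q (Suc ?k)) \<otimes>\<^bsub>?T\<^esub> (A \<otimes>\<^bsub>?T\<^esub> Z \<otimes>\<^bsub>?T\<^esub> A)"
    by (simp add: Let_def A_def Z_def a_def g_def)
  have a: "a \<in> carrier (tmat base ?k)" using Suc by (simp add: a_def)
  have A: "A \<in> carrier ?T"
    unfolding A_def by (rule K.leg_closed[of _ 0 _ 1]) (use a in auto)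
  have g: "g \<in> carrier ?T"
    unfolding g_def by (rule K.leg_closed[of _ l _ 0]) (use R in auto)
  have s: "scal base (Suc ?k) c \<in> carrier ?T" for c by (simp add: K.scal_closed)
  have Z: "Z \<in> carrier ?T" using g s by (simp add: Z_def)
  show ?case
  proof (intro conjI allI impI)
    show "asym q R (Suc ?k) \<in> carrier ?T"
      unfolding asym using A Z s by (intro T.m_closed)
    fix N p assume N: "p + Suc ?k \<le> N"
    define r where "r = N - (p + Suc ?k)"
    have Nr: "N = p + Suc ?k + r" using N by (simp add: r_def)
    let ?\<phi> = "leg base (Suc ?k) N (Suc p) :: ('n, 'k) tm \<Rightarrow> _"
    interpret S: central_scalars "tmat base N :: ('n, 'k) tm ring" "scal base N"
      by (rule central_scalars_tmat)
    interpret \<phi>: ring_hom_ring ?T "tmat base N :: ('n, 'k) tm ring" ?\<phi>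
      by (rule ring_hom_ringI2[OF T.ring_axioms S.ring_axioms K.leg_hom[OF Nr]])
    have \<phi>s: "?\<phi> (scal base (Suc ?k) c) = scal base N c" for c
      using K.leg_scal[OF Nr, of c] by simp
    have \<phi>A: "?\<phi> A = S.antisym q (\<lambda>i. hecke_gen R q N (p + i)) l"
    proof -
      have "?\<phi> A = leg base ?k N (Suc p) a"
        unfolding A_def using K.leg_leg[OF Nr, of 0 ?k 1 a] a by simp
      with Suc N show ?thesis by (simp add: a_def)
    qed
    have \<phi>g: "?\<phi> g = leg base 2 N (Suc (p + l)) R"
      unfolding g_def using K.leg_leg[OF Nr, of l 2 0 R] R by simp
    have g': "leg base 2 N (Suc (p + l)) R \<in> carrier (tmat base N)"
      using \<phi>.hom_closed[OF g] by (simp add: \<phi>g)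
    have \<phi>Z: "?\<phi> Z = scal base N (q ^ ?k) \<ominus>\<^bsub>tmat base N\<^esub> scal base N (qnum q ?k) \<otimes>\<^bsub>tmat base N\<^esub> leg base 2 N (Suc (p + l)) R"
      unfolding Z_def a_minus_def using g s by (simp add: \<phi>s \<phi>g)
    show "?\<phi> (asym q R (Suc ?k)) = S.antisym q (\<lambda>i. hecke_gen R q N (p + i)) ?k"
      unfolding asym using A Z s
      by (simp add: \<phi>s \<phi>A \<phi>Z S.antisym_generator[OF g' q, of l] del: power_Suc)
        (simp add: S.smul_def hecke_gen_def)
  qed
qed

lemma leg_braid:
  fixes R :: "('n::finite, 'k::field) tm"
  assumes "R_matrix R" and i: "1 \<le> i" "i + 2 \<le> N"
  shows "leg base 2 N i R \<otimes>\<^bsub>tmat base N\<^esub> leg base 2 N (Suc i) R \<otimes>\<^bsub>tmat base N\<^esub> leg base 2 N i R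
    = leg base 2 N (Suc i) R \<otimes>\<^bsub>tmat base N\<^esub> leg base 2 N i R \<otimes>\<^bsub>tmat base N\<^esub> leg base 2 N (Suc i) R"
proof -
  interpret K: ring "base :: 'k ring" by (rule ring_ring_of_type_algebra)
  let ?T2 = "tmat base 2 :: ('n, 'k) tm ring" and ?T3 = "tmat base 3 :: ('n, 'k) tm ring"
  have units: "R \<in> Units ?T2" and yb: "leg base 2 3 1 R \<otimes>\<^bsub>?T3\<^esub> leg base 2 3 2 R \<otimes>\<^bsub>?T3\<^esub> leg base 2 3 1 R
      = leg base 2 3 2 R \<otimes>\<^bsub>?T3\<^esub> leg base 2 3 1 R \<otimes>\<^bsub>?T3\<^esub> leg base 2 3 2 R"
    using assms(1) by (simp_all only: R_matrix_def Let_def)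
  have R: "R \<in> carrier ?T2"
    using units by (rule monoid.Units_closed[OF ring.is_monoid[OF K.tmat_ring]])
  define p where "p = i - 1"
  have N: "N = p + 3 + (N - i - 2)" "i = Suc p" using i by (auto simp: p_def)
  interpret \<phi>: ring_hom_ring ?T3 "tmat base N :: ('n, 'k) tm ring" "leg base 3 N i"
    unfolding N(2) by (rule ring_hom_ringI2[OF K.tmat_ring K.tmat_ring K.leg_hom[OF N(1)]])
  define R\<^sub>1 R\<^sub>2 where "R\<^sub>1 = leg base 2 3 1 R" and "R\<^sub>2 = leg base 2 3 2 R"
  have R12: "R\<^sub>1 \<in> carrier ?T3" "R\<^sub>2 \<in> carrier ?T3"
    using K.leg_closed[of 3 0 2 1 R] K.leg_closed[of 3 1 2 0 R] R
    by (simp_all add: R\<^sub>1_def R\<^sub>2_def numeral_2_eq_2)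
  have leg: "leg base 3 N i R\<^sub>1 = leg base 2 N i R" "leg base 3 N i R\<^sub>2 = leg base 2 N (Suc i) R"
    unfolding N(2) R\<^sub>1_def R\<^sub>2_def using K.leg_leg[OF N(1), of 0 2 1 R] K.leg_leg[OF N(1), of 1 2 0 R] R
    by (simp_all add: numeral_2_eq_2)
  from arg_cong[OF yb[folded R\<^sub>1_def R\<^sub>2_def], of "leg base 3 N i"]
  show ?thesis
    using R12 by (simp add: leg)
qed

text \<open>The quadratic relation is transported from two factors by \<open>leg\<close>, and the
  braid relation from three by \<open>leg_braid\<close>. Distant generators act in disjoint factors
  and have entries in a field, so they commute.\<close>

lemma hecke_algebra_tmat:
  fixes R :: "('n::finite, 'k::field_char_0) tm"
  assumes "Hecke_type R q"
  shows "hecke_algebra (tmat base (Suc n)) (scal base (Suc n)) q (hecke_gen R q (Suc n)) n"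
proof -
  interpret K: ring "base :: 'k ring" by (rule ring_ring_of_type_algebra)
  let ?N = "Suc n" and ?T2 = "tmat base 2 :: ('n, 'k) tm ring"
  let ?S = "tmat base ?N :: ('n, 'k) tm ring" and ?p = "hecke_gen R q ?N" and ?R = "\<lambda>i. leg base 2 ?N i R"
  interpret S: central_scalars ?S "scal base ?N"
    by (rule central_scalars_tmat)
  interpret T2: ring ?T2 by (rule K.tmat_ring)
  note H = assms[unfolded Hecke_type_def]
  have gen: "generic q" and units: "R \<in> Units ?T2"
    using H[THEN conjunct1] H[THEN conjunct2, THEN conjunct1] by (simp_all only: R_matrix_def)
  have q: "q \<noteq> 0" using gen by (simp add: generic_def)
  have qn: "qnum q k \<noteq> 0" if "k > 0" for k using qnum_nonzero[OF gen that] .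
  have R: "R \<in> carrier ?T2" using units by (rule T2.Units_closed)
  have hecke: "(R \<ominus>\<^bsub>?T2\<^esub> scal base 2 q) \<otimes>\<^bsub>?T2\<^esub> (R \<oplus>\<^bsub>?T2\<^esub> scal base 2 (1 / q)) = \<zero>\<^bsub>?T2\<^esub>"
    using H[THEN conjunct2, THEN conjunct2] by (simp only: inverse_eq_divide)
  have gcl: "?R i \<in> carrier ?S" if "i \<in> {1..n}" for i
    using K.leg_closed[of ?N "i - 1" 2 "n - i" R] R that by simp
  have sq: "?p i \<otimes>\<^bsub>?S\<^esub> ?p i = S.smul (q + 1 / q) (?p i)"
    if i: "i \<in> {1..n}" for i
    unfolding hecke_gen_def
  proof (rule S.hecke_square[OF gcl[OF i]])
    define p where "p = i - 1"
    have N: "?N = p + 2 + (n - i)" "i = Suc p" using i by (auto simp: p_def)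
    interpret \<phi>: ring_hom_ring ?T2 ?S "leg base 2 ?N i"
      unfolding N(2) by (rule ring_hom_ringI2[OF T2.ring_axioms S.ring_axioms K.leg_hom[OF N(1)]])
    have s: "leg base 2 ?N i (scal base 2 c) = (scal base ?N c :: ('n, 'k) tm)" for c
      unfolding N(2) by (rule K.leg_scal[OF N(1)])
    have sc: "scal base 2 c \<in> carrier ?T2" for c by (simp add: K.scal_closed)
    show "(?R i \<ominus>\<^bsub>?S\<^esub> scal base ?N q) \<otimes>\<^bsub>?S\<^esub> (?R i \<oplus>\<^bsub>?S\<^esub> scal base ?N (1 / q)) = \<zero>\<^bsub>?S\<^esub>"
      using arg_cong[OF hecke, of "leg base 2 ?N i"] R sc
      by (simp add: s a_minus_def)
  qed
  show ?thesis
  proof unfold_locales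
    fix i assume i: "i \<in> {1..n}"
    show "?p i \<in> carrier ?S"
      unfolding hecke_gen_def using gcl[OF i] by simp
    show "?p i \<otimes>\<^bsub>?S\<^esub> ?p i = S.smul (q + 1 / q) (?p i)"
      by (rule sq[OF i])
  next
    fix i assume i: "1 \<le> i" "i < n"
    have braid: "?R i \<otimes>\<^bsub>?S\<^esub> ?R (Suc i) \<otimes>\<^bsub>?S\<^esub> ?R i
        = ?R (Suc i) \<otimes>\<^bsub>?S\<^esub> ?R i \<otimes>\<^bsub>?S\<^esub> ?R (Suc i)"
      using H[THEN conjunct1] i by (intro leg_braid) auto
    have ii: "i \<in> {1..n}" "Suc i \<in> {1..n}" using i by auto
    show "?p i \<otimes>\<^bsub>?S\<^esub> ?p (Suc i) \<otimes>\<^bsub>?S\<^esub> ?p i \<oplus>\<^bsub>?S\<^esub> ?p (Suc i)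
      = ?p (Suc i) \<otimes>\<^bsub>?S\<^esub> ?p i \<otimes>\<^bsub>?S\<^esub> ?p (Suc i) \<oplus>\<^bsub>?S\<^esub> ?p i"
      using S.hecke_braid[OF gcl[OF ii(1)] gcl[OF ii(2)] q sq[OF ii(1), unfolded hecke_gen_def]
        sq[OF ii(2), unfolded hecke_gen_def] braid]
      unfolding hecke_gen_def .
  next
    fix i j assume ij: "1 \<le> i" "Suc i < j" "j \<le> n"
    have cl: "?R i \<in> carrier ?S" "?R j \<in> carrier ?S"
      using ij by (auto intro!: gcl)
    have "?R i \<otimes>\<^bsub>?S\<^esub> ?R j = ?R j \<otimes>\<^bsub>?S\<^esub> ?R i"
      using ij R by (intro K.leg_commute) (auto simp: mult.commute)
    then have "?R i \<otimes>\<^bsub>?S\<^esub> ?p j = ?p j \<otimes>\<^bsub>?S\<^esub> ?R i"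
      unfolding hecke_gen_def by (rule S.commute_shift[OF cl])
    moreover have "?p j \<in> carrier ?S"
      unfolding hecke_gen_def using cl(2) by simp
    ultimately show "?p i \<otimes>\<^bsub>?S\<^esub> ?p j = ?p j \<otimes>\<^bsub>?S\<^esub> ?p i"
      using S.commute_shift[OF _ cl(1), of "?p j" "1 / q"]
      by (simp only: hecke_gen_def[of R q ?N i])
  qed (use q qn in auto)
qed

lemma GL_type_factor:
  fixes R :: "('n::finite, 'k::field_char_0) tm"
  assumes GL: "GL_type R q (Suc l)"
  obtains u v w w' I\<^sub>0 J\<^sub>0 where
    "\<And>I J. I \<in> idx (Suc l) \<Longrightarrow> J \<in> idx (Suc l) \<Longrightarrow> asym q R (Suc l) (I, J) = u I * v J"
    "I\<^sub>0 \<in> idx (Suc l)" "u I\<^sub>0 \<noteq> 0" "J\<^sub>0 \<in> idx (Suc l)" "v J\<^sub>0 \<noteq> 0"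
    "\<And>a d. a \<in> idx 1 \<Longrightarrow> d \<in> idx 1 \<Longrightarrow> (\<Sum>K\<in>idx l. u (a @ K) * w K d) = (if a = d then 1 else 0)"
    "\<And>b d. b \<in> idx 1 \<Longrightarrow> d \<in> idx 1 \<Longrightarrow> (\<Sum>H\<in>idx l. w' d H * v (b @ H)) = (if d = b then 1 else 0)"
proof -
  interpret K: ring "base :: 'k ring" by (rule ring_ring_of_type_algebra)
  let ?m = "Suc l" and ?N = "l + 2" and ?A = "asym q R (Suc l)"
  have hecke: "Hecke_type R q" and rank: "tm_rank ?m ?A = 1" and top: "asym q R (Suc ?m) = \<zero>\<^bsub>tmat base (Suc ?m)\<^esub>"
    using GL unfolding GL_type_def Suc_eq_plus1[symmetric] by blast+
  \<comment> \<open>There is one factor more than \<open>?A\<close> acts in: both embeddings of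
    \<open>?A\<close> and the vanishing next antisymmetrizer live in the same Hecke algebra.\<close>
  interpret S: hecke_algebra "tmat base (Suc ?m)" "scal base (Suc ?m)" q "hecke_gen R q (Suc ?m)" ?m
    by (rule hecke_algebra_tmat[OF hecke])
  have R: "R \<in> carrier (tmat base 2)"
    using hecke unfolding Hecke_type_def R_matrix_def
    by (elim conjE) (rule monoid.Units_closed[OF ring.is_monoid[OF K.tmat_ring]])
  have A: "?A \<in> carrier (tmat base ?m)"
    using leg_asym[OF R S.q_nonzero] by blast
  have "leg base (Suc ?m) (Suc ?m) (Suc 0) (asym q R (Suc ?m)) = S.antisym q (\<lambda>i. hecke_gen R q (Suc ?m) (0 + i)) ?m"
    using leg_asym[OF R S.q_nonzero, of ?m, THEN conjunct2, THEN spec[of _ "Suc ?m"], THEN spec[of _ 0], THEN mp]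
    by simp
  moreover have "leg base (Suc ?m) (Suc ?m) (Suc 0) (asym q R (Suc ?m)) = asym q R (Suc ?m)"
    using leg_asym[OF R S.q_nonzero, of ?m] by (intro K.leg_full) blast
  ultimately have zero: "S.antisym q (hecke_gen R q (Suc ?m)) ?m = \<zero>\<^bsub>tmat base (Suc ?m)\<^esub>"
    using top by simp
  have A1: "leg base ?m (Suc ?m) 1 ?A = S.antisym q (hecke_gen R q (Suc ?m)) l"
    using leg_asym[OF R S.q_nonzero, of l, THEN conjunct2, THEN spec[of _ "Suc ?m"], THEN spec[of _ 0]] by simp
  have A2: "leg base ?m (Suc ?m) 2 ?A = S.antisym q (\<lambda>i. hecke_gen R q (Suc ?m) (Suc i)) l"
    using leg_asym[OF R S.q_nonzero, of l, THEN conjunct2, THEN spec[of _ "Suc ?m"], THEN spec[of _ 1]]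
    by (simp add: numeral_2_eq_2)
  have shift: "leg base ?m ?N 1 ?A \<otimes>\<^bsub>tmat base ?N\<^esub> leg base ?m ?N 2 ?A \<otimes>\<^bsub>tmat base ?N\<^esub> leg base ?m ?N 1 ?A
      = scal base ?N (1 / (qnum q ?m)\<^sup>2) \<otimes>\<^bsub>tmat base ?N\<^esub> leg base ?m ?N 1 ?A"
    using S.antisym_shift[OF refl zero] unfolding A1[symmetric] A2[symmetric] S.smul_def by simp
  have nz: "1 / (qnum q ?m)\<^sup>2 \<noteq> 0"
    using S.qnum_nonzero[of ?m] by simp
  obtain u v I\<^sub>0 J\<^sub>0 where uv: "\<And>I J. I \<in> idx ?m \<Longrightarrow> J \<in> idx ?m \<Longrightarrow> ?A (I, J) = u I * v J"
    and 0: "I\<^sub>0 \<in> idx ?m" "u I\<^sub>0 \<noteq> 0" "J\<^sub>0 \<in> idx ?m" "v J\<^sub>0 \<noteq> 0"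
    using tm_rank_one_factor[OF rank] by blast
  obtain w w' where
    "\<And>a d. a \<in> idx 1 \<Longrightarrow> d \<in> idx 1 \<Longrightarrow> (\<Sum>K\<in>idx l. u (a @ K) * w K d) = (if a = d then 1 else 0)"
    "\<And>b d. b \<in> idx 1 \<Longrightarrow> d \<in> idx 1 \<Longrightarrow> (\<Sum>H\<in>idx l. w' d H * v (b @ H)) = (if d = b then 1 else 0)"
    using rank_one_first_factor_nondegenerate[OF A uv 0 shift nz] by blast
  then show thesis
    using that uv 0 by blast
qed

section \<open>Invertibility of reflection equation matrices\<close>

lemma ring_hom_Units:
  assumes "ring A" "ring A'" "h \<in> ring_hom A A'" "u \<in> Units A"
  shows "h u \<in> Units A'" "h (inv\<^bsub>A\<^esub> u) = inv\<^bsub>A'\<^esub> (h u)"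
proof -
  interpret h: ring_hom_ring A A' h by (rule ring_hom_ringI2[OF assms(1-3)])
  have u: "u \<in> carrier A" "inv\<^bsub>A\<^esub> u \<in> carrier A" "u \<otimes>\<^bsub>A\<^esub> inv\<^bsub>A\<^esub> u = \<one>\<^bsub>A\<^esub>" "inv\<^bsub>A\<^esub> u \<otimes>\<^bsub>A\<^esub> u = \<one>\<^bsub>A\<^esub>"
    using assms(4) by auto
  have h: "h u \<otimes>\<^bsub>A'\<^esub> h (inv\<^bsub>A\<^esub> u) = \<one>\<^bsub>A'\<^esub>" "h (inv\<^bsub>A\<^esub> u) \<otimes>\<^bsub>A'\<^esub> h u = \<one>\<^bsub>A'\<^esub>"
    using u h.hom_mult[of u "inv\<^bsub>A\<^esub> u"] h.hom_mult[of "inv\<^bsub>A\<^esub> u" u] by simp_all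
  then show "h u \<in> Units A'"
    unfolding Units_def using u h.hom_closed by blast
  show "h (inv\<^bsub>A\<^esub> u) = inv\<^bsub>A'\<^esub> (h u)"
    using h u by (intro h.S.inv_char[symmetric]) auto
qed

text \<open>Both sides obey the same recursion with the same scalars. This carries the
  antisymmetrizer from matrices over the field to matrices over the extended ring.\<close>

lemma antisym_hom:
  assumes S: "central_scalars S \<iota>" and S': "central_scalars S' \<iota>'" and f: "f \<in> ring_hom S S'"
    and \<iota>: "\<And>c. f (\<iota> c) = \<iota>' c" and p: "\<And>i. i \<in> {1..l} \<Longrightarrow> p i \<in> carrier S"
  shows "f (central_scalars.antisym S \<iota> q p l) = central_scalars.antisym S' \<iota>' q (\<lambda>i. f (p i)) l"
proof -
  interpret S: central_scalars S \<iota> by (rule S)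
  interpret S': central_scalars S' \<iota>' by (rule S')
  interpret f: ring_hom_ring S S' f by (rule ring_hom_ringI2[OF S.ring_axioms S'.ring_axioms f])
  have smul: "f (S.smul c x) = S'.smul c (f x)" if "x \<in> carrier S" for c x
    using that by (simp add: S.smul_def S'.smul_def \<iota>)
  show ?thesis
    using p
  proof (induction l)
    case (Suc l)
    have "S.antisym q p l \<in> carrier S" "p (Suc l) \<in> carrier S"
      using Suc.prems by (auto intro!: S.antisym_closed)
    with Suc show ?case by (simp add: smul)
  qed simp
qed

text \<open>An algebra \<open>B\<close> over the field, in general noncommutative. Centrality of
  \<open>h c\<close> is what lets the numerical matrices obtained from operators on tensor powers
  move past entries of \<open>B\<close>.\<close>

locale scalar_extension = ring B for B (structure) +
  fixes h :: "'k::field \<Rightarrow> 'a"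
  assumes h_hom: "h \<in> ring_hom base B"
    and h_central: "x \<in> carrier B \<Longrightarrow> x \<otimes> h c = h c \<otimes> x"
begin

lemma h_closed [simp]: "h c \<in> carrier B"
  using ring_hom_closed[OF h_hom, of c] by simp

lemma h_simps: "h (c * d) = h c \<otimes> h d" "h (c + d) = h c \<oplus> h d" "h 1 = \<one>" "h 0 = \<zero>"
proof -
  interpret h: ring_hom_ring base B h
    by (rule ring_hom_ringI2[OF ring_ring_of_type_algebra ring_axioms h_hom])
  show "h (c * d) = h c \<otimes> h d" "h (c + d) = h c \<oplus> h d" "h 1 = \<one>" "h 0 = \<zero>"
    using h.hom_mult[of c d] h.hom_add[of c d] h.hom_one h.hom_zero by simp_all
qed

lemma h_sum: "h (sum f A) = (\<Oplus>a\<in>A. h (f a))"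
  using ring_hom_finsum[OF ring_ring_of_type_algebra ring_axioms h_hom, of f A] by (simp add: comp_def)

lemma map_h_hom:
  "map_tm N h \<in> ring_hom (tmat base N :: ('n::finite, 'k) tm ring) (tmat B N)"
  by (rule map_tm_hom[OF ring_ring_of_type_algebra ring_axioms h_hom])

lemma central_scalars_ext:
  "central_scalars (tmat B N :: ('n::finite, 'a) tm ring) (\<lambda>c. scal B N (h c))"
proof -
  interpret T: ring "tmat B N :: ('n, 'a) tm ring" by (rule tmat_ring)
  show ?thesis
  proof unfold_locales
    show "(\<lambda>c. scal B N (h c)) \<in> ring_hom base (tmat B N)"
      using ring_hom_trans[OF h_hom scal_hom, of N] by (simp add: comp_def)
    fix x :: "('n, 'a) tm" and c assume "x \<in> carrier (tmat B N)"
    then show "x \<otimes>\<^bsub>tmat B N\<^esub> scal B N (h c) = scal B N (h c) \<otimes>\<^bsub>tmat B N\<^esub> x"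
      by (rule scal_central[OF h_closed _ h_central[symmetric], symmetric])
  qed
qed

lemma map_h_units:
  fixes Y :: "('n::finite, 'k) tm"
  assumes "Y \<in> Units (tmat base 2)" "1 \<le> i" "Suc i \<le> N"
  shows "leg base 2 N i Y \<in> Units (tmat base N)" "map_tm N h (leg base 2 N i Y) \<in> Units (tmat B N)"
proof -
  interpret K: ring "base :: 'k ring" by (rule ring_ring_of_type_algebra)
  define p where "p = i - 1"
  have N: "N = p + 2 + (N - p - 2)" "i = Suc p" using assms by (auto simp: p_def)
  show "leg base 2 N i Y \<in> Units (tmat base N)"
    unfolding N(2) by (rule ring_hom_Units[OF K.tmat_ring K.tmat_ring K.leg_hom[OF N(1)] assms(1)])
  then show "map_tm N h (leg base 2 N i Y) \<in> Units (tmat B N)"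
    by (rule ring_hom_Units[OF K.tmat_ring tmat_ring map_h_hom])
qed

text \<open>For \<open>i \<ge> 2\<close> the operator \<open>R_i\<close> avoids the first factor and
  its entries become central, so it commutes with \<open>Y\<close> in that factor. The reflection
  equation is moved from two factors to \<open>Suc n\<close> factors by \<open>leg\<close>, the
  other relations from the field to \<open>B\<close> by \<open>map_tm\<close>.\<close>

lemma barred_copies_tmat:
  fixes R :: "('n::finite, 'k) tm" and Y :: "('n, 'a) tm"
  assumes R: "R_matrix R" and Y: "Y \<in> carrier (tmat B 1)"
    and reflection: "map_tm 2 h R \<otimes>\<^bsub>tmat B 2\<^esub> leg B 1 2 1 Y \<otimes>\<^bsub>tmat B 2\<^esub> map_tm 2 h R \<otimes>\<^bsub>tmat B 2\<^esub> leg B 1 2 1 Y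
      = leg B 1 2 1 Y \<otimes>\<^bsub>tmat B 2\<^esub> map_tm 2 h R \<otimes>\<^bsub>tmat B 2\<^esub> leg B 1 2 1 Y \<otimes>\<^bsub>tmat B 2\<^esub> map_tm 2 h R"
  shows "barred_copies (tmat B (Suc n)) (\<lambda>i. map_tm (Suc n) h (leg base 2 (Suc n) i R)) (leg B 1 (Suc n) 1 Y) n"
proof -
  interpret K: ring "base :: 'k ring" by (rule ring_ring_of_type_algebra)
  let ?N = "Suc n"
  let ?T = "tmat B ?N :: ('n, 'a) tm ring"
  let ?g = "\<lambda>i. map_tm ?N h (leg base 2 ?N i R)"
  interpret T: monoid ?T by (rule ring.is_monoid[OF tmat_ring])
  have RU: "R \<in> Units (tmat base 2)" using R by (simp only: R_matrix_def)
  then have Rc: "R \<in> carrier (tmat base 2)" by (rule monoid.Units_closed[OF ring.is_monoid[OF K.tmat_ring]])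
  have leg_c: "leg base 2 ?N i R \<in> carrier (tmat base ?N)" if "i \<in> {1..n}" for i
    using map_h_units(1)[OF RU, of i ?N] that by (intro monoid.Units_closed[OF ring.is_monoid[OF K.tmat_ring]]) auto
  have mult: "?g i \<otimes>\<^bsub>?T\<^esub> ?g j = map_tm ?N h (leg base 2 ?N i R \<otimes>\<^bsub>tmat base ?N\<^esub> leg base 2 ?N j R)"
    if "i \<in> {1..n}" "j \<in> {1..n}" for i j
    using ring_hom_mult[OF map_h_hom leg_c[OF that(1)] leg_c[OF that(2)]] by simp
  have mult3: "?g i \<otimes>\<^bsub>?T\<^esub> ?g j \<otimes>\<^bsub>?T\<^esub> ?g k
      = map_tm ?N h (leg base 2 ?N i R \<otimes>\<^bsub>tmat base ?N\<^esub> leg base 2 ?N j R \<otimes>\<^bsub>tmat base ?N\<^esub> leg base 2 ?N k R)"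
    if "i \<in> {1..n}" "j \<in> {1..n}" "k \<in> {1..n}" for i j k
    unfolding mult[OF that(1,2)]
    by (rule ring_hom_mult[OF map_h_hom K.tmat_mult_closed[OF leg_c[OF that(1)] leg_c[OF that(2)]] leg_c[OF that(3)], symmetric])
  have g_leg: "?g i = leg B 2 ?N i (map_tm 2 h R)" if "i \<in> {1..n}" for i
    using map_tm_leg[OF K.ring_axioms ring_axioms h_hom, of ?N "i - 1" 2 "n - i" R] that by simp
  have hR: "map_tm 2 h R \<in> carrier (tmat B 2)" by (rule map_tm_closed[OF h_hom Rc])
  show ?thesis
  proof unfold_locales
    fix i assume "i \<in> {1..n}"
    then show "?g i \<in> Units ?T" by (intro map_h_units(2)[OF RU]) auto
  next
    fix i assume i: "1 \<le> i" "i < n"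
    then show "?g i \<otimes>\<^bsub>?T\<^esub> ?g (Suc i) \<otimes>\<^bsub>?T\<^esub> ?g i = ?g (Suc i) \<otimes>\<^bsub>?T\<^esub> ?g i \<otimes>\<^bsub>?T\<^esub> ?g (Suc i)"
      using leg_braid[OF R, of i ?N] by (simp add: mult3)
  next
    fix i j assume ij: "1 \<le> i" "Suc i < j" "j \<le> n"
    have "leg base 2 ?N i R \<otimes>\<^bsub>tmat base ?N\<^esub> leg base 2 ?N j R = leg base 2 ?N j R \<otimes>\<^bsub>tmat base ?N\<^esub> leg base 2 ?N i R"
      using ij Rc by (intro K.leg_commute) (auto simp: mult.commute)
    then show "?g i \<otimes>\<^bsub>?T\<^esub> ?g j = ?g j \<otimes>\<^bsub>?T\<^esub> ?g i"
      using ij by (simp add: mult)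
  next
    show "leg B 1 ?N 1 Y \<in> carrier ?T"
      using leg_closed[of ?N 0 1 n Y] Y by simp
  next
    fix i assume i: "2 \<le> i" "i \<le> n"
    have "leg B 1 ?N 1 Y \<otimes>\<^bsub>?T\<^esub> leg B 2 ?N i (map_tm 2 h R) = leg B 2 ?N i (map_tm 2 h R) \<otimes>\<^bsub>?T\<^esub> leg B 1 ?N 1 Y"
    proof (rule leg_commute)
      fix I J I' J' :: "'n list" assume "I \<in> idx 1" "J \<in> idx 1" "I' \<in> idx 2" "J' \<in> idx 2"
      then show "Y (I, J) \<otimes> map_tm 2 h R (I', J') = map_tm 2 h R (I', J') \<otimes> Y (I, J)"
        using Y h_central by (simp add: map_tm_def)
    qed (use i Y hR in auto)
    then show "?g i \<otimes>\<^bsub>?T\<^esub> leg B 1 ?N 1 Y = leg B 1 ?N 1 Y \<otimes>\<^bsub>?T\<^esub> ?g i"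
      using g_leg[of i] i by simp
  next
    assume n: "1 \<le> n"
    have N: "?N = 0 + 2 + (n - 1)" using n by simp
    interpret \<phi>: ring_hom_ring "tmat B 2 :: ('n, 'a) tm ring" ?T "leg B 2 ?N (Suc 0)"
      by (rule ring_hom_ringI2[OF tmat_ring tmat_ring leg_hom[OF N]])
    define Y1 where "Y1 = leg B 1 2 1 Y"
    have Y1: "Y1 \<in> carrier (tmat B 2)"
      using leg_closed[of 2 0 1 1 Y] Y by (simp add: Y1_def)
    have "leg B 2 ?N (Suc 0) Y1 = leg B 1 ?N 1 Y"
      using leg_leg[OF N, of 0 1 1 Y] Y by (simp add: Y1_def)
    moreover have "leg B 2 ?N (Suc 0) (map_tm 2 h R) = ?g 1"
      using g_leg[of 1] n by simp
    ultimately show "?g 1 \<otimes>\<^bsub>?T\<^esub> leg B 1 ?N 1 Y \<otimes>\<^bsub>?T\<^esub> ?g 1 \<otimes>\<^bsub>?T\<^esub> leg B 1 ?N 1 Y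
        = leg B 1 ?N 1 Y \<otimes>\<^bsub>?T\<^esub> ?g 1 \<otimes>\<^bsub>?T\<^esub> leg B 1 ?N 1 Y \<otimes>\<^bsub>?T\<^esub> ?g 1"
      using arg_cong[OF reflection[folded Y1_def], of "leg B 2 ?N (Suc 0)"] Y1 hR by simp
  qed
qed

end

section \<open>The quantum determinant and the inverse matrix\<close>

context scalar_extension
begin

text \<open>When \<open>P\<close> is the product of the barred copies of \<open>Y\<close>, \<open>det\<close> is the quantum determinant of \<open>Y\<close>.\<close>

lemma rank_one_determinant:
  fixes P A C :: "('n::finite, _) tm"
  assumes P: "P \<in> carrier (tmat B m)" and A: "A \<in> carrier (tmat base m)" and C: "C \<in> carrier (tmat base m)"
    and uv: "\<And>I J. I \<in> idx m \<Longrightarrow> J \<in> idx m \<Longrightarrow> A (I, J) = u I * v J"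
    and idem: "A \<otimes>\<^bsub>tmat base m\<^esub> A = A"
    and comm: "map_tm m h A \<otimes>\<^bsub>tmat B m\<^esub> P = P \<otimes>\<^bsub>tmat B m\<^esub> map_tm m h A"
    and unit: "tr B m (map_tm m h C \<otimes>\<^bsub>tmat B m\<^esub> P \<otimes>\<^bsub>tmat B m\<^esub> map_tm m h A) \<in> Units B"
  obtains det where "det \<in> Units B"
    "\<And>I J. I \<in> idx m \<Longrightarrow> J \<in> idx m \<Longrightarrow> (P \<otimes>\<^bsub>tmat B m\<^esub> map_tm m h A) (I, J) = h (u I * v J) \<otimes> det"
proof -
  interpret T: ring "tmat B m :: ('n, 'a) tm ring" by (rule tmat_ring)
  let ?T = "tmat B m :: ('n, 'a) tm ring"
  define Ah where "Ah = map_tm m h A"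
  have Ah: "Ah \<in> carrier ?T" and Ch: "map_tm m h C \<in> carrier ?T"
    using map_tm_closed[OF h_hom A] map_tm_closed[OF h_hom C] by (simp_all add: Ah_def)
  have Ahe: "Ah (I, J) = h (u I * v J)" if "I \<in> idx m" "J \<in> idx m" for I J
    using that by (simp add: Ah_def map_tm_def uv)
  have AA: "Ah \<otimes>\<^bsub>?T\<^esub> Ah = Ah"
    using ring_hom_mult[OF map_h_hom A A] by (simp add: Ah_def idem)
  \<comment> \<open>Read as column and row, \<open>s\<close> is \<open>P u\<close> and
    \<open>det\<close> is \<open>v P u\<close>.\<close>
  define s where "s = (\<lambda>H. \<Oplus>K\<in>idx m. P (H, K) \<otimes> h (u K))"
  define det where "det = (\<Oplus>H\<in>idx m. h (v H) \<otimes> s H)"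
  have s: "s H \<in> carrier B" if "H \<in> idx m" for H
    unfolding s_def using that P by (intro finsum_closed) auto
  have det: "det \<in> carrier B"
    unfolding det_def using s by (intro finsum_closed) auto
  have PA: "(P \<otimes>\<^bsub>?T\<^esub> Ah) (H, J) = s H \<otimes> h (v J)" if HJ: "H \<in> idx m" "J \<in> idx m" for H J
  proof -
    have "(P \<otimes>\<^bsub>?T\<^esub> Ah) (H, J) = (\<Oplus>K\<in>idx m. P (H, K) \<otimes> h (u K) \<otimes> h (v J))"
      unfolding tmat_mult_entry[OF HJ] using HJ P
      by (intro finsum_cong') (auto simp: Ahe h_simps m_assoc)
    also have "\<dots> = s H \<otimes> h (v J)"
      unfolding s_def using HJ P by (intro finsum_ldistr[symmetric]) auto
    finally show ?thesis .
  qed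
  have entry: "(P \<otimes>\<^bsub>?T\<^esub> Ah) (I, J) = h (u I * v J) \<otimes> det" if IJ: "I \<in> idx m" "J \<in> idx m" for I J
  proof -
    \<comment> \<open>By idempotence and commutation \<open>P A = A P A\<close>. The left factor
      \<open>A = u v\<close> replaces the unknown column \<open>s\<close> by \<open>u\<close> times
      the single element \<open>det\<close>.\<close>
    have "P \<otimes>\<^bsub>?T\<^esub> Ah = P \<otimes>\<^bsub>?T\<^esub> (Ah \<otimes>\<^bsub>?T\<^esub> Ah)" by (simp only: AA)
    also have "\<dots> = Ah \<otimes>\<^bsub>?T\<^esub> (P \<otimes>\<^bsub>?T\<^esub> Ah)"
      using P Ah comm[folded Ah_def] by (simp flip: T.m_assoc)
    finally have "(P \<otimes>\<^bsub>?T\<^esub> Ah) (I, J) = (\<Oplus>H\<in>idx m. Ah (I, H) \<otimes> (P \<otimes>\<^bsub>?T\<^esub> Ah) (H, J))"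
      using tmat_mult_entry[OF IJ] by metis
    also have "\<dots> = (\<Oplus>H\<in>idx m. h (u I * v J) \<otimes> (h (v H) \<otimes> s H))"
    proof (intro finsum_cong')
      fix H :: "'n list" assume H: "H \<in> idx m"
      have "Ah (I, H) \<otimes> (P \<otimes>\<^bsub>?T\<^esub> Ah) (H, J) = h (u I * v H) \<otimes> (h (v J) \<otimes> s H)"
        using H IJ s by (simp add: Ahe PA h_central)
      also have "\<dots> = h (u I * v H * v J) \<otimes> s H"
        using H s by (simp add: h_simps m_assoc)
      also have "u I * v H * v J = u I * v J * v H" by simp
      also have "h \<dots> \<otimes> s H = h (u I * v J) \<otimes> (h (v H) \<otimes> s H)"
        using H s by (simp add: h_simps m_assoc)
      finally show "Ah (I, H) \<otimes> (P \<otimes>\<^bsub>?T\<^esub> Ah) (H, J) = h (u I * v J) \<otimes> (h (v H) \<otimes> s H)" .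
    qed (use s in auto)
    also have "\<dots> = h (u I * v J) \<otimes> det"
      unfolding det_def using s by (intro finsum_rdistr[symmetric]) auto
    finally show ?thesis .
  qed
  \<comment> \<open>\<open>c\<close> is the trace of the numerical matrix \<open>C A\<close>. The
    trace in question then factors as \<open>h c \<otimes> det\<close>.\<close>
  define c where "c = (\<Sum>I\<in>idx m. \<Sum>J\<in>idx m. C (I, J) * (u J * v I))"
  define a where "a = tr B m (map_tm m h C \<otimes>\<^bsub>?T\<^esub> P \<otimes>\<^bsub>?T\<^esub> Ah)"
  have "a = (\<Oplus>I\<in>idx m. (map_tm m h C \<otimes>\<^bsub>?T\<^esub> (P \<otimes>\<^bsub>?T\<^esub> Ah)) (I, I))"
    unfolding a_def tr_def T.m_assoc[OF Ch P Ah] ..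
  also have "\<dots> = (\<Oplus>I\<in>idx m. h (\<Sum>J\<in>idx m. C (I, J) * (u J * v I)) \<otimes> det)"
  proof (intro finsum_cong')
    fix I :: "'n list" assume I: "I \<in> idx m"
    have "(map_tm m h C \<otimes>\<^bsub>?T\<^esub> (P \<otimes>\<^bsub>?T\<^esub> Ah)) (I, I) = (\<Oplus>J\<in>idx m. h (C (I, J) * (u J * v I)) \<otimes> det)"
      unfolding tmat_mult_entry[OF I I] using I det
      by (intro finsum_cong') (auto simp: map_tm_def entry h_simps m_assoc)
    also have "\<dots> = h (\<Sum>J\<in>idx m. C (I, J) * (u J * v I)) \<otimes> det"
      unfolding h_sum using det by (intro finsum_ldistr[symmetric]) auto
    finally show "(map_tm m h C \<otimes>\<^bsub>?T\<^esub> (P \<otimes>\<^bsub>?T\<^esub> Ah)) (I, I) = h (\<Sum>J\<in>idx m. C (I, J) * (u J * v I)) \<otimes> det" .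
  qed (use det in auto)
  also have "\<dots> = h c \<otimes> det"
    unfolding c_def h_sum[of _ "idx m :: 'n list set"] using det
    by (intro finsum_ldistr[symmetric]) auto
  finally have a: "a = h c \<otimes> det" .
  have aU: "a \<in> Units B" using unit by (simp add: a_def Ah_def)
  define e where "e = inv a"
  have e: "e \<in> carrier B" "a \<otimes> e = \<one>" "e \<otimes> a = \<one>" using aU by (simp_all add: e_def)
  \<comment> \<open>The candidate inverse of \<open>det\<close>. Since \<open>h c\<close> is
    central, it can be moved to either side of \<open>det\<close> and combined with it to
    \<open>a\<close>, which \<open>e\<close> inverts.\<close>
  define d where "d = h c \<otimes> e"
  have d: "d \<in> carrier B" using e by (simp add: d_def)
  have "det \<otimes> d = det \<otimes> h c \<otimes> e"
    unfolding d_def using det e(1) by (simp add: m_assoc)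
  then have det_d: "det \<otimes> d = \<one>"
    unfolding h_central[OF det] a[symmetric] e(2) .
  have "d \<otimes> det = e \<otimes> h c \<otimes> det"
    unfolding d_def h_central[OF e(1)] ..
  also have "\<dots> = \<one>"
    using det e(1,3) by (simp add: m_assoc flip: a)
  finally have d_det: "d \<otimes> det = \<one>" .
  have "det \<in> Units B"
    unfolding Units_def using det d det_d d_det by blast
  then show thesis
    using that entry by (simp add: Ah_def)
qed

text \<open>Fixing the column \<open>J\<^sub>0\<close> and contracting the last \<open>l\<close> row
  indices with \<open>w\<close> turns the \<open>right\<close> identity into \<open>Y Z = 1\<close>.
  Fixing the row \<open>I\<^sub>0\<close> and contracting the last \<open>l\<close> column indices
  with \<open>w'\<close> turns the \<open>left\<close> one into \<open>Z' Y = 1\<close>. The two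
  inverses are constructed independently because one does not imply the other over \<open>B\<close>;
  the scalar \<open>r\<close> leaves room for the eigenvalue of the permuting operator.\<close>

lemma first_factor_invertible:
  fixes P A Y :: "('n::finite, _) tm"
  assumes Y: "Y \<in> carrier (tmat B 1)"
    and det: "det \<in> Units B"
    and right: "y \<in> carrier (tmat B (Suc l))"
      "\<And>I J. I \<in> idx (Suc l) \<Longrightarrow> J \<in> idx (Suc l) \<Longrightarrow>
        (leg B 1 (Suc l) 1 Y \<otimes>\<^bsub>tmat B (Suc l)\<^esub> y) (I, J) = h (u I * v J) \<otimes> det"
    and left: "z \<in> carrier (tmat B (Suc l))"
      "\<And>I J. I \<in> idx (Suc l) \<Longrightarrow> J \<in> idx (Suc l) \<Longrightarrow>
        (z \<otimes>\<^bsub>tmat B (Suc l)\<^esub> leg B 1 (Suc l) 1 Y) (I, J) = h (r * (u I * v J)) \<otimes> det"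
    and nz: "r \<noteq> 0" "I\<^sub>0 \<in> idx (Suc l)" "u I\<^sub>0 \<noteq> 0" "J\<^sub>0 \<in> idx (Suc l)" "v J\<^sub>0 \<noteq> 0"
    and w: "\<And>a d. a \<in> idx 1 \<Longrightarrow> d \<in> idx 1 \<Longrightarrow> (\<Sum>K\<in>idx l. u (a @ K) * w K d) = (if a = d then 1 else 0)"
    and w': "\<And>b d. b \<in> idx 1 \<Longrightarrow> d \<in> idx 1 \<Longrightarrow> (\<Sum>H\<in>idx l. w' d H * v (b @ H)) = (if d = b then 1 else 0)"
  shows "Y \<in> Units (tmat B 1)"
proof -
  interpret E: ring "tmat B 1 :: ('n, 'a) tm ring" by (rule tmat_ring)
  let ?E = "tmat B 1 :: ('n, 'a) tm ring" and ?m = "Suc l"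
  have N: "?m = 0 + 1 + l" by simp
  have ext: "a @ K \<in> idx ?m" if "a \<in> idx 1" "K \<in> idx l" for a K :: "'n list"
    using that by (simp add: idx_def)
  have dets: "det \<in> carrier B" "inv det \<in> carrier B" using det by auto
  \<comment> \<open>Only the images of scalars are moved past \<open>det\<close>; it is never
    commuted with entries of \<open>Y\<close>.\<close>
  have cancel: "h x \<otimes> det \<otimes> (h x' \<otimes> inv det) = h (x * x')" for x x'
  proof -
    have "det \<otimes> (h x' \<otimes> inv det) = h x' \<otimes> (det \<otimes> inv det)"
      using dets h_central[of det x'] by (simp flip: m_assoc)
    then show ?thesis using det dets by (simp add: m_assoc h_simps)
  qed
  have cancel': "h x' \<otimes> inv det \<otimes> (h x \<otimes> det) = h (x' * x)" for x x'
  proof -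
    have "inv det \<otimes> (h x \<otimes> det) = h x \<otimes> (inv det \<otimes> det)"
      using dets h_central[of "inv det" x] by (simp flip: m_assoc)
    then show ?thesis using det dets by (simp add: m_assoc h_simps)
  qed
  let ?r = "\<lambda>d K. h (w K d / v J\<^sub>0) \<otimes> inv det"
  \<comment> \<open>Division by \<open>v J\<^sub>0\<close> and the inverse of \<open>det\<close>
    remove everything except \<open>u\<close> from column \<open>J\<^sub>0\<close>, and
    \<open>w\<close> inverts \<open>u\<close>.\<close>
  define Z where "Z = (\<lambda>(b, d)\<in>idx 1 \<times> idx 1. \<Oplus>K\<in>idx l. y (b @ K, J\<^sub>0) \<otimes> ?r d K)"
  have Zin: "y (b @ K, J\<^sub>0) \<otimes> ?r d K \<in> carrier B"
    if "b \<in> idx 1" "K \<in> idx l" for b K d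
    using right(1) that nz ext dets by simp
  have Z: "Z \<in> carrier ?E"
    using Zin by (auto simp: Z_def tmat_simps(1) intro!: finsum_closed)
  have YZ: "Y \<otimes>\<^bsub>?E\<^esub> Z = \<one>\<^bsub>?E\<^esub>"
  proof (rule tmat_eqI[where A = B])
    fix a d :: "'n list" assume ad: "a \<in> idx 1" "d \<in> idx 1"
    have rows: "(\<Oplus>b\<in>idx 1. Y (a, b) \<otimes> y (b @ K, J\<^sub>0)) = h (u (a @ K) * v J\<^sub>0) \<otimes> det" if K: "K \<in> idx l" for K
    proof -
      have "h (u (a @ K) * v J\<^sub>0) \<otimes> det = (\<Oplus>H\<in>idx ?m. leg B 1 ?m 1 Y (a @ K, H) \<otimes> y (H, J\<^sub>0))"
        using right(2)[OF ext[OF ad(1) K] nz(4)] tmat_mult_entry[OF ext[OF ad(1) K] nz(4)] by metis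
      also have "\<dots> = (\<Oplus>b\<in>idx 1. Y (a, b) \<otimes> y (b @ K, J\<^sub>0))"
        using leg_mult_left[OF N, of "[]" a K "\<lambda>H. y (H, J\<^sub>0)" Y] ad K Y right(1) nz(4)
        by (simp add: idx_def)
      finally show ?thesis by simp
    qed
    have "(Y \<otimes>\<^bsub>?E\<^esub> Z) (a, d) = (\<Oplus>b\<in>idx 1. Y (a, b) \<otimes> (\<Oplus>K\<in>idx l. y (b @ K, J\<^sub>0) \<otimes> ?r d K))"
      unfolding tmat_mult_entry[OF ad] using ad Y Zin
      by (intro finsum_cong') (auto simp: Z_def intro!: finsum_closed)
    also have "\<dots> = (\<Oplus>b\<in>idx 1. \<Oplus>K\<in>idx l. Y (a, b) \<otimes> y (b @ K, J\<^sub>0) \<otimes> ?r d K)"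
    proof (intro finsum_cong' refl)
      fix b :: "'n list" assume b: "b \<in> idx 1"
      have "Y (a, b) \<otimes> (\<Oplus>K\<in>idx l. y (b @ K, J\<^sub>0) \<otimes> ?r d K)
          = (\<Oplus>K\<in>idx l. Y (a, b) \<otimes> (y (b @ K, J\<^sub>0) \<otimes> ?r d K))"
        using ad b Y Zin by (intro finsum_rdistr) auto
      also have "\<dots> = (\<Oplus>K\<in>idx l. Y (a, b) \<otimes> y (b @ K, J\<^sub>0) \<otimes> ?r d K)"
        using ad b Y right(1) nz(4) ext dets by (intro finsum_cong') (auto simp: m_assoc)
      finally show "Y (a, b) \<otimes> (\<Oplus>K\<in>idx l. y (b @ K, J\<^sub>0) \<otimes> ?r d K)
          = (\<Oplus>K\<in>idx l. Y (a, b) \<otimes> y (b @ K, J\<^sub>0) \<otimes> ?r d K)" .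
    qed (use ad Y right(1) nz(4) ext dets in \<open>auto intro!: finsum_closed\<close>)
    also have "\<dots> = (\<Oplus>K\<in>idx l. \<Oplus>b\<in>idx 1. Y (a, b) \<otimes> y (b @ K, J\<^sub>0) \<otimes> ?r d K)"
      using ad Y right(1) nz(4) ext dets by (intro finsum_swap) auto
    also have "\<dots> = (\<Oplus>K\<in>idx l. h (u (a @ K) * w K d))"
    proof (intro finsum_cong' refl)
      fix K :: "'n list" assume K: "K \<in> idx l"
      have "(\<Oplus>b\<in>idx 1. Y (a, b) \<otimes> y (b @ K, J\<^sub>0) \<otimes> ?r d K)
          = (\<Oplus>b\<in>idx 1. Y (a, b) \<otimes> y (b @ K, J\<^sub>0)) \<otimes> ?r d K"
        using ad Y right(1) nz(4) ext K dets by (intro finsum_ldistr[symmetric]) auto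
      also have "\<dots> = h (u (a @ K) * w K d)"
        unfolding rows[OF K] cancel using nz(5) by simp
      finally show "(\<Oplus>b\<in>idx 1. Y (a, b) \<otimes> y (b @ K, J\<^sub>0) \<otimes> ?r d K) = h (u (a @ K) * w K d)" .
    qed auto
    also have "\<dots> = \<one>\<^bsub>?E\<^esub> (a, d)"
      unfolding h_sum[symmetric] w[OF ad] using ad by (simp add: h_simps tmat_simps(3))
    finally show "(Y \<otimes>\<^bsub>?E\<^esub> Z) (a, d) = \<one>\<^bsub>?E\<^esub> (a, d)" .
  qed (rule E.m_closed[OF Y Z] E.one_closed)+
  let ?k = "\<lambda>d K. h (w' d K / (r * u I\<^sub>0)) \<otimes> inv det"
  \<comment> \<open>The mirror image: \<open>inv det\<close> must now stand on the left, and
    dividing by \<open>r * u I\<^sub>0\<close> leaves \<open>v\<close>, which \<open>w'\<close>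
    inverts.\<close>
  define Z' where "Z' = (\<lambda>(d, a)\<in>idx 1 \<times> idx 1. \<Oplus>K\<in>idx l. ?k d K \<otimes> z (I\<^sub>0, a @ K))"
  have Zin': "?k d K \<otimes> z (I\<^sub>0, a @ K) \<in> carrier B" if "a \<in> idx 1" "K \<in> idx l" for a K d
    using left(1) that nz ext dets by simp
  have Z': "Z' \<in> carrier ?E"
    using Zin' by (auto simp: Z'_def tmat_simps(1) intro!: finsum_closed)
  have ZY: "Z' \<otimes>\<^bsub>?E\<^esub> Y = \<one>\<^bsub>?E\<^esub>"
  proof (rule tmat_eqI[where A = B])
    fix d b :: "'n list" assume db: "d \<in> idx 1" "b \<in> idx 1"
    have cols: "(\<Oplus>a\<in>idx 1. z (I\<^sub>0, a @ K) \<otimes> Y (a, b)) = h (r * (u I\<^sub>0 * v (b @ K))) \<otimes> det" if K: "K \<in> idx l" for K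
    proof -
      have "h (r * (u I\<^sub>0 * v (b @ K))) \<otimes> det = (\<Oplus>H\<in>idx ?m. z (I\<^sub>0, H) \<otimes> leg B 1 ?m 1 Y (H, b @ K))"
        using left(2)[OF nz(2) ext[OF db(2) K]] tmat_mult_entry[OF nz(2) ext[OF db(2) K]] by metis
      also have "\<dots> = (\<Oplus>a\<in>idx 1. z (I\<^sub>0, a @ K) \<otimes> Y (a, b))"
        using leg_mult_right[OF N, of "[]" b K "\<lambda>H. z (I\<^sub>0, H)" Y] db K Y left(1) nz(2)
        by (simp add: idx_def)
      finally show ?thesis by simp
    qed
    have "(Z' \<otimes>\<^bsub>?E\<^esub> Y) (d, b) = (\<Oplus>a\<in>idx 1. (\<Oplus>K\<in>idx l. ?k d K \<otimes> z (I\<^sub>0, a @ K)) \<otimes> Y (a, b))"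
      unfolding tmat_mult_entry[OF db] using db Y Zin'
      by (intro finsum_cong') (auto simp: Z'_def intro!: finsum_closed)
    also have "\<dots> = (\<Oplus>a\<in>idx 1. \<Oplus>K\<in>idx l. ?k d K \<otimes> (z (I\<^sub>0, a @ K) \<otimes> Y (a, b)))"
    proof (intro finsum_cong' refl)
      fix a :: "'n list" assume a: "a \<in> idx 1"
      have "(\<Oplus>K\<in>idx l. ?k d K \<otimes> z (I\<^sub>0, a @ K)) \<otimes> Y (a, b) = (\<Oplus>K\<in>idx l. ?k d K \<otimes> z (I\<^sub>0, a @ K) \<otimes> Y (a, b))"
        using db a Y Zin' by (intro finsum_ldistr) auto
      also have "\<dots> = (\<Oplus>K\<in>idx l. ?k d K \<otimes> (z (I\<^sub>0, a @ K) \<otimes> Y (a, b)))"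
        using db a Y left(1) nz(2) ext dets by (intro finsum_cong') (auto simp: m_assoc)
      finally show "(\<Oplus>K\<in>idx l. ?k d K \<otimes> z (I\<^sub>0, a @ K)) \<otimes> Y (a, b) = (\<Oplus>K\<in>idx l. ?k d K \<otimes> (z (I\<^sub>0, a @ K) \<otimes> Y (a, b)))" .
    qed (use db Y left(1) nz(2) ext dets in \<open>auto intro!: finsum_closed\<close>)
    also have "\<dots> = (\<Oplus>K\<in>idx l. \<Oplus>a\<in>idx 1. ?k d K \<otimes> (z (I\<^sub>0, a @ K) \<otimes> Y (a, b)))"
      using db Y left(1) nz(2) ext dets by (intro finsum_swap) auto
    also have "\<dots> = (\<Oplus>K\<in>idx l. h (w' d K * v (b @ K)))"
    proof (intro finsum_cong' refl)
      fix K :: "'n list" assume K: "K \<in> idx l"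
      have "(\<Oplus>a\<in>idx 1. ?k d K \<otimes> (z (I\<^sub>0, a @ K) \<otimes> Y (a, b))) = ?k d K \<otimes> (\<Oplus>a\<in>idx 1. z (I\<^sub>0, a @ K) \<otimes> Y (a, b))"
        using db Y left(1) nz(2) ext K dets by (intro finsum_rdistr[symmetric]) auto
      also have "\<dots> = h (w' d K * v (b @ K))"
        unfolding cols[OF K] cancel' using nz(1,3) by simp
      finally show "(\<Oplus>a\<in>idx 1. ?k d K \<otimes> (z (I\<^sub>0, a @ K) \<otimes> Y (a, b))) = h (w' d K * v (b @ K))" .
    qed auto
    also have "\<dots> = \<one>\<^bsub>?E\<^esub> (d, b)"
      unfolding h_sum[symmetric] w'[OF db(2,1)] using db by (simp add: h_simps tmat_simps(3))
    finally show "(Z' \<otimes>\<^bsub>?E\<^esub> Y) (d, b) = \<one>\<^bsub>?E\<^esub> (d, b)" .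
  qed (rule E.m_closed[OF Z' Y] E.one_closed)+
  have "Z' = Z' \<otimes>\<^bsub>?E\<^esub> (Y \<otimes>\<^bsub>?E\<^esub> Z)" unfolding YZ by (rule E.r_one[OF Z', symmetric])
  also have "\<dots> = Z" unfolding E.m_assoc[OF Z' Y Z, symmetric] ZY by (rule E.l_one[OF Z])
  finally have "Z' = Z" .
  then show ?thesis
    using YZ ZY Y Z unfolding Units_def by blast
qed

end

lemma (in central_scalars) annihilated_eigenvalue:
  assumes "x \<in> carrier S" "g \<in> carrier S" "x \<otimes> (g \<oplus> \<iota> c) = \<zero>"
  shows "x \<otimes> g = (- c) \<cdot> x"
proof -
  have "x \<otimes> g \<oplus> c \<cdot> x = \<zero>"
    using assms unfolding \<iota>_smul[of c] by (simp add: r_distr)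
  then have "\<ominus> (c \<cdot> x) = x \<otimes> g"
    using assms by (intro minus_equality) auto
  then show ?thesis
    using smul_minus[OF assms(1)] by simp
qed

text \<open>The factorisation of \<open>P\<close> with \<open>Y\<close> on the right involves the
  extra operator \<open>descent l\<close>. It disappears after multiplication by \<open>A\<close> on
  the left: \<open>A P = P A\<close>, and \<open>A\<close> absorbs \<open>descent l\<close> up to
  the nonzero scalar \<open>(- (1 / q)) ^ l\<close>. Both one-sided factorisations therefore lead to
  multiples of \<open>P A\<close>.\<close>

lemma reflection_matrix_Units:
  fixes R :: "('n::finite, 'k::field_char_0) tm" and Y :: "('n, 'b) tm"
  assumes GL: "GL_type R q (Suc l)" and ext: "scalar_extension B h" and Y: "Y \<in> carrier (tmat B 1)"
    and C: "C \<in> carrier (tmat base (Suc l))"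
    and reflection: "map_tm 2 h R \<otimes>\<^bsub>tmat B 2\<^esub> leg B 1 2 1 Y \<otimes>\<^bsub>tmat B 2\<^esub> map_tm 2 h R \<otimes>\<^bsub>tmat B 2\<^esub> leg B 1 2 1 Y
      = leg B 1 2 1 Y \<otimes>\<^bsub>tmat B 2\<^esub> map_tm 2 h R \<otimes>\<^bsub>tmat B 2\<^esub> leg B 1 2 1 Y \<otimes>\<^bsub>tmat B 2\<^esub> map_tm 2 h R"
    and unit: "tr B (Suc l) (map_tm (Suc l) h C \<otimes>\<^bsub>tmat B (Suc l)\<^esub>
        barred_copies.copies_prod (tmat B (Suc l)) (\<lambda>i. map_tm (Suc l) h (leg base 2 (Suc l) i R)) (leg B 1 (Suc l) 1 Y) l
        \<otimes>\<^bsub>tmat B (Suc l)\<^esub> map_tm (Suc l) h (asym q R (Suc l))) \<in> Units B"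
  shows "Y \<in> Units (tmat B 1)"
proof -
  interpret X: scalar_extension B h by (rule ext)
  interpret K: ring "base :: 'k ring" by (rule ring_ring_of_type_algebra)
  let ?m = "Suc l" and ?A = "asym q R (Suc l)"
  let ?S = "tmat base ?m :: ('n, 'k) tm ring" and ?T = "tmat B ?m :: ('n, 'b) tm ring"
  let ?g = "\<lambda>i. map_tm ?m h (leg base 2 ?m i R)" and ?x = "leg B 1 ?m 1 Y"
  have hecke: "Hecke_type R q" and idem: "?A \<otimes>\<^bsub>?S\<^esub> ?A = ?A"
    using GL unfolding GL_type_def by blast+
  have RM: "R_matrix R" using hecke unfolding Hecke_type_def by blast
  interpret S: hecke_algebra ?S "scal base ?m" q "hecke_gen R q ?m" l
    by (rule hecke_algebra_tmat[OF hecke])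
  interpret T: central_scalars ?T "\<lambda>c. scal B ?m (h c)"
    by (rule X.central_scalars_ext)
  interpret C: barred_copies ?T ?g ?x l
    by (rule X.barred_copies_tmat[OF RM Y reflection])
  have RU: "R \<in> Units (tmat base 2)" using RM by (simp only: R_matrix_def)
  have R: "R \<in> carrier (tmat base 2)"
    using RU by (rule monoid.Units_closed[OF ring.is_monoid[OF K.tmat_ring]])
  have A: "?A \<in> carrier ?S"
    using leg_asym[OF R S.q_nonzero] by blast
  have A_antisym: "?A = S.antisym q (hecke_gen R q ?m) l"
    using leg_asym[OF R S.q_nonzero, of l, THEN conjunct2, THEN spec[of _ ?m], THEN spec[of _ 0]]
      K.leg_full[OF A] by simp
  define Ah where "Ah = map_tm ?m h ?A"
  have Ah: "Ah \<in> carrier ?T"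
    unfolding Ah_def by (rule map_tm_closed[OF X.h_hom A])
  have map_scal: "map_tm ?m h (scal base ?m c) = scal B ?m (h c)" for c
    by (rule map_tm_scal[OF K.ring_axioms X.ring_axioms X.h_hom])
  have leg_c: "leg base 2 ?m i R \<in> carrier ?S" if "i \<in> {1..l}" for i
    using X.map_h_units(1)[OF RU, of i ?m] that by (intro S.Units_closed) auto
  have gen: "map_tm ?m h (hecke_gen R q ?m i) = ?g i \<oplus>\<^bsub>?T\<^esub> scal B ?m (h (1 / q))" if "i \<in> {1..l}" for i
    unfolding hecke_gen_def map_scal[symmetric]
    by (rule ring_hom_add[OF X.map_h_hom leg_c[OF that]]) (simp add: K.scal_closed)
  have gen_c: "map_tm ?m h (hecke_gen R q ?m i) \<in> carrier ?T" if "i \<in> {1..l}" for i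
    by (rule map_tm_closed[OF X.h_hom S.p_closed[OF that]])
  have Ah_antisym: "Ah = T.antisym q (\<lambda>i. map_tm ?m h (hecke_gen R q ?m i)) l"
    unfolding Ah_def A_antisym
    by (rule antisym_hom[OF S.central_scalars_axioms T.central_scalars_axioms X.map_h_hom map_scal S.p_closed])
  define P where "P = C.copies_prod l"
  have P: "P \<in> carrier ?T" unfolding P_def by (rule C.copies_prod_closed) simp
  \<comment> \<open>\<open>Ah\<close> is a word in the generators, each of which commutes with the
    product of the copies.\<close>
  have comm: "Ah \<otimes>\<^bsub>?T\<^esub> P = P \<otimes>\<^bsub>?T\<^esub> Ah"
    unfolding Ah_antisym
  proof (rule T.antisym_commute[OF P gen_c])
    fix i assume i: "i \<in> {1..l}"
    show "map_tm ?m h (hecke_gen R q ?m i) \<otimes>\<^bsub>?T\<^esub> P = P \<otimes>\<^bsub>?T\<^esub> map_tm ?m h (hecke_gen R q ?m i)"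
      unfolding gen[OF i] P_def
      by (rule T.commute_shift[OF P[unfolded P_def] C.g_closed[OF i] C.copies_prod_commute[OF order_refl i, symmetric], symmetric])
  qed
  \<comment> \<open>Being killed by \<open>R_i + 1/q\<close> means being an eigenvector of
    \<open>R_i\<close> with eigenvalue \<open>- 1/q\<close>.\<close>
  have Ag: "Ah \<otimes>\<^bsub>?T\<^esub> ?g i = T.smul (- (1 / q)) Ah" if i: "i \<in> {1..l}" for i
  proof (rule T.annihilated_eigenvalue[OF Ah C.g_closed[OF i]])
    have "Ah \<otimes>\<^bsub>?T\<^esub> map_tm ?m h (hecke_gen R q ?m i) = map_tm ?m h (?A \<otimes>\<^bsub>?S\<^esub> hecke_gen R q ?m i)"
      unfolding Ah_def by (rule ring_hom_mult[OF X.map_h_hom A S.p_closed[OF i], symmetric])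
    also have "\<dots> = map_tm ?m h \<zero>\<^bsub>?S\<^esub>"
      unfolding A_antisym using S.antisym_annihilates[OF order_refl i] by simp
    also have "\<dots> = \<zero>\<^bsub>?T\<^esub>"
      by (rule ring_hom_zero[OF X.map_h_hom S.ring_axioms T.ring_axioms])
    finally show "Ah \<otimes>\<^bsub>?T\<^esub> (?g i \<oplus>\<^bsub>?T\<^esub> scal B ?m (h (1 / q))) = \<zero>\<^bsub>?T\<^esub>"
      unfolding gen[OF i] .
  qed
  have descent: "Ah \<otimes>\<^bsub>?T\<^esub> C.descent k = T.smul ((- (1 / q)) ^ k) Ah" if "k \<le> l" for k
    using that
  proof (induction k)
    case 0
    then show ?case using Ah by simp
  next
    case (Suc k)
    have cl: "?g (Suc k) \<in> carrier ?T" "C.descent k \<in> carrier ?T"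
      using Suc.prems by (intro C.g_closed T.Units_closed C.descent_Units; simp)+
    have "Ah \<otimes>\<^bsub>?T\<^esub> C.descent (Suc k) = Ah \<otimes>\<^bsub>?T\<^esub> ?g (Suc k) \<otimes>\<^bsub>?T\<^esub> C.descent k"
      using cl Ah by (simp add: T.m_assoc)
    also have "Ah \<otimes>\<^bsub>?T\<^esub> ?g (Suc k) = T.smul (- (1 / q)) Ah"
      using Suc.prems by (intro Ag) auto
    also have "T.smul (- (1 / q)) Ah \<otimes>\<^bsub>?T\<^esub> C.descent k = T.smul (- (1 / q)) (Ah \<otimes>\<^bsub>?T\<^esub> C.descent k)"
      by (rule T.smul_mult(1)[OF Ah cl(2)])
    also have "\<dots> = T.smul ((- (1 / q)) ^ Suc k) Ah"
      using Suc Ah by simp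
    finally show ?case .
  qed
  obtain u v w w' I\<^sub>0 J\<^sub>0 where
    uv: "\<And>I J. I \<in> idx ?m \<Longrightarrow> J \<in> idx ?m \<Longrightarrow> ?A (I, J) = u I * v J"
    and nz: "I\<^sub>0 \<in> idx ?m" "u I\<^sub>0 \<noteq> 0" "J\<^sub>0 \<in> idx ?m" "v J\<^sub>0 \<noteq> 0"
    and w: "\<And>a d. a \<in> idx 1 \<Longrightarrow> d \<in> idx 1 \<Longrightarrow> (\<Sum>K\<in>idx l. u (a @ K) * w K d) = (if a = d then 1 else 0)"
    and w': "\<And>b d. b \<in> idx 1 \<Longrightarrow> d \<in> idx 1 \<Longrightarrow> (\<Sum>H\<in>idx l. w' d H * v (b @ H)) = (if d = b then 1 else 0)"
    by (rule GL_type_factor[OF GL]) (rule that, assumption+)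
  obtain det where det: "det \<in> Units B"
    and entry: "\<And>I J. I \<in> idx ?m \<Longrightarrow> J \<in> idx ?m \<Longrightarrow> (P \<otimes>\<^bsub>?T\<^esub> Ah) (I, J) = h (u I * v J) \<otimes>\<^bsub>B\<^esub> det"
    by (rule X.rank_one_determinant[OF P A C uv idem comm[unfolded Ah_def] unit[folded P_def], folded Ah_def])
      (assumption, assumption, rule that, assumption+)
  obtain y where y: "y \<in> carrier ?T" "P = ?x \<otimes>\<^bsub>?T\<^esub> y"
    using C.copies_prod_first[OF order_refl] unfolding P_def by blast
  obtain z where z: "z \<in> carrier ?T" "P \<otimes>\<^bsub>?T\<^esub> C.descent l = z \<otimes>\<^bsub>?T\<^esub> ?x"
    using C.copies_prod_last[OF order_refl] unfolding P_def by blast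
  have right: "?x \<otimes>\<^bsub>?T\<^esub> (y \<otimes>\<^bsub>?T\<^esub> Ah) = P \<otimes>\<^bsub>?T\<^esub> Ah"
    unfolding y(2) by (rule T.m_assoc[OF C.x_closed y(1) Ah, symmetric])
  have left: "(Ah \<otimes>\<^bsub>?T\<^esub> z) \<otimes>\<^bsub>?T\<^esub> ?x = T.smul ((- (1 / q)) ^ l) (P \<otimes>\<^bsub>?T\<^esub> Ah)"
  proof -
    have D: "C.descent l \<in> carrier ?T" by (intro T.Units_closed C.descent_Units) simp
    have "(Ah \<otimes>\<^bsub>?T\<^esub> z) \<otimes>\<^bsub>?T\<^esub> ?x = Ah \<otimes>\<^bsub>?T\<^esub> P \<otimes>\<^bsub>?T\<^esub> C.descent l"
      unfolding T.m_assoc[OF Ah z(1) C.x_closed] z(2)[symmetric] T.m_assoc[OF Ah P D] ..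
    also have "\<dots> = P \<otimes>\<^bsub>?T\<^esub> (Ah \<otimes>\<^bsub>?T\<^esub> C.descent l)"
      unfolding comm by (rule T.m_assoc[OF P Ah D])
    finally show ?thesis
      unfolding descent[OF order_refl] T.smul_mult(2)[OF P Ah] .
  qed
  have r: "(- (1 / q)) ^ l \<noteq> 0" using S.q_nonzero by simp
  show ?thesis
  proof (rule X.first_factor_invertible[OF Y det _ _ _ _ r nz w w'])
    show "y \<otimes>\<^bsub>?T\<^esub> Ah \<in> carrier ?T" "Ah \<otimes>\<^bsub>?T\<^esub> z \<in> carrier ?T"
      using y z Ah by simp_all
    fix I J :: "'n list" assume IJ: "I \<in> idx ?m" "J \<in> idx ?m"
    show "(?x \<otimes>\<^bsub>?T\<^esub> (y \<otimes>\<^bsub>?T\<^esub> Ah)) (I, J) = h (u I * v J) \<otimes>\<^bsub>B\<^esub> det"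
      unfolding right by (rule entry[OF IJ])
    show "(Ah \<otimes>\<^bsub>?T\<^esub> z \<otimes>\<^bsub>?T\<^esub> ?x) (I, J) = h ((- (1 / q)) ^ l * (u I * v J)) \<otimes>\<^bsub>B\<^esub> det"
      unfolding left T.smul_def X.scal_mult_entry(1)[OF X.h_closed T.m_closed[OF P Ah] IJ] entry[OF IJ]
        X.h_simps(1)[of "(- (1 / q)) ^ l"]
      by (rule X.m_assoc[OF X.h_closed X.h_closed X.Units_closed[OF det], symmetric])
  qed
qed

section \<open>Consequences of the reflection relations\<close>

text \<open>\<open>e\<close> is the central element belonging to the factor \<open>\<eta>\<close>.
  Moving \<open>M\<close> or \<open>L\<close> through \<open>W\<close> uses the mixed relation
  twice, once for a letter and once for an inverse, so that \<open>e\<close> appears with both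
  exponents. The relations for \<open>N\<close> then need only
  \<open>Q = inv R \<otimes> W \<otimes> inv R\<close> and the reflection equation for
  \<open>M\<close>.\<close>

lemma (in group) reflection_relations:
  assumes carr: "R \<in> carrier G" "M \<in> carrier G" "L \<in> carrier G" "e \<in> carrier G"
    and central: "\<And>x. x \<in> carrier G \<Longrightarrow> x \<otimes> e = e \<otimes> x"
    and MM: "R \<otimes> M \<otimes> R \<otimes> M = M \<otimes> R \<otimes> M \<otimes> R"
    and LL: "R \<otimes> L \<otimes> R \<otimes> L = L \<otimes> R \<otimes> L \<otimes> R"
    and LM: "R \<otimes> L \<otimes> R \<otimes> M = e \<otimes> (M \<otimes> R \<otimes> L \<otimes> inv R)"
    and Q_def: "Q = L \<otimes> inv M \<otimes> inv L \<otimes> M" and N_def: "N = inv M \<otimes> Q"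
  shows "R \<otimes> Q \<otimes> R \<otimes> M = M \<otimes> R \<otimes> Q \<otimes> R"
    and "R \<otimes> Q \<otimes> R \<otimes> Q = Q \<otimes> R \<otimes> Q \<otimes> R"
    and "R \<otimes> N \<otimes> R \<otimes> N = N \<otimes> R \<otimes> N \<otimes> R"
    and "inv R \<otimes> N \<otimes> R \<otimes> M = M \<otimes> inv R \<otimes> N \<otimes> R"
proof -
  let ?r = "inv R" and ?m = "inv M" and ?l = "inv L" and ?e = "inv e"
  have Q: "Q \<in> carrier G" and N: "N \<in> carrier G"
    using carr by (simp_all add: Q_def N_def)
  note [simp] = carr Q N
  have cancel [simp]: "a \<otimes> (inv a \<otimes> x) = x" "inv a \<otimes> (a \<otimes> x) = x"
    if "a \<in> carrier G" "x \<in> carrier G" for a x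
    using that by (simp_all flip: m_assoc)
  have central_left: "x \<otimes> (e \<otimes> y) = e \<otimes> (x \<otimes> y)" if "x \<in> carrier G" "y \<in> carrier G" for x y
    using that central[of x] by (simp flip: m_assoc)
  note cl = central_left[of R] central_left[of M] central_left[of L]
    central_left[of ?r] central_left[of ?m] central_left[of ?l] central_left[of ?e]
  have inv_central_left: "x \<otimes> (?e \<otimes> y) = ?e \<otimes> (x \<otimes> y)" if "x \<in> carrier G" "y \<in> carrier G" for x y
  proof -
    have "?e \<otimes> (x \<otimes> e) \<otimes> (?e \<otimes> y) = ?e \<otimes> (e \<otimes> x) \<otimes> (?e \<otimes> y)"
      by (simp only: central[OF that(1)])
    with that show ?thesis by (simp add: m_assoc)
  qed
  note inv_central = inv_central_left[of R] inv_central_left[of M] inv_central_left[of L]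
    inv_central_left[of ?r] inv_central_left[of ?m] inv_central_left[of ?l]
  \<comment> \<open>The mixed relation solved for \<open>M R L\<close>. This and the four facts
    after it are the rewriting rules for moving a letter or its inverse to the right.\<close>
  have LM': "M \<otimes> R \<otimes> L = ?e \<otimes> (R \<otimes> L \<otimes> R \<otimes> M \<otimes> R)"
    unfolding LM by (simp add: m_assoc)
  have commM: "R \<otimes> M \<otimes> R \<otimes> ?m = ?m \<otimes> R \<otimes> M \<otimes> R"
  proof -
    have "?m \<otimes> (R \<otimes> M \<otimes> R \<otimes> M) \<otimes> ?m = ?m \<otimes> (M \<otimes> R \<otimes> M \<otimes> R) \<otimes> ?m"
      by (simp only: MM)
    then show ?thesis by (simp add: m_assoc)
  qed
  have commL: "R \<otimes> L \<otimes> R \<otimes> ?l = ?l \<otimes> R \<otimes> L \<otimes> R"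
  proof -
    have "?l \<otimes> (R \<otimes> L \<otimes> R \<otimes> L) \<otimes> ?l = ?l \<otimes> (L \<otimes> R \<otimes> L \<otimes> R) \<otimes> ?l"
      by (simp only: LL)
    then show ?thesis by (simp add: m_assoc)
  qed
  have RMRl: "R \<otimes> M \<otimes> R \<otimes> ?l = e \<otimes> (?l \<otimes> ?r \<otimes> M \<otimes> R)"
  proof -
    have "?l \<otimes> ?r \<otimes> (R \<otimes> L \<otimes> R \<otimes> M) \<otimes> R \<otimes> ?l = ?l \<otimes> ?r \<otimes> (e \<otimes> (M \<otimes> R \<otimes> L \<otimes> ?r)) \<otimes> R \<otimes> ?l"
      by (simp only: LM)
    then show ?thesis by (simp add: m_assoc cl)
  qed
  have mRLR: "?m \<otimes> R \<otimes> L \<otimes> R = e \<otimes> (R \<otimes> L \<otimes> ?r \<otimes> ?m)"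
  proof -
    have "?m \<otimes> (R \<otimes> L \<otimes> R \<otimes> M) \<otimes> ?m = ?m \<otimes> (e \<otimes> (M \<otimes> R \<otimes> L \<otimes> ?r)) \<otimes> ?m"
      by (simp only: LM)
    then show ?thesis by (simp add: m_assoc cl)
  qed
  define W where "W = R \<otimes> Q \<otimes> R"
  have W [simp]: "W \<in> carrier G" by (simp add: W_def)
  have WM: "W \<otimes> M = M \<otimes> W"
  proof -
    \<comment> \<open>\<open>LM'\<close> produces \<open>?e\<close>, \<open>RMRl\<close> produces
      \<open>e\<close>, and the two cancel. The remaining \<open>M R M R\<close> is the reflection
      equation.\<close>
    have "M \<otimes> W = (M \<otimes> R \<otimes> L) \<otimes> (?m \<otimes> ?l \<otimes> M \<otimes> R)"
      by (simp add: W_def Q_def m_assoc)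
    also have "\<dots> = ?e \<otimes> (R \<otimes> L) \<otimes> (R \<otimes> M \<otimes> R \<otimes> ?m) \<otimes> (?l \<otimes> M \<otimes> R)"
      unfolding LM' by (simp add: m_assoc)
    also have "\<dots> = ?e \<otimes> (R \<otimes> L \<otimes> ?m) \<otimes> (R \<otimes> M \<otimes> R \<otimes> ?l) \<otimes> (M \<otimes> R)"
      unfolding commM by (simp add: m_assoc)
    also have "\<dots> = R \<otimes> L \<otimes> ?m \<otimes> ?l \<otimes> ?r \<otimes> (M \<otimes> R \<otimes> M \<otimes> R)"
      unfolding RMRl by (simp add: m_assoc cl)
    also have "\<dots> = W \<otimes> M"
      unfolding MM[symmetric] by (simp add: m_assoc W_def Q_def)
    finally show ?thesis by simp
  qed
  have WL: "W \<otimes> L = L \<otimes> W"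
  proof -
    \<comment> \<open>Again \<open>?e\<close> from \<open>LM'\<close> meets \<open>e\<close> from
      \<open>mRLR\<close>, and the reflection equation for \<open>L\<close> finishes.\<close>
    have "W \<otimes> L = R \<otimes> L \<otimes> ?m \<otimes> ?l \<otimes> (M \<otimes> R \<otimes> L)"
      by (simp add: W_def Q_def m_assoc)
    also have "\<dots> = ?e \<otimes> (R \<otimes> L \<otimes> ?m \<otimes> (?l \<otimes> R \<otimes> L \<otimes> R) \<otimes> M \<otimes> R)"
      unfolding LM' by (simp add: m_assoc inv_central)
    also have "\<dots> = ?e \<otimes> (R \<otimes> L \<otimes> (?m \<otimes> R \<otimes> L \<otimes> R) \<otimes> (?l \<otimes> M \<otimes> R))"
      unfolding commL[symmetric] by (simp add: m_assoc)
    also have "\<dots> = (R \<otimes> L \<otimes> R \<otimes> L) \<otimes> ?r \<otimes> ?m \<otimes> ?l \<otimes> M \<otimes> R"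
      unfolding mRLR by (simp add: m_assoc cl)
    also have "\<dots> = L \<otimes> W"
      unfolding LL by (simp add: m_assoc W_def Q_def)
    finally show ?thesis .
  qed
  have W_inv: "W \<otimes> inv a = inv a \<otimes> W" if "a \<in> carrier G" "W \<otimes> a = a \<otimes> W" for a
  proof -
    have "inv a \<otimes> (W \<otimes> a) \<otimes> inv a = inv a \<otimes> (a \<otimes> W) \<otimes> inv a"
      by (simp only: that(2))
    with that(1) show ?thesis by (simp add: m_assoc)
  qed
  have W_mult: "W \<otimes> (a \<otimes> b) = a \<otimes> b \<otimes> W"
    if "a \<in> carrier G" "b \<in> carrier G" "W \<otimes> a = a \<otimes> W" "W \<otimes> b = b \<otimes> W" for a b
  proof -
    have "W \<otimes> (a \<otimes> b) = a \<otimes> W \<otimes> b"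
      using that by (simp flip: m_assoc)
    with that show ?thesis by (simp add: m_assoc)
  qed
  have WQ: "W \<otimes> Q = Q \<otimes> W"
    unfolding Q_def by (intro W_mult W_inv WM WL) simp_all
  show "R \<otimes> Q \<otimes> R \<otimes> M = M \<otimes> R \<otimes> Q \<otimes> R"
    using WM by (simp add: W_def m_assoc)
  show "R \<otimes> Q \<otimes> R \<otimes> Q = Q \<otimes> R \<otimes> Q \<otimes> R"
    using WQ by (simp add: W_def m_assoc)
  have Q_W: "Q = ?r \<otimes> W \<otimes> ?r"
    by (simp add: W_def m_assoc)
  \<comment> \<open>The reflection equation for \<open>M\<close> with the word
    \<open>M R M R\<close> inverted: multiplying by \<open>?r \<otimes> ?m \<otimes> ?r\<close> on
    both sides moves \<open>M\<close> across it.\<close>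
  have mr: "?r \<otimes> ?m \<otimes> ?r \<otimes> M = M \<otimes> ?r \<otimes> ?m \<otimes> ?r"
  proof -
    have "?r \<otimes> ?m \<otimes> ?r \<otimes> (M \<otimes> R \<otimes> M \<otimes> R) \<otimes> ?r \<otimes> ?m \<otimes> ?r
        = ?r \<otimes> ?m \<otimes> ?r \<otimes> (R \<otimes> M \<otimes> R \<otimes> M) \<otimes> ?r \<otimes> ?m \<otimes> ?r"
      by (simp only: MM)
    then show ?thesis by (simp add: m_assoc)
  qed
  show "?r \<otimes> N \<otimes> R \<otimes> M = M \<otimes> ?r \<otimes> N \<otimes> R"
  proof -
    have "?r \<otimes> N \<otimes> R \<otimes> M = ?r \<otimes> ?m \<otimes> ?r \<otimes> (W \<otimes> M)"
      by (simp add: N_def Q_W m_assoc)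
    also have "\<dots> = (?r \<otimes> ?m \<otimes> ?r \<otimes> M) \<otimes> W"
      unfolding WM by (simp add: m_assoc)
    also have "\<dots> = M \<otimes> ?r \<otimes> N \<otimes> R"
      unfolding mr by (simp add: N_def Q_W m_assoc)
    finally show ?thesis .
  qed
  show "R \<otimes> N \<otimes> R \<otimes> N = N \<otimes> R \<otimes> N \<otimes> R"
  proof -
    have mRm: "R \<otimes> ?m \<otimes> ?r \<otimes> ?m = ?m \<otimes> ?r \<otimes> ?m \<otimes> R"
    proof -
      have "R \<otimes> ?m \<otimes> (?r \<otimes> ?m \<otimes> ?r \<otimes> M) \<otimes> ?m \<otimes> R = R \<otimes> ?m \<otimes> (M \<otimes> ?r \<otimes> ?m \<otimes> ?r) \<otimes> ?m \<otimes> R"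
        by (simp only: mr)
      then show ?thesis by (simp add: m_assoc)
    qed
    \<comment> \<open>Inserting \<open>?r \<otimes> R\<close> exposes \<open>W\<close> inside, and
      \<open>W\<close> commutes with the whole of \<open>N = ?m \<otimes> Q\<close>.\<close>
    have "R \<otimes> N \<otimes> R \<otimes> N = R \<otimes> ?m \<otimes> ?r \<otimes> (W \<otimes> (?m \<otimes> Q))"
      by (simp add: N_def W_def m_assoc)
    also have "W \<otimes> (?m \<otimes> Q) = ?m \<otimes> Q \<otimes> W"
      by (intro W_mult W_inv WM WQ) simp_all
    also have "R \<otimes> ?m \<otimes> ?r \<otimes> (?m \<otimes> Q \<otimes> W) = (R \<otimes> ?m \<otimes> ?r \<otimes> ?m) \<otimes> Q \<otimes> W"
      by (simp add: m_assoc)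
    also have "\<dots> = ?m \<otimes> ?r \<otimes> (?m \<otimes> W) \<otimes> ?r \<otimes> W"
      unfolding mRm by (simp add: Q_W m_assoc)
    also have "\<dots> = ?m \<otimes> ?r \<otimes> (W \<otimes> ?m) \<otimes> ?r \<otimes> W"
      by (simp only: W_inv[OF carr(2) WM])
    also have "\<dots> = N \<otimes> R \<otimes> N \<otimes> R"
      by (simp add: N_def m_assoc) (simp add: W_def m_assoc)
    finally show ?thesis .
  qed
qed

lemma (in monoid) reflection_relations_Units:
  assumes U: "R \<in> Units G" "M \<in> Units G" "L \<in> Units G" "e \<in> Units G"
    and central: "\<And>x. x \<in> carrier G \<Longrightarrow> x \<otimes> e = e \<otimes> x"
    and MM: "R \<otimes> M \<otimes> R \<otimes> M = M \<otimes> R \<otimes> M \<otimes> R"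
    and LL: "R \<otimes> L \<otimes> R \<otimes> L = L \<otimes> R \<otimes> L \<otimes> R"
    and LM: "R \<otimes> L \<otimes> R \<otimes> M = e \<otimes> (M \<otimes> R \<otimes> L \<otimes> inv R)"
    and Q_def: "Q = L \<otimes> inv M \<otimes> inv L \<otimes> M" and N_def: "N = inv M \<otimes> Q"
  shows "R \<otimes> Q \<otimes> R \<otimes> M = M \<otimes> R \<otimes> Q \<otimes> R"
    and "R \<otimes> Q \<otimes> R \<otimes> Q = Q \<otimes> R \<otimes> Q \<otimes> R"
    and "R \<otimes> N \<otimes> R \<otimes> N = N \<otimes> R \<otimes> N \<otimes> R"
    and "inv R \<otimes> N \<otimes> R \<otimes> M = M \<otimes> inv R \<otimes> N \<otimes> R"
proof -
  have inv: "inv\<^bsub>units_of G\<^esub> x = inv x" if "x \<in> Units G" for x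
    using that by (rule units_of_inv)
  interpret U: group "units_of G" by (rule units_group)
  note U' = U[folded units_of_carrier]
  have c: "x \<otimes>\<^bsub>units_of G\<^esub> e = e \<otimes>\<^bsub>units_of G\<^esub> x" if "x \<in> carrier (units_of G)" for x
    using that central[OF Units_closed] by (simp add: units_of_mult units_of_carrier)
  note rel = U.reflection_relations[OF U' c, unfolded units_of_mult inv[OF U(1)] inv[OF U(2)] inv[OF U(3)],
      OF _ MM LL LM Q_def N_def]
  show "R \<otimes> Q \<otimes> R \<otimes> M = M \<otimes> R \<otimes> Q \<otimes> R" "R \<otimes> Q \<otimes> R \<otimes> Q = Q \<otimes> R \<otimes> Q \<otimes> R"
    "R \<otimes> N \<otimes> R \<otimes> N = N \<otimes> R \<otimes> N \<otimes> R" "inv R \<otimes> N \<otimes> R \<otimes> M = M \<otimes> inv R \<otimes> N \<otimes> R"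
    by (rule rel; assumption)+
qed

section \<open>The algebra \<open>B\<^sub>r\<close>\<close>

lemma const_hom: "const \<in> ring_hom base (free :: ('g, 'k::field) free_alg ring)"
  by (rule ring_hom_memI) (simp_all add: const_def mult_single single_add)

lemma const_central: "const c * (x :: ('g, 'k::field) free_alg) = x * const c"
proof (induction x rule: Poly_Mapping.update_induct)
  case (update f a b)
  have "Poly_Mapping.update a b f = Poly_Mapping.single a b + f"
    using update(1) by (intro poly_mapping_eqI) (auto simp: Poly_Mapping.lookup_update Poly_Mapping.lookup_add Poly_Mapping.lookup_single Poly_Mapping.in_keys_iff when_def)
  moreover have "const c * Poly_Mapping.single a b = Poly_Mapping.single a b * const c"
    by (simp add: const_def mult_single mult.commute)
  ultimately show ?case
    using update(3) by (simp add: distrib_left distrib_right)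
qed simp

lemma ring_hom_minus:
  assumes "ring A" "ring A'" "f \<in> ring_hom A A'" "x \<in> carrier A" "y \<in> carrier A"
  shows "f (x \<ominus>\<^bsub>A\<^esub> y) = f x \<ominus>\<^bsub>A'\<^esub> f y"
proof -
  interpret f: ring_hom_ring A A' f by (rule ring_hom_ringI2[OF assms(1-3)])
  show ?thesis using assms(4,5) by (simp add: a_minus_def)
qed

text \<open>The defining relators of \<open>Br\<close> are the single entries of differences of
  matrices. Their vanishing in the quotient is turned back here into an equation between
  matrices.\<close>

lemma map_tm_eqI:
  assumes "ring A" "ring A'" "f \<in> ring_hom A A'"
    and "Y \<in> carrier (tmat A k :: ('n::finite, 'a) tm ring)" "Z \<in> carrier (tmat A k)"
    and "\<And>p. p \<in> idx k \<times> idx k \<Longrightarrow> f ((Y \<ominus>\<^bsub>tmat A k\<^esub> Z) p) = \<zero>\<^bsub>A'\<^esub>"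
  shows "map_tm k f Y = map_tm k f Z"
proof -
  have T: "ring (tmat A k :: ('n, 'a) tm ring)" by (rule ring.tmat_ring[OF assms(1)])
  interpret T': ring "tmat A' k :: ('n, 'c) tm ring" by (rule ring.tmat_ring[OF assms(2)])
  have f: "map_tm k f \<in> ring_hom (tmat A k :: ('n, 'a) tm ring) (tmat A' k)"
    by (rule map_tm_hom[OF assms(1-3)])
  have "map_tm k f Y \<ominus>\<^bsub>tmat A' k\<^esub> map_tm k f Z = map_tm k f (Y \<ominus>\<^bsub>tmat A k\<^esub> Z)"
    by (rule ring_hom_minus[OF T T'.ring_axioms f assms(4,5), symmetric])
  also have "\<dots> = \<zero>\<^bsub>tmat A' k\<^esub>"
    using assms(6) by (auto simp: map_tm_def tmat_simps(4) restrict_def fun_eq_iff)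
  finally show ?thesis
    using map_tm_closed[OF assms(3,4)] map_tm_closed[OF assms(3,5)] by (simp add: T'.r_right_minus_eq)
qed

lemma ordered_prod_Nil [simp]: "ordered_prod G [] = \<one>\<^bsub>G\<^esub>"
  and ordered_prod_Cons [simp]: "ordered_prod G (x # xs) = x \<otimes>\<^bsub>G\<^esub> ordered_prod G xs"
  by (simp_all add: ordered_prod_def)

lemma (in monoid) ordered_prod_closed: "set xs \<subseteq> carrier G \<Longrightarrow> ordered_prod G xs \<in> carrier G"
  by (induction xs) auto

lemma (in monoid) ordered_prod_snoc:
  "set xs \<subseteq> carrier G \<Longrightarrow> x \<in> carrier G \<Longrightarrow> ordered_prod G (xs @ [x]) = ordered_prod G xs \<otimes> x"
  by (induction xs) (auto simp: m_assoc ordered_prod_closed)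

lemma ring_hom_ordered_prod:
  assumes "ring A" "ring A'" "f \<in> ring_hom A A'" "set xs \<subseteq> carrier A"
  shows "f (ordered_prod A xs) = ordered_prod A' (map f xs)"
proof -
  interpret f: ring_hom_ring A A' f by (rule ring_hom_ringI2[OF assms(1-3)])
  show ?thesis
    using assms(4) by (induction xs) (auto simp: f.R.ordered_prod_closed)
qed

lemma (in barred_copies) ordered_prod_copies:
  "l \<le> n \<Longrightarrow> ordered_prod G (map copy [0..<Suc l]) = copies_prod l"
proof (induction l)
  case (Suc l)
  have "map copy [0..<Suc (Suc l)] = map copy [0..<Suc l] @ [copy (Suc l)]" by simp
  moreover have "set (map copy [0..<Suc l]) \<subseteq> carrier G"
    using Suc.prems by (auto intro!: copy_closed)
  moreover have "copy (Suc l) \<in> carrier G"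
    using Suc.prems by (rule copy_closed)
  ultimately show ?case
    using Suc by (simp only: ordered_prod_snoc copies_prod.simps Suc_leD)
qed (simp add: x_closed)

lemma tr_map_tm:
  assumes "ring A" "ring A'" "f \<in> ring_hom A A'" "Y \<in> carrier (tmat A k :: ('n::finite, 'a) tm ring)"
  shows "f (tr A k Y) = tr A' k (map_tm k f Y)"
proof -
  interpret f: ring_hom_ring A A' f by (rule ring_hom_ringI2[OF assms(1-3)])
  have "f (tr A k Y) = finsum A' (f \<circ> (\<lambda>I. Y (I, I))) (idx k)"
    unfolding tr_def using assms(4) by (intro ring_hom_finsum[OF assms(1-3)]) auto
  also have "\<dots> = tr A' k (map_tm k f Y)"
    unfolding tr_def using assms(4) by (intro f.S.finsum_cong') (auto simp: map_tm_def)
  finally show ?thesis .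
qed

section \<open>The elements \<open>a_m(X)\<close> under a homomorphism from the free algebra\<close>

lemma bar_closed:
  fixes R :: "('n::finite, 'k::field) tm" and Y :: "('n, ('g, 'k) free_alg) tm"
  assumes R: "R \<in> Units (tmat base 2)" and Y: "Y \<in> carrier (tmat free 1)"
  shows "k < m \<Longrightarrow> bar R m Y (Suc k) \<in> carrier (tmat free m)"
proof (induction k)
  case 0
  then show ?case
    using ring.leg_closed[OF ring_ring_of_type_algebra, of m 0 1 "m - 1" Y] Y by simp
next
  case (Suc k)
  interpret F: ring "free :: ('g, 'k) free_alg ring" by (rule ring_ring_of_type_algebra)
  interpret F: scalar_extension "free :: ('g, 'k) free_alg ring" const
    by unfold_locales (simp_all add: const_hom const_central)
  interpret K: monoid "tmat base m :: ('n, 'k) tm ring"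
    by (rule ring.is_monoid[OF ring.tmat_ring[OF ring_ring_of_type_algebra]])
  have leg: "leg base 2 m (Suc k) R \<in> Units (tmat base m)"
    using Suc.prems by (intro F.map_h_units(1)[OF R]) auto
  show ?case
    unfolding bar.simps Let_def
    using Suc by (intro F.tmat_mult_closed map_tm_closed[OF const_hom] K.Units_closed[OF leg] K.Units_inv_closed[OF leg]) auto
qed

text \<open>\<open>bar\<close> is formed in the free algebra, where the generating matrix satisfies
  no reflection equation. The theory of the copies applies only to its image under \<open>f\<close>,
  so the two recursions are compared there.\<close>

lemma map_bar:
  fixes R :: "('n::finite, 'k::field) tm" and Y :: "('n, ('g, 'k) free_alg) tm" and A :: "('a, 'b) ring_scheme"
  assumes R: "R \<in> Units (tmat base 2)" and Y: "Y \<in> carrier (tmat free 1)"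
    and A: "ring A" and f: "f \<in> ring_hom free A"
    and copies: "barred_copies (tmat A m) (\<lambda>i. map_tm m (f \<circ> const) (leg base 2 m i R)) (leg A 1 m 1 (map_tm 1 f Y)) n"
  shows "k < m \<Longrightarrow> map_tm m f (bar R m Y (Suc k))
    = barred_copies.copy (tmat A m) (\<lambda>i. map_tm m (f \<circ> const) (leg base 2 m i R)) (leg A 1 m 1 (map_tm 1 f Y)) k"
proof (induction k)
  case 0
  then show ?case
    using map_tm_leg[OF ring_ring_of_type_algebra A f, of m 0 1 "m - 1" Y]
    unfolding barred_copies.copy.simps(1)[OF copies] by simp
next
  case (Suc k)
  have F: "ring (free :: ('g, 'k) free_alg ring)" by (rule ring_ring_of_type_algebra)
  interpret F: scalar_extension "free :: ('g, 'k) free_alg ring" const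
    by (intro scalar_extension.intro scalar_extension_axioms.intro F const_hom) (simp add: const_central)
  have fc: "f \<circ> const \<in> ring_hom base A" by (rule ring_hom_trans[OF const_hom f])
  have TK: "ring (tmat base m :: ('n, 'k) tm ring)"
    by (rule ring.tmat_ring[OF ring_ring_of_type_algebra])
  have TF: "ring (tmat free m :: ('n, ('g, 'k) free_alg) tm ring)"
    by (rule ring.tmat_ring[OF ring_ring_of_type_algebra])
  have TA: "ring (tmat A m :: ('n, 'a) tm ring)" by (rule ring.tmat_ring[OF A])
  let ?f = "map_tm m f :: ('n, ('g, 'k) free_alg) tm \<Rightarrow> ('n, 'a) tm"
  have mf: "?f \<in> ring_hom (tmat free m) (tmat A m)" by (rule map_tm_hom[OF F A f])
  let ?r = "leg base 2 m (Suc k) R"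
  have leg: "?r \<in> Units (tmat base m)"
    using Suc.prems by (intro F.map_h_units(1)[OF R]) auto
  have legc: "?r \<in> carrier (tmat base m)" "inv\<^bsub>tmat base m\<^esub> ?r \<in> carrier (tmat base m)"
    using leg monoid.Units_closed[OF ring.is_monoid[OF TK]] monoid.Units_inv_closed[OF ring.is_monoid[OF TK]] by auto
  have c: "map_tm m const ?r \<in> carrier (tmat free m)" "map_tm m const (inv\<^bsub>tmat base m\<^esub> ?r) \<in> carrier (tmat free m)"
    "bar R m Y (Suc k) \<in> carrier (tmat free m)"
    using legc Suc.prems by (auto intro!: map_tm_closed[OF const_hom] bar_closed[OF R Y] simp del: bar.simps)
  have "?f (bar R m Y (Suc (Suc k))) = ?f (map_tm m const ?r) \<otimes>\<^bsub>tmat A m\<^esub> ?f (bar R m Y (Suc k))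
      \<otimes>\<^bsub>tmat A m\<^esub> ?f (map_tm m const (inv\<^bsub>tmat base m\<^esub> ?r))"
    unfolding bar.simps Let_def
    by (simp only: ring_hom_mult[OF mf] F.tmat_mult_closed c)
  also have "?f (map_tm m const (inv\<^bsub>tmat base m\<^esub> ?r)) = inv\<^bsub>tmat A m\<^esub> (map_tm m (f \<circ> const) ?r)"
    unfolding map_tm_comp by (rule ring_hom_Units(2)[OF TK TA map_tm_hom[OF ring_ring_of_type_algebra A fc] leg])
  finally show ?case
    using Suc by (simp only: barred_copies.copy.simps[OF copies] map_tm_comp Suc_lessD)
qed

lemma Cmat_closed: "Cmat R \<in> carrier (tmat base 1)"
  by (auto simp: Cmat_def ptr_def tmat_simps(1))

lemma map_a_elem:
  fixes R :: "('n::finite, 'k::field) tm" and Y :: "('n, ('g, 'k) free_alg) tm" and A :: "('a, 'b) ring_scheme"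
  defines "C l \<equiv> ordered_prod (tmat base (Suc l)) (map (\<lambda>i. leg base 1 (Suc l) i (Cmat R)) [1..<Suc l + 1])"
  assumes R: "R \<in> Units (tmat base 2)" and q: "q \<noteq> 0" and Y: "Y \<in> carrier (tmat free 1)"
    and A: "ring A" and f: "f \<in> ring_hom free A"
    and copies: "barred_copies (tmat A (Suc l)) (\<lambda>i. map_tm (Suc l) (f \<circ> const) (leg base 2 (Suc l) i R))
      (leg A 1 (Suc l) 1 (map_tm 1 f Y)) l"
  shows "C l \<in> carrier (tmat base (Suc l))"
    and "f (a_elem R q (Suc l) Y) = tr A (Suc l) (map_tm (Suc l) (f \<circ> const) (C l) \<otimes>\<^bsub>tmat A (Suc l)\<^esub>
      barred_copies.copies_prod (tmat A (Suc l)) (\<lambda>i. map_tm (Suc l) (f \<circ> const) (leg base 2 (Suc l) i R))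
        (leg A 1 (Suc l) 1 (map_tm 1 f Y)) l
      \<otimes>\<^bsub>tmat A (Suc l)\<^esub> map_tm (Suc l) (f \<circ> const) (asym q R (Suc l)))"
proof -
  let ?m = "Suc l"
  let ?TK = "tmat base ?m :: ('n, 'k) tm ring" and ?TF = "tmat free ?m :: ('n, ('g, 'k) free_alg) tm ring"
    and ?TA = "tmat A ?m :: ('n, 'a) tm ring"
  have KR: "ring (base :: 'k ring)" and F: "ring (free :: ('g, 'k) free_alg ring)"
    by (rule ring_ring_of_type_algebra)+
  have TK: "ring ?TK" by (rule ring.tmat_ring[OF KR])
  have TF: "ring ?TF" by (rule ring.tmat_ring[OF F])
  have TA: "ring ?TA" by (rule ring.tmat_ring[OF A])
  have mc: "map_tm ?m const \<in> ring_hom ?TK ?TF" by (rule map_tm_hom[OF KR F const_hom])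
  have mf: "map_tm ?m f \<in> ring_hom ?TF ?TA" by (rule map_tm_hom[OF F A f])
  let ?Cs = "map (\<lambda>i. leg base 1 ?m i (Cmat R)) [1..<?m + 1]"
  have Cs: "set ?Cs \<subseteq> carrier ?TK"
  proof -
    have "leg base 1 ?m i (Cmat R) \<in> carrier ?TK" if "i \<in> {1..?m}" for i
      using ring.leg_closed[OF KR, of ?m "i - 1" 1 "?m - i" "Cmat R"] Cmat_closed[of R] that by simp
    then show ?thesis by auto
  qed
  show C: "C l \<in> carrier ?TK"
    unfolding C_def by (rule monoid.ordered_prod_closed[OF ring.is_monoid[OF TK] Cs])
  have Rc: "R \<in> carrier (tmat base 2)"
    using R by (rule monoid.Units_closed[OF ring.is_monoid[OF ring.tmat_ring[OF KR]]])
  have asym: "asym q R ?m \<in> carrier ?TK"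
    using leg_asym[OF Rc q] by blast
  interpret C: barred_copies ?TA "\<lambda>i. map_tm ?m (f \<circ> const) (leg base 2 ?m i R)" "leg A 1 ?m 1 (map_tm 1 f Y)" l
    by (rule copies)
  have bars: "set (map (bar R ?m Y) [1..<?m + 1]) \<subseteq> carrier ?TF"
  proof -
    have "bar R ?m Y i \<in> carrier ?TF" if "i \<in> {1..?m}" for i
      using bar_closed[OF R Y, of "i - 1" ?m] that by (auto simp del: bar.simps)
    then show ?thesis by auto
  qed
  define Cf P where "Cf = ordered_prod ?TF (map (\<lambda>i. map_tm ?m const (leg base 1 ?m i (Cmat R))) [1..<?m + 1])"
    and "P = ordered_prod ?TF (map (bar R ?m Y) [1..<?m + 1])"
  have Cf: "Cf = map_tm ?m const (C l)"
    unfolding Cf_def C_def ring_hom_ordered_prod[OF TK TF mc Cs] by (simp only: map_map o_def)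
  have P: "P \<in> carrier ?TF"
    unfolding P_def by (rule monoid.ordered_prod_closed[OF ring.is_monoid[OF TF] bars])
  \<comment> \<open>Barred indices run from 1 to \<open>?m\<close>, the index of \<open>copy\<close>
    from 0 to \<open>l\<close>.\<close>
  have "[1..<?m + 1] = map Suc [0..<?m]"
    by (simp add: map_Suc_upt del: upt_Suc)
  then have "map (map_tm ?m f) (map (bar R ?m Y) [1..<?m + 1]) = map C.copy [0..<?m]"
    using map_bar[OF R Y A f copies] by (simp only: map_map o_def) (auto simp del: bar.simps upt_Suc)
  then have fP: "map_tm ?m f P = C.copies_prod l"
    unfolding P_def ring_hom_ordered_prod[OF TF TA mf bars]
    using C.ordered_prod_copies[OF order_refl] by simp
  have cl: "Cf \<in> carrier ?TF" "map_tm ?m const (asym q R ?m) \<in> carrier ?TF"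
    unfolding Cf by (rule map_tm_closed[OF const_hom C], rule map_tm_closed[OF const_hom asym])
  have "f (a_elem R q ?m Y) = f (tr free ?m (Cf \<otimes>\<^bsub>?TF\<^esub> P \<otimes>\<^bsub>?TF\<^esub> map_tm ?m const (asym q R ?m)))"
    unfolding a_elem_def Let_def Cf_def P_def ..
  also have "\<dots> = tr A ?m (map_tm ?m f (Cf \<otimes>\<^bsub>?TF\<^esub> P \<otimes>\<^bsub>?TF\<^esub> map_tm ?m const (asym q R ?m)))"
    by (rule tr_map_tm[OF F A f]) (intro ring.tmat_mult_closed[OF F] cl P)
  also have "map_tm ?m f (Cf \<otimes>\<^bsub>?TF\<^esub> P \<otimes>\<^bsub>?TF\<^esub> map_tm ?m const (asym q R ?m))
      = map_tm ?m f Cf \<otimes>\<^bsub>?TA\<^esub> C.copies_prod l \<otimes>\<^bsub>?TA\<^esub> map_tm ?m f (map_tm ?m const (asym q R ?m))"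
    by (simp only: ring_hom_mult[OF mf] ring.tmat_mult_closed[OF F] cl P fP)
  finally show "f (a_elem R q ?m Y) = tr A ?m (map_tm ?m (f \<circ> const) (C l) \<otimes>\<^bsub>?TA\<^esub> C.copies_prod l
      \<otimes>\<^bsub>?TA\<^esub> map_tm ?m (f \<circ> const) (asym q R ?m))"
    unfolding Cf map_tm_comp .
qed

section \<open>The quotient algebra and its relations\<close>

lemma ideal_Br: "ideal (Br_ideal R q m \<eta>) free"
  unfolding Br_ideal_def by (rule ring.genideal_ideal[OF ring_ring_of_type_algebra]) simp

lemma ring_Br: "ring (Br R q m \<eta>)"
  unfolding Br_def by (rule ideal.quotient_is_ring[OF ideal_Br])

lemma Br_class_hom: "Br_class R q m \<eta> \<in> ring_hom free (Br R q m \<eta>)"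
  unfolding Br_def Br_class_def[abs_def] by (rule ideal.rcos_ring_hom[OF ideal_Br])

lemma Br_class_relator:
  assumes "x \<in> Br_relators R q m \<eta>"
  shows "Br_class R q m \<eta> x = \<zero>\<^bsub>Br R q m \<eta>\<^esub>"
proof -
  interpret ideal "Br_ideal R q m \<eta>" free by (rule ideal_Br)
  have "x \<in> Br_ideal R q m \<eta>"
    unfolding Br_ideal_def using ring.genideal_self[OF ring_ring_of_type_algebra] assms by fastforce
  then have "Br_class R q m \<eta> x = Br_ideal R q m \<eta>"
    unfolding Br_class_def by (rule a_rcos_const)
  then show ?thesis by (simp add: Br_def FactRing_def)
qed

text \<open>Every element of the quotient is the class of an element of the free algebra, where
  multiples of the empty word are central.\<close>

lemma scalar_extension_Br: "scalar_extension (Br R q m \<eta>) (Br_class R q m \<eta> \<circ> const)"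
proof (intro scalar_extension.intro scalar_extension_axioms.intro)
  let ?f = "Br_class R q m \<eta>"
  show "ring (Br R q m \<eta>)" by (rule ring_Br)
  show "?f \<circ> const \<in> ring_hom base (Br R q m \<eta>)"
    by (rule ring_hom_trans[OF const_hom Br_class_hom])
  fix x c assume "x \<in> carrier (Br R q m \<eta>)"
  then obtain y where "x = ?f y"
    by (auto simp: Br_def FactRing_def A_RCOSETS_def' Br_class_def a_r_coset_def')
  then show "x \<otimes>\<^bsub>Br R q m \<eta>\<^esub> (?f \<circ> const) c = (?f \<circ> const) c \<otimes>\<^bsub>Br R q m \<eta>\<^esub> x"
    using ring_hom_mult[OF Br_class_hom, of y "const c"] ring_hom_mult[OF Br_class_hom, of "const c" y]
    by (simp add: const_central)
qed

lemma gen_mat_closed: "gen_mat G \<in> carrier (tmat free 1)"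
  by (auto simp: gen_mat_def tmat_simps(1))

text \<open>\<open>Q\<close> is the group commutator of \<open>L\<close> and the inverse of
  \<open>M\<close>, hence preserved by any unital homomorphism applied to units.\<close>

lemma ring_hom_commutator:
  assumes "ring A" "f \<in> ring_hom A A'" "ring A'" "L \<in> Units A" "M \<in> Units A"
  shows "f (L \<otimes>\<^bsub>A\<^esub> inv\<^bsub>A\<^esub> M \<otimes>\<^bsub>A\<^esub> inv\<^bsub>A\<^esub> L \<otimes>\<^bsub>A\<^esub> M)
      = f L \<otimes>\<^bsub>A'\<^esub> inv\<^bsub>A'\<^esub> (f M) \<otimes>\<^bsub>A'\<^esub> inv\<^bsub>A'\<^esub> (f L) \<otimes>\<^bsub>A'\<^esub> f M"
    and "x \<in> carrier A \<Longrightarrow> f (inv\<^bsub>A\<^esub> M \<otimes>\<^bsub>A\<^esub> x) = inv\<^bsub>A'\<^esub> (f M) \<otimes>\<^bsub>A'\<^esub> f x"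
proof -
  interpret A: ring A by (rule assms(1))
  note inv = ring_hom_Units(2)[OF assms(1,3,2), symmetric]
  show "f (L \<otimes>\<^bsub>A\<^esub> inv\<^bsub>A\<^esub> M \<otimes>\<^bsub>A\<^esub> inv\<^bsub>A\<^esub> L \<otimes>\<^bsub>A\<^esub> M)
      = f L \<otimes>\<^bsub>A'\<^esub> inv\<^bsub>A'\<^esub> (f M) \<otimes>\<^bsub>A'\<^esub> inv\<^bsub>A'\<^esub> (f L) \<otimes>\<^bsub>A'\<^esub> f M"
    unfolding inv[OF assms(4)] inv[OF assms(5)]
    using assms(4,5) by (simp add: ring_hom_mult[OF assms(2)] A.Units_closed)
  show "f (inv\<^bsub>A\<^esub> M \<otimes>\<^bsub>A\<^esub> x) = inv\<^bsub>A'\<^esub> (f M) \<otimes>\<^bsub>A'\<^esub> f x" if "x \<in> carrier A"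
    unfolding inv[OF assms(5)] using that assms(5) by (simp add: ring_hom_mult[OF assms(2)])
qed

text \<open>That \<open>L\<close> and \<open>M\<close> are units is part of the conclusion: the
  inverses occurring in \<open>Q\<close> and \<open>N\<close> denote the intended matrices only
  because of it.\<close>

theorem proposition11:
  fixes R :: "('n::finite, 'k::real_normed_field) tm" and q \<eta> :: 'k and m :: nat
  assumes "GL_type R q m" and "\<eta> \<noteq> 0"
  shows
    "let B = Br R q m \<eta>; cls = Br_class R q m \<eta>;
         E = (tmat B 1 :: ('n, _) tm ring); T = (tmat B 2 :: ('n, _) tm ring);
         R1 = map_tm 2 (\<lambda>c. cls (const c)) R;
         R1' = map_tm 2 (\<lambda>c. cls (const c)) (inv\<^bsub>tmat base 2\<^esub> R);
         L = map_tm 1 cls (gen_mat GenL); M = map_tm 1 cls (gen_mat GenM);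
         Q = L \<otimes>\<^bsub>E\<^esub> inv\<^bsub>E\<^esub> M \<otimes>\<^bsub>E\<^esub> inv\<^bsub>E\<^esub> L \<otimes>\<^bsub>E\<^esub> M;
         N = inv\<^bsub>E\<^esub> M \<otimes>\<^bsub>E\<^esub> Q;
         M1 = leg B 1 2 1 M; Q1 = leg B 1 2 1 Q; N1 = leg B 1 2 1 N
     in (L \<in> Units E \<and> M \<in> Units E) \<and>
        (R1 \<otimes>\<^bsub>T\<^esub> M1 \<otimes>\<^bsub>T\<^esub> R1 \<otimes>\<^bsub>T\<^esub> M1 \<ominus>\<^bsub>T\<^esub> M1 \<otimes>\<^bsub>T\<^esub> R1 \<otimes>\<^bsub>T\<^esub> M1 \<otimes>\<^bsub>T\<^esub> R1 = \<zero>\<^bsub>T\<^esub> \<and>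
         R1 \<otimes>\<^bsub>T\<^esub> Q1 \<otimes>\<^bsub>T\<^esub> R1 \<otimes>\<^bsub>T\<^esub> Q1 \<ominus>\<^bsub>T\<^esub> Q1 \<otimes>\<^bsub>T\<^esub> R1 \<otimes>\<^bsub>T\<^esub> Q1 \<otimes>\<^bsub>T\<^esub> R1 = \<zero>\<^bsub>T\<^esub> \<and>
         R1 \<otimes>\<^bsub>T\<^esub> Q1 \<otimes>\<^bsub>T\<^esub> R1 \<otimes>\<^bsub>T\<^esub> M1 \<ominus>\<^bsub>T\<^esub> M1 \<otimes>\<^bsub>T\<^esub> R1 \<otimes>\<^bsub>T\<^esub> Q1 \<otimes>\<^bsub>T\<^esub> R1 = \<zero>\<^bsub>T\<^esub>) \<and>
        (R1 \<otimes>\<^bsub>T\<^esub> M1 \<otimes>\<^bsub>T\<^esub> R1 \<otimes>\<^bsub>T\<^esub> M1 \<ominus>\<^bsub>T\<^esub> M1 \<otimes>\<^bsub>T\<^esub> R1 \<otimes>\<^bsub>T\<^esub> M1 \<otimes>\<^bsub>T\<^esub> R1 = \<zero>\<^bsub>T\<^esub> \<and>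
         R1 \<otimes>\<^bsub>T\<^esub> N1 \<otimes>\<^bsub>T\<^esub> R1 \<otimes>\<^bsub>T\<^esub> N1 \<ominus>\<^bsub>T\<^esub> N1 \<otimes>\<^bsub>T\<^esub> R1 \<otimes>\<^bsub>T\<^esub> N1 \<otimes>\<^bsub>T\<^esub> R1 = \<zero>\<^bsub>T\<^esub> \<and>
         R1' \<otimes>\<^bsub>T\<^esub> N1 \<otimes>\<^bsub>T\<^esub> R1 \<otimes>\<^bsub>T\<^esub> M1 \<ominus>\<^bsub>T\<^esub> M1 \<otimes>\<^bsub>T\<^esub> R1' \<otimes>\<^bsub>T\<^esub> N1 \<otimes>\<^bsub>T\<^esub> R1 = \<zero>\<^bsub>T\<^esub>)"
proof -
  have m: "m \<ge> 1" and hecke: "Hecke_type R q"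
    using assms(1) unfolding GL_type_def by blast+
  obtain l where l: "m = Suc l" using m by (cases m) auto
  have RM: "R_matrix R" and q: "q \<noteq> 0"
    using hecke unfolding Hecke_type_def generic_def by blast+
  have RU: "R \<in> Units (tmat base 2)" using RM by (simp only: R_matrix_def)
  define B where "B = Br R q m \<eta>"
  define cls where "cls = Br_class R q m \<eta>"
  define h where "h = cls \<circ> const"
  have h_eq: "h = (\<lambda>c. cls (const c))" by (simp only: h_def o_def)
  let ?F2 = "tmat free 2 :: ('n, ('n gens, 'k) free_alg) tm ring"
  let ?E = "tmat B 1 :: ('n, ('n gens, 'k) free_alg set) tm ring"
  let ?T = "tmat B 2 :: ('n, ('n gens, 'k) free_alg set) tm ring"
  have F: "ring (free :: ('n gens, 'k) free_alg ring)" and K: "ring (base :: 'k ring)"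
    by (rule ring_ring_of_type_algebra)+
  have B: "ring B" unfolding B_def by (rule ring_Br)
  have cls: "cls \<in> ring_hom free B" unfolding cls_def B_def by (rule Br_class_hom)
  have rel: "cls x = \<zero>\<^bsub>B\<^esub>" if "x \<in> Br_relators R q m \<eta>" for x
    unfolding cls_def B_def by (rule Br_class_relator[OF that])
  have ext: "scalar_extension B h"
    unfolding h_def cls_def B_def by (rule scalar_extension_Br)
  interpret X: scalar_extension B h by (rule ext)
  interpret T: ring ?T by (rule X.tmat_ring)
  have E: "ring ?E" by (rule X.tmat_ring)
  have F2: "ring ?F2" by (rule ring.tmat_ring[OF F])
  have f2: "map_tm 2 cls \<in> ring_hom ?F2 ?T" by (rule map_tm_hom[OF F B cls])
  have leg2: "leg B 1 2 1 \<in> ring_hom ?E ?T"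
    using X.leg_hom[of 2 0 1 1] by simp
  have leg_cls: "map_tm 2 cls (leg free 1 2 1 Y) = leg B 1 2 1 (map_tm 1 cls Y)"
    for Y :: "('n, ('n gens, 'k) free_alg) tm"
    using map_tm_leg[OF F B cls, of 2 0 1 1 Y] by simp
  define L M where "L = (gen_mat GenL :: ('n, ('n gens, 'k) free_alg) tm)"
    and "M = (gen_mat GenM :: ('n, ('n gens, 'k) free_alg) tm)"
  have L: "L \<in> carrier (tmat free 1)" and M: "M \<in> carrier (tmat free 1)"
    unfolding L_def M_def by (rule gen_mat_closed)+
  define R1 R1' where "R1 = (map_tm 2 const R :: ('n, ('n gens, 'k) free_alg) tm)"
    and "R1' = (map_tm 2 const (inv\<^bsub>tmat base 2\<^esub> R) :: ('n, ('n gens, 'k) free_alg) tm)"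
  define L1 M1 where "L1 = leg free 1 2 1 L" and "M1 = leg free 1 2 1 M"
  define e where "e = (scal free 2 (const \<eta>) :: ('n, ('n gens, 'k) free_alg) tm)"
  have TK: "monoid (tmat base 2 :: ('n, 'k) tm ring)"
    by (rule ring.is_monoid[OF ring.tmat_ring[OF K]])
  have cl: "R1 \<in> carrier ?F2" "R1' \<in> carrier ?F2" "L1 \<in> carrier ?F2" "M1 \<in> carrier ?F2" "e \<in> carrier ?F2"
  proof -
    show "R1 \<in> carrier ?F2" "R1' \<in> carrier ?F2"
      unfolding R1_def R1'_def
      by (rule map_tm_closed[OF const_hom monoid.Units_closed[OF TK RU]],
          rule map_tm_closed[OF const_hom monoid.Units_inv_closed[OF TK RU]])
    show "L1 \<in> carrier ?F2" "M1 \<in> carrier ?F2"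
      unfolding L1_def M1_def using ring.leg_closed[OF F, of 2 0 1 1] L M by simp_all
    show "e \<in> carrier ?F2"
      unfolding e_def by (rule ring.scal_closed[OF F]) simp
  qed
  note mult_closed = ring.tmat_mult_closed[OF F]
  \<comment> \<open>The names ending in \<open>1\<close> denote matrices over the free algebra,
    those ending in \<open>2\<close> their images over \<open>B\<close>, all in two tensor
    factors.\<close>
  define R2 R2' L2 M2 e2 where "R2 = map_tm 2 h R" and "R2' = map_tm 2 h (inv\<^bsub>tmat base 2\<^esub> R)"
    and "L2 = leg B 1 2 1 (map_tm 1 cls L)" and "M2 = leg B 1 2 1 (map_tm 1 cls M)"
    and "e2 = (scal B 2 (h \<eta>) :: ('n, ('n gens, 'k) free_alg set) tm)"
  have img: "map_tm 2 cls R1 = R2" "map_tm 2 cls R1' = R2'" "map_tm 2 cls L1 = L2" "map_tm 2 cls M1 = M2"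
    "map_tm 2 cls e = e2"
    unfolding R1_def R1'_def L1_def M1_def e_def R2_def R2'_def L2_def M2_def e2_def h_def
    by (simp_all only: map_tm_comp leg_cls map_tm_scal[OF F B cls] o_apply)
  let ?reflection = "\<lambda>Y. R1 \<otimes>\<^bsub>?F2\<^esub> Y \<otimes>\<^bsub>?F2\<^esub> R1 \<otimes>\<^bsub>?F2\<^esub> Y \<ominus>\<^bsub>?F2\<^esub> Y \<otimes>\<^bsub>?F2\<^esub> R1 \<otimes>\<^bsub>?F2\<^esub> Y \<otimes>\<^bsub>?F2\<^esub> R1"
  have relators: "?reflection M1 ` (idx 2 \<times> idx 2) \<subseteq> Br_relators R q m \<eta>"
      "?reflection L1 ` (idx 2 \<times> idx 2) \<subseteq> Br_relators R q m \<eta>"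
      "(R1 \<otimes>\<^bsub>?F2\<^esub> L1 \<otimes>\<^bsub>?F2\<^esub> R1 \<otimes>\<^bsub>?F2\<^esub> M1 \<ominus>\<^bsub>?F2\<^esub> e \<otimes>\<^bsub>?F2\<^esub> (M1 \<otimes>\<^bsub>?F2\<^esub> R1 \<otimes>\<^bsub>?F2\<^esub> L1 \<otimes>\<^bsub>?F2\<^esub> R1')) ` (idx 2 \<times> idx 2)
        \<subseteq> Br_relators R q m \<eta>"
      "{a_elem R q m L * gen InvL - 1, gen InvL * a_elem R q m L - 1,
        a_elem R q m M * gen InvM - 1, gen InvM * a_elem R q m M - 1} \<subseteq> Br_relators R q m \<eta>"
    unfolding Br_relators_def Let_def L_def M_def R1_def R1'_def L1_def M1_def e_def by blast+
  have eq: "map_tm 2 cls Y = map_tm 2 cls Z"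
    if "(Y \<ominus>\<^bsub>?F2\<^esub> Z) ` (idx 2 \<times> idx 2) \<subseteq> Br_relators R q m \<eta>" "Y \<in> carrier ?F2" "Z \<in> carrier ?F2" for Y Z
    by (rule map_tm_eqI[OF F B cls that(2,3)]) (use that(1) rel in blast)
  let ?reflects = "\<lambda>Y. R2 \<otimes>\<^bsub>?T\<^esub> Y \<otimes>\<^bsub>?T\<^esub> R2 \<otimes>\<^bsub>?T\<^esub> Y = Y \<otimes>\<^bsub>?T\<^esub> R2 \<otimes>\<^bsub>?T\<^esub> Y \<otimes>\<^bsub>?T\<^esub> R2"
  have MM: "?reflects M2"
    using eq[OF relators(1)] by (simp only: ring_hom_mult[OF f2] mult_closed cl img)
  have LL: "?reflects L2"
    using eq[OF relators(2)] by (simp only: ring_hom_mult[OF f2] mult_closed cl img)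
  have LM: "R2 \<otimes>\<^bsub>?T\<^esub> L2 \<otimes>\<^bsub>?T\<^esub> R2 \<otimes>\<^bsub>?T\<^esub> M2 = e2 \<otimes>\<^bsub>?T\<^esub> (M2 \<otimes>\<^bsub>?T\<^esub> R2 \<otimes>\<^bsub>?T\<^esub> L2 \<otimes>\<^bsub>?T\<^esub> R2')"
    using eq[OF relators(3)] by (simp only: ring_hom_mult[OF f2] mult_closed cl img)
  \<comment> \<open>The relators for the adjoined inverses come in both orders, so the class is
    inverted on both sides.\<close>
  have unit: "cls a \<in> Units B" if "a * b - 1 \<in> Br_relators R q m \<eta>" "b * a - 1 \<in> Br_relators R q m \<eta>" for a b
  proof -
    interpret c: ring_hom_ring free B cls by (rule ring_hom_ringI2[OF F B cls])
    have "cls x = \<one>\<^bsub>B\<^esub>" if "x - 1 \<in> Br_relators R q m \<eta>" for x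
    proof -
      have "cls x = cls ((x - 1) + 1)" by simp
      also have "\<dots> = cls (x - 1) \<oplus>\<^bsub>B\<^esub> cls 1" using c.hom_add[of "x - 1" 1] by simp
      also have "\<dots> = \<one>\<^bsub>B\<^esub>" using rel[OF that] c.hom_one by simp
      finally show ?thesis .
    qed
    from this[OF that(1)] this[OF that(2)] show ?thesis
      using c.hom_mult[of a b] c.hom_mult[of b a] c.hom_closed[of a] c.hom_closed[of b]
      unfolding Units_def by auto
  qed
  \<comment> \<open>Stated for a general \<open>Y\<close> because it serves \<open>L\<close> and
    \<open>M\<close> alike. The reflection equation in \<open>B\<close> must already be known, since
    it is what makes the barred copies commute with the \<open>R_i\<close>.\<close>
  have Units: "map_tm 1 cls Y \<in> Units ?E"
    if Y: "Y \<in> carrier (tmat free 1)" and a: "cls (a_elem R q m Y) \<in> Units B"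
      and YY: "?reflects (leg B 1 2 1 (map_tm 1 cls Y))"
    for Y :: "('n, ('n gens, 'k) free_alg) tm"
  proof -
    have Yc: "map_tm 1 cls Y \<in> carrier ?E" by (rule map_tm_closed[OF cls Y])
    note copies = X.barred_copies_tmat[OF RM Yc YY[unfolded R2_def], of l]
    note a_elem = map_a_elem[OF RU q Y B cls copies[unfolded h_def]]
    show ?thesis
      by (rule reflection_matrix_Units[OF assms(1)[unfolded l] ext Yc a_elem(1) YY[unfolded R2_def]])
        (use a a_elem(2) in \<open>simp only: l h_def\<close>)
  qed
  have LU: "map_tm 1 cls L \<in> Units ?E"
    by (rule Units[OF L _ LL[unfolded L2_def]]) (rule unit; use relators(4) in blast)
  have MU: "map_tm 1 cls M \<in> Units ?E"
    by (rule Units[OF M _ MM[unfolded M2_def]]) (rule unit; use relators(4) in blast)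
  have R2U: "R2 \<in> Units ?T" and R2': "R2' = inv\<^bsub>?T\<^esub> R2"
    unfolding R2_def R2'_def by (rule ring_hom_Units[OF ring.tmat_ring[OF K] T.ring_axioms X.map_h_hom RU])+
  have L2U: "L2 \<in> Units ?T" and M2U: "M2 \<in> Units ?T"
    unfolding L2_def M2_def by (rule ring_hom_Units(1)[OF E T.ring_axioms leg2], rule LU MU)+
  interpret cs: central_scalars ?T "\<lambda>c. scal B 2 (h c)" by (rule X.central_scalars_ext)
  \<comment> \<open>\<open>\<eta> \<noteq> 0\<close> makes the scalar matrix a central unit, as
    required of \<open>e\<close> in the group computation.\<close>
  have "\<eta> \<in> Units (base :: 'k ring)"
    unfolding Units_def using assms(2) by (auto intro!: exI[of _ "1 / \<eta>"])
  then have e2U: "e2 \<in> Units ?T"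
    unfolding e2_def by (rule ring_hom_Units(1)[OF K T.ring_axioms cs.\<iota>_hom])
  have e2c: "x \<otimes>\<^bsub>?T\<^esub> e2 = e2 \<otimes>\<^bsub>?T\<^esub> x" if "x \<in> carrier ?T" for x
    unfolding e2_def by (rule cs.\<iota>_central[OF that])
  define Q where "Q = map_tm 1 cls L \<otimes>\<^bsub>?E\<^esub> inv\<^bsub>?E\<^esub> (map_tm 1 cls M) \<otimes>\<^bsub>?E\<^esub> inv\<^bsub>?E\<^esub> (map_tm 1 cls L) \<otimes>\<^bsub>?E\<^esub> map_tm 1 cls M"
  define N where "N = inv\<^bsub>?E\<^esub> (map_tm 1 cls M) \<otimes>\<^bsub>?E\<^esub> Q"
  define Q2 N2 where "Q2 = leg B 1 2 1 Q" and "N2 = leg B 1 2 1 N"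
  have Em: "monoid ?E" by (rule ring.is_monoid[OF E])
  have Qc: "Q \<in> carrier ?E"
    unfolding Q_def using LU MU
    by (intro monoid.m_closed[OF Em] monoid.Units_closed[OF Em] monoid.Units_inv_Units[OF Em])
  have Nc: "N \<in> carrier ?E"
    unfolding N_def using MU Qc by (intro monoid.m_closed[OF Em] monoid.Units_inv_closed[OF Em])
  \<comment> \<open>\<open>leg\<close> preserves inverses of units, so the matrix \<open>Q\<close>
    in the first factor is the same word in \<open>L2\<close> and \<open>M2\<close>, and the
    relations can be computed inside \<open>?T\<close>.\<close>
  have Q2: "Q2 = L2 \<otimes>\<^bsub>?T\<^esub> inv\<^bsub>?T\<^esub> M2 \<otimes>\<^bsub>?T\<^esub> inv\<^bsub>?T\<^esub> L2 \<otimes>\<^bsub>?T\<^esub> M2"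
    unfolding Q2_def Q_def L2_def M2_def by (rule ring_hom_commutator(1)[OF E leg2 T.ring_axioms LU MU])
  have N2: "N2 = inv\<^bsub>?T\<^esub> M2 \<otimes>\<^bsub>?T\<^esub> Q2"
    unfolding N2_def N_def Q2_def M2_def by (rule ring_hom_commutator(2)[OF E leg2 T.ring_axioms LU MU Qc])
  have c2: "R2 \<in> carrier ?T" "R2' \<in> carrier ?T" "M2 \<in> carrier ?T" "Q2 \<in> carrier ?T" "N2 \<in> carrier ?T"
    using R2U M2U Qc Nc ring_hom_closed[OF leg2] unfolding R2' Q2_def N2_def by (simp_all only: T.Units_closed T.Units_inv_closed)
  note relations = T.reflection_relations_Units[OF R2U M2U L2U e2U e2c MM LL LM[unfolded R2'] Q2 N2, folded R2']
  have diff: "x \<ominus>\<^bsub>?T\<^esub> y = \<zero>\<^bsub>?T\<^esub>" if "x = y" "y \<in> carrier ?T" for x y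
    unfolding that(1) using that(2) by (simp add: T.r_right_minus_eq)
  show ?thesis
    unfolding Let_def cls_def[symmetric] B_def[symmetric] h_eq[symmetric] L_def[symmetric] M_def[symmetric]
      R2_def[symmetric] R2'_def[symmetric] Q_def[symmetric] N_def[symmetric] M2_def[symmetric]
      Q2_def[symmetric] N2_def[symmetric]
    by (intro conjI LU MU diff MM relations T.m_closed c2)
qed

end
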